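(* The semicircle distributions are not freely strongly unimodal; that is, for every $t>0$ the semicircle distribution $S(0,t)$ is not freely strongly unimodal.
   Context: Unimodality: a Borel measure $\mu$ on $\mathbb{R}$ is unimodal if there exist $a\in\mathbb{R}$ and a function $f\colon\mathbb{R}\to[0,\infty)$, non-decreasing on $(-\infty,a)$ and non-increasing on $(a,\infty)$, such that $\mu(dx)=\mu(\{a\})\delta_a+f(x)\,dx$. Free strong unimodality: a probability measure $\mu$ on $\mathbb{R}$ is freely strongly unimodal if $\mu\boxplus\nu$ is unimodal for all unimodal probability distributions $\nu$ on $\mathbb{R}$. Semicircle distribution: for $t>0$, $S(0,t)$ is the probability measure with density $\frac{1}{2\pi t}\sqrt{4t-x^2}$ on its support $[-2\sqrt t,2\sqrt t]$. Free convolution $\boxplus$: let $\mathbb{C}^{\pm}$ be the open upper/lower half-planes. For a probability measure $\mu$ on $\mathbb{R}$ let $G_\mu(z)=\int_{\mathbb{R}}\frac{1}{z-x}\,d\mu(x)$, $z\in\mathbb{C}^+$, be its Cauchy transform. For every $\gamma>0$ there exist $\alpha,\beta,\delta>0$ such that $G_\mu$ is univalent on $\{z\in\mathbb{C}^+: |\mathrm{Re}\,z|<\alpha\,\mathrm{Im}\,z,\ \mathrm{Im}\,z>\beta\}$ and the image of this set under $G_\mu$ contains $\{z\in\mathbb{C}^-: |\mathrm{Re}\,z|<\gamma|\mathrm{Im}\,z|,\ |z|<\delta\}$; on the latter set one has the right inverse $G_\mu^{-1}$ and defines the R-transform $R_\mu(z)=G_\mu^{-1}(z)-\frac1z$. For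 probability measures $\mu,\nu$ on $\mathbb{R}$, $\mu\boxplus\nu$ is the unique probability measure $\lambda$ on $\mathbb{R}$ with $R_\lambda(z)=R_\mu(z)+R_\nu(z)$ on the intersection of the domains of the three transforms. *)

theory Defs
  imports "HOL-Probability.Probability"
begin

definition unimodal :: "real measure \<Rightarrow> bool" where
  "unimodal M \<longleftrightarrow> sets M = sets borel \<and>
     (\<exists>(a::real) (f::real \<Rightarrow> real).
        (\<forall>x. 0 \<le> f x) \<and> mono_on {..<a} f \<and> antimono_on {a<..} f \<and>
        (\<forall>A\<in>sets borel.
           emeasure M A =
             emeasure M {a} * emeasure (return borel a) A
             + emeasure (density lborel (\<lambda>x. ennreal (f x))) A))"

definition semicircle :: "real \<Rightarrow> real measure" where
  "semicircle t = density lborel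
     (\<lambda>x. ennreal (indicator {-2 * sqrt t..2 * sqrt t} x * (1 / (2 * pi * t) * sqrt (4 * t - x\<^sup>2))))"

definition cauchy_transform :: "real measure \<Rightarrow> complex \<Rightarrow> complex" where
  "cauchy_transform M z = (LINT x|M. 1 / (z - complex_of_real x))"

definition upper_cone :: "real \<Rightarrow> real \<Rightarrow> complex set" where
  "upper_cone \<alpha> \<beta> = {z. 0 < Im z \<and> \<bar>Re z\<bar> < \<alpha> * Im z \<and> \<beta> < Im z}"

definition lower_cone :: "real \<Rightarrow> real \<Rightarrow> complex set" where
  "lower_cone \<gamma> \<delta> = {z. Im z < 0 \<and> \<bar>Re z\<bar> < \<gamma> * \<bar>Im z\<bar> \<and> cmod z < \<delta>}"

definition cauchy_invertible ::
    "real measure \<Rightarrow> real \<Rightarrow> real \<Rightarrow> real \<Rightarrow> real \<Rightarrow> bool" where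
  "cauchy_invertible M \<gamma> \<alpha> \<beta> \<delta> \<longleftrightarrow>
     0 < \<gamma> \<and> 0 < \<alpha> \<and> 0 < \<beta> \<and> 0 < \<delta> \<and>
     inj_on (cauchy_transform M) (upper_cone \<alpha> \<beta>) \<and>
     lower_cone \<gamma> \<delta> \<subseteq> cauchy_transform M ` upper_cone \<alpha> \<beta>"

text \<open>
  The inverse of the Cauchy transform on a lower cone does not depend on the parameters: any two
  such inverses are holomorphic and asymptotic to \<open>1 / z\<close> at the vertex, so they agree close to the
  vertex and the imaginary axis by injectivity, hence on the (convex) intersection of the two lower cones.  Therefore the
  R-transform is a single function on the union of all admissible lower cones, and the definite
  description below is well defined there for every probability measure.
\<close>

definition R_domain :: "real measure \<Rightarrow> complex set" where
  "R_domain M = {z. \<exists>\<gamma> \<alpha> \<beta> \<delta>. cauchy_invertible M \<gamma> \<alpha> \<beta> \<delta> \<and> z \<in> lower_cone \<gamma> \<delta>}"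

definition R_transform :: "real measure \<Rightarrow> complex \<Rightarrow> complex" where
  "R_transform M z =
     (THE w. \<exists>\<gamma> \<alpha> \<beta> \<delta>. cauchy_invertible M \<gamma> \<alpha> \<beta> \<delta> \<and> z \<in> lower_cone \<gamma> \<delta> \<and>
        w = inv_into (upper_cone \<alpha> \<beta>) (cauchy_transform M) z - 1 / z)"

definition free_convolution :: "real measure \<Rightarrow> real measure \<Rightarrow> real measure"
    (infixl \<open>\<boxplus>\<close> 65) where
  "M \<boxplus> N =
     (THE L. real_distribution L \<and>
        (\<forall>z \<in> R_domain M \<inter> R_domain N \<inter> R_domain L.
           R_transform L z = R_transform M z + R_transform N z))"

definition freely_strongly_unimodal :: "real measure \<Rightarrow> bool" where
  "freely_strongly_unimodal M \<longleftrightarrow>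
     (\<forall>N. real_distribution N \<longrightarrow> unimodal N \<longrightarrow> unimodal (M \<boxplus> N))"

end

theory Submission
  imports Defs "HOL-Complex_Analysis.Complex_Analysis" "HOL-Real_Asymp.Real_Asymp"
begin

text \<open>
  Following Biane, put \<open>H w = w + t * G\<^sub>\<nu> w\<close> and let \<open>\<omega>\<close> be the inverse of \<open>H\<close> on the part of
  the closed upper half-plane where \<open>\<integral> d\<nu>(x) / |w - x|\<^sup>2 \<le> 1 / t\<close>.  Then \<open>G\<^sub>\<nu> \<circ> \<omega>\<close> is the Cauchy
  transform of \<open>S(0,t) \<boxplus> \<nu>\<close>, and at a boundary point \<open>w\<close> of this region the free convolution has
  density \<open>Im w / (\<pi> t)\<close> at the real point \<open>H w\<close>, which increases with \<open>Re w\<close>.  So the density is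
  unimodal only if the boundary curve has no strict dip, i.e. only if the Poisson smoothing of
  \<open>\<nu>\<close> at each height \<open>c\<close> has no strict dip across the level fixed by \<open>c\<close> and \<open>t\<close>.  The Cauchy
  kernel is not log-concave: for an atom of weight \<open>3/103\<close> at the left end of a uniform
  distribution on \<open>[0, 100 c]\<close>, the smoothing at height \<open>c\<close> is larger at \<open>0\<close> and at \<open>50 c\<close> than at
  \<open>4 c\<close>, and \<open>c\<close> is scaled so that \<open>1 / t\<close> lies in between.
\<close>

section \<open>Cauchy transforms\<close>

text \<open>\<open>M \<boxplus> N\<close> is a definite description, so nothing is known about it
  until one measure with the right R-transform is exhibited and shown to be the only one. Existence
  is settled for the measure at hand by recovering a function on the half-plane from its boundary
  values; uniqueness rests on Stieltjes inversion. Continuity up to the real axis is the delicate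
  point, since the Cauchy transform blows up at an atom. It holds because every short subinterval of
  [0, l] carries mass at least proportional to its length: a bounded energy then forces a fixed
  distance from [0, l], and the whole closed region avoids the singularities. The dip comes from
  comparing tails. At height c and abscissa s c the energy is 3/(s^2 + 1) + arctan s + arctan (100 -
  s), up to the factor 1/(103 c^2). The bump of the atom decays like 1/s^2, but the deficit pi/2 -
  arctan s at the edge of the uniform part only like 1/s. So the sum undershoots its plateau, which
  lies close to pi, before rising to it; the level pi - 1/20 separates the value at 4 from those at
  0 and 50.\<close>

lemma norm_LINT_le:
  fixes f :: "'a \<Rightarrow> 'b :: {banach, second_countable_topology}"
  assumes "integrable M g" "f \<in> borel_measurable M" "AE x in M. norm (f x) \<le> g x"
  shows "norm (LINT x|M. f x) \<le> (LINT x|M. g x)"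
proof -
  have "integrable M f"
    using assms(3) by (intro Bochner_Integration.integrable_bound[OF assms(1,2)]) auto
  then have "(LINT x|M. norm (f x)) \<le> (LINT x|M. g x)"
    by (intro integral_mono_AE integrable_norm assms)
  then show ?thesis using integral_norm_bound[of M f] by linarith
qed

context real_distribution
begin

lemma cauchy_kernel_integrable:
  assumes "0 < d" "AE x in M. d \<le> cmod (z - of_real x)"
  shows "integrable M (\<lambda>x. 1 / (z - complex_of_real x))"
proof (rule integrable_const_bound[where B = "1 / d"])
  show "AE x in M. cmod (1 / (z - complex_of_real x)) \<le> 1 / d"
    using assms(2) by eventually_elim (use assms(1) in \<open>auto simp: norm_divide frac_le\<close>)
qed auto

lemma cauchy_kernel_prod_integrable:
  assumes "0 < d" "AE x in M. d \<le> cmod (z - of_real x)" "AE x in M. d \<le> cmod (w - of_real x)"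
  shows "integrable M (\<lambda>x. 1 / ((z - complex_of_real x) * (w - complex_of_real x)))"
proof (rule integrable_const_bound[where B = "1 / (d * d)"])
  show "AE x in M. cmod (1 / ((z - complex_of_real x) * (w - complex_of_real x))) \<le> 1 / (d * d)"
    using assms(2,3)
    by eventually_elim (use assms(1) in \<open>auto simp: norm_divide norm_mult intro!: frac_le mult_mono\<close>)
qed auto

lemma norm_cauchy_transform_le:
  assumes "0 < d" "AE x in M. d \<le> cmod (z - of_real x)"
  shows "cmod (cauchy_transform M z) \<le> 1 / d"
proof -
  have "cmod (cauchy_transform M z) \<le> (\<integral>x. 1 / d \<partial>M)"
    unfolding cauchy_transform_def
  proof (rule norm_LINT_le)
    show "AE x in M. cmod (1 / (z - complex_of_real x)) \<le> 1 / d"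
      using assms(2) by eventually_elim (use assms(1) in \<open>auto simp: norm_divide frac_le\<close>)
  qed auto
  then show ?thesis using prob_space by simp
qed

lemma cauchy_transform_diff:
  assumes "0 < d" "AE x in M. d \<le> cmod (z - of_real x)" "AE x in M. d \<le> cmod (w - of_real x)"
  shows "cauchy_transform M z - cauchy_transform M w
           = (w - z) * (LINT x|M. 1 / ((z - complex_of_real x) * (w - complex_of_real x)))"
proof -
  have "cauchy_transform M z - cauchy_transform M w
      = (LINT x|M. 1 / (z - complex_of_real x) - 1 / (w - complex_of_real x))"
    unfolding cauchy_transform_def
    by (rule Bochner_Integration.integral_diff[symmetric])
       (rule cauchy_kernel_integrable[OF assms(1)], fact)+
  also have "\<dots> = (LINT x|M. (w - z) * (1 / ((z - complex_of_real x) * (w - complex_of_real x))))"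
  proof (rule integral_cong_AE)
    show "AE x in M. 1 / (z - complex_of_real x) - 1 / (w - complex_of_real x)
            = (w - z) * (1 / ((z - complex_of_real x) * (w - complex_of_real x)))"
      using assms(2,3)
    proof eventually_elim
      case (elim x)
      then have "z - of_real x \<noteq> 0" "w - of_real x \<noteq> 0" using assms(1) by auto
      then show ?case by (simp add: field_simps)
    qed
  qed auto
  also have "\<dots> = (w - z) * (LINT x|M. 1 / ((z - complex_of_real x) * (w - complex_of_real x)))"
    by (rule integral_mult_right_zero)
  finally show ?thesis .
qed

text \<open>The difference quotient is exactly \<open>- K w\<close>, so only continuity of
  \<open>K\<close> at \<open>z\<close> is at stake. The hypothesis is a positive distance from
  almost every x instead of \<open>0 < Im z\<close>, because the closed region used later contains
  real points.\<close>

lemma cauchy_transform_field_differentiable: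
  assumes "0 < d" "AE x in M. d \<le> cmod (z - of_real x)"
  shows "cauchy_transform M field_differentiable at z"
proof -
  define K where "K w = (LINT x|M. 1 / ((w - complex_of_real x) * (z - complex_of_real x)))" for w
  have near: "AE x in M. d / 2 \<le> cmod (w - of_real x)" if "dist w z < d / 2" for w
    using assms(2)
  proof eventually_elim
    case (elim x)
    have "cmod (z - of_real x) \<le> cmod (w - of_real x) + dist w z"
      by (metis dist_norm norm_triangle_sub add.commute dist_commute dist_triangle)
    then show ?case using elim that by linarith
  qed
  have bound: "cmod (K w - K z) \<le> dist w z * (4 / d ^ 3)" if "dist w z < d / 2" for w
  proof -
    have iw: "integrable M (\<lambda>x. 1 / ((w - complex_of_real x) * (z - complex_of_real x)))"
      and iz: "integrable M (\<lambda>x. 1 / ((z - complex_of_real x) * (z - complex_of_real x)))"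
      by (rule cauchy_kernel_prod_integrable[of "d/2"]; use near[OF that] near[of z] assms(1) in simp)+
    have "cmod (K w - K z) = cmod (LINT x|M. 1 / ((w - complex_of_real x) * (z - complex_of_real x))
              - 1 / ((z - complex_of_real x) * (z - complex_of_real x)))"
      unfolding K_def by (subst Bochner_Integration.integral_diff[OF iw iz]) simp
    also have "\<dots> \<le> (\<integral>x. dist w z * (4 / d ^ 3) \<partial>M)"
    proof (rule norm_LINT_le)
      show "AE x in M. cmod (1 / ((w - complex_of_real x) * (z - complex_of_real x))
              - 1 / ((z - complex_of_real x) * (z - complex_of_real x))) \<le> dist w z * (4 / d ^ 3)"
        using near[OF that] assms(2)
      proof eventually_elim
        case (elim x)
        then have nz: "w - of_real x \<noteq> 0" "z - of_real x \<noteq> 0" using assms(1) by auto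
        have "1 / ((w - complex_of_real x) * (z - complex_of_real x))
              - 1 / ((z - complex_of_real x) * (z - complex_of_real x))
            = (z - w) / ((w - of_real x) * (z - of_real x) * (z - of_real x))"
          using nz
        proof -
          have "1 / (a * b) - 1 / (b * b) = (b - a) / (a * b * b)" if "a \<noteq> 0" "b \<noteq> 0" for a b :: complex
            using that by (simp add: field_simps)
          from this[OF nz] show ?thesis by simp
        qed
        also have "cmod \<dots> = dist w z / (cmod (w - of_real x) * cmod (z - of_real x) * cmod (z - of_real x))"
          by (simp add: norm_divide norm_mult dist_norm norm_minus_commute)
        also have "\<dots> \<le> dist w z / ((d/2) * d * d)"
          using elim assms(1) by (intro divide_left_mono mult_mono mult_pos_pos) auto
        also have "\<dots> \<le> dist w z * (4 / d ^ 3)"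
          using assms(1) by (simp add: field_simps power3_eq_cube)
        finally show ?case .
      qed
    qed auto
    finally show ?thesis using prob_space by simp
  qed
  have "((\<lambda>w. K w) \<longlongrightarrow> K z) (at z)"
  proof (rule Lim_null_comparison[where g = "\<lambda>w. dist w z * (4 / d ^ 3)", THEN LIM_zero_cancel])
    have "\<forall>\<^sub>F w in at z. dist w z < d / 2"
      using assms(1) by (intro tendstoD tendsto_ident_at) auto
    then show "\<forall>\<^sub>F w in at z. cmod (K w - K z) \<le> dist w z * (4 / d ^ 3)"
      by eventually_elim (rule bound)
    have "((\<lambda>w. dist w z * (4 / d ^ 3)) \<longlongrightarrow> dist z z * (4 / d ^ 3)) (at z)"
      by (intro tendsto_intros)
    then show "((\<lambda>w. dist w z * (4 / d ^ 3)) \<longlongrightarrow> 0) (at z)" by simp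
  qed
  then have lim: "((\<lambda>w. - K w) \<longlongrightarrow> - K z) (at z)" by (intro tendsto_intros)
  have "((\<lambda>w. (cauchy_transform M w - cauchy_transform M z) / (w - z)) \<longlongrightarrow> - K z) (at z)"
  proof (rule Lim_transform_eventually[OF lim])
    have "\<forall>\<^sub>F w in at z. dist w z < d / 2"
      using assms(1) by (intro tendstoD tendsto_ident_at) auto
    moreover have "\<forall>\<^sub>F w in at z. w \<noteq> z" by (simp add: eventually_at_filter)
    ultimately show "\<forall>\<^sub>F w in at z. - K w = (cauchy_transform M w - cauchy_transform M z) / (w - z)"
    proof eventually_elim
      case (elim w)
      have "cauchy_transform M w - cauchy_transform M z = (z - w) * K w"
        unfolding K_def
        by (rule cauchy_transform_diff[of "d/2"]) (use near[OF elim(1)] near[of z] assms(1) in auto)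
      then show ?case using elim(2) by (simp add: field_simps)
    qed
  qed
  then have "(cauchy_transform M has_field_derivative - K z) (at z)"
    by (simp add: has_field_derivative_iff)
  then show ?thesis unfolding field_differentiable_def by blast
qed

lemma AE_Im_le_norm_diff: "AE x in M. Im z \<le> cmod (z - of_real x)"
proof (rule AE_I2)
  fix x show "Im z \<le> cmod (z - of_real x)"
    using abs_Im_le_cmod[of "z - of_real x"] by simp
qed

lemma cauchy_transform_holomorphic: "cauchy_transform M holomorphic_on {z. 0 < Im z}"
  unfolding holomorphic_on_def
  using cauchy_transform_field_differentiable[OF _ AE_Im_le_norm_diff] field_differentiable_at_within
  by blast

lemma inv_norm_square_integrable:
  assumes "0 < d" "AE x in M. d \<le> cmod (z - of_real x)"
  shows "integrable M (\<lambda>x. 1 / (cmod (z - complex_of_real x))\<^sup>2)"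
proof (rule integrable_const_bound[where B = "1 / d\<^sup>2"])
  show "AE x in M. norm (1 / (cmod (z - complex_of_real x))\<^sup>2) \<le> 1 / d\<^sup>2"
    using assms(2) by eventually_elim (use assms(1) in \<open>auto intro!: frac_le power_mono\<close>)
qed auto

lemma Im_cauchy_transform:
  assumes "0 < d" "AE x in M. d \<le> cmod (z - of_real x)"
  shows "Im (cauchy_transform M z) = - Im z * (LINT x|M. 1 / (cmod (z - complex_of_real x))\<^sup>2)"
proof -
  have "Im (cauchy_transform M z) = (LINT x|M. Im (1 / (z - complex_of_real x)))"
    unfolding cauchy_transform_def
    by (rule integral_Im[OF cauchy_kernel_integrable[OF assms], symmetric])
  also have "\<dots> = (LINT x|M. - Im z * (1 / (cmod (z - complex_of_real x))\<^sup>2))"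
    by (intro Bochner_Integration.integral_cong) (auto simp: Im_divide cmod_power2)
  also have "\<dots> = - Im z * (LINT x|M. 1 / (cmod (z - complex_of_real x))\<^sup>2)"
    by (rule integral_mult_right_zero)
  finally show ?thesis .
qed

lemma Im_cauchy_transform_neg:
  assumes "0 < Im z"
  shows "Im (cauchy_transform M z) < 0"
proof -
  have int: "integrable M (\<lambda>x. 1 / (cmod (z - complex_of_real x))\<^sup>2)"
    by (rule inv_norm_square_integrable[OF assms AE_Im_le_norm_diff])
  have "0 < (LINT x|M. 1 / (cmod (z - complex_of_real x))\<^sup>2)"
  proof -
    have "(LINT x|M. 1 / (cmod (z - complex_of_real x))\<^sup>2) \<noteq> 0"
    proof
      assume "(LINT x|M. 1 / (cmod (z - complex_of_real x))\<^sup>2) = 0"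
      then have "AE x in M. 1 / (cmod (z - complex_of_real x))\<^sup>2 = 0"
        using integral_nonneg_eq_0_iff_AE[OF int] by auto
      then have "AE x in M. False"
        using AE_Im_le_norm_diff[of z] by eventually_elim (use assms in auto)
      then show False by simp
    qed
    moreover have "0 \<le> (LINT x|M. 1 / (cmod (z - complex_of_real x))\<^sup>2)" by simp
    ultimately show ?thesis by linarith
  qed
  then show ?thesis
    using Im_cauchy_transform[OF assms AE_Im_le_norm_diff] assms by simp
qed

end

section \<open>Functions on the half-plane that are Cauchy transforms\<close>

text \<open>Cauchy's formula for F(\<zeta>)/(\<zeta> - z) on the rectangle [-R, R] x [0, R]. The
  three upper sides have total length 4 R and the integrand is at most C/(R (R - |z|)) there, so
  they contribute O(1/R). For z below the axis the integrand has no pole and the integral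
  vanishes.\<close>

lemma rectpath_integral_tendsto:
  fixes F :: "complex \<Rightarrow> complex"
  assumes cont: "continuous_on {z. 0 \<le> Im z} F"
    and hol: "F holomorphic_on {z. 0 < Im z}"
    and decay: "\<And>z. 0 \<le> Im z \<Longrightarrow> cmod (z * F z) \<le> C"
    and z: "Im z \<noteq> 0"
  shows "(\<lambda>n. integral {- real n..real n} (\<lambda>x. F (of_real x) / (of_real x - z)))
           \<longlonglongrightarrow> 2 * pi * \<i> * (if 0 < Im z then F z else 0)"
proof -
  define V where "V = 2 * pi * \<i> * (if 0 < Im z then F z else 0)"
  let ?H = "{z. 0 \<le> Im z}"
  define g where "g \<zeta> = F \<zeta> / (\<zeta> - z)" for \<zeta>
  have int_H: "interior ?H = {z. 0 < Im z}"
    using interior_halfspace_ge[of \<i> "0::real"] by (simp add: inner_complex_def)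
  have convH: "convex ?H" by (rule convex_halfspace_Im_ge)
  have fd: "F field_differentiable at x" if "x \<in> interior ?H" for x
    using hol that open_halfspace_Im_gt[of 0] unfolding int_H
    by (auto simp: holomorphic_on_open field_differentiable_def)
  have key: "cmod (integral {-R..R} (\<lambda>x. g (of_real x)) - V) \<le> 4 * C / (R - cmod z)"
    if R: "cmod z < R" for R :: real
  proof -
    have R0: "0 < R" using R norm_ge_zero[of z] by linarith
    define a1 a2 a3 a4 where a: "a1 = complex_of_real (-R)" "a2 = complex_of_real R"
      "a3 = Complex R R" "a4 = Complex (-R) R"
    have rect: "rectpath a1 a3 = linepath a1 a2 +++ linepath a2 a3 +++ linepath a3 a4 +++ linepath a4 a1"
      by (simp add: rectpath_def a Let_def complex_of_real_def)
    have im: "path_image (rectpath a1 a3) \<subseteq> ?H - {z}"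
      using R0 z R abs_Re_le_cmod[of z] abs_Im_le_cmod[of z]
      by (subst path_image_rectpath) (auto simp: a)
    have hc: "(g has_contour_integral V) (rectpath a1 a3)"
    proof (cases "0 < Im z")
      case True
      have "z \<in> box a1 a3"
        using True R abs_Re_le_cmod[of z] abs_Im_le_cmod[of z] by (auto simp: a in_box_complex_iff)
      then have wn: "winding_number (rectpath a1 a3) z = 1" by (rule winding_number_rectpath)
      have "(g has_contour_integral (2*pi * \<i> * winding_number (rectpath a1 a3) z * F z)) (rectpath a1 a3)"
        unfolding g_def using True im
        by (intro Cauchy_integral_formula_weak[OF convH, of "{}"] cont fd) (auto simp: int_H)
      then show ?thesis using True by (simp add: wn V_def)
    next
      case False
      have ne: "\<zeta> - z \<noteq> 0" if "\<zeta> \<in> ?H" for \<zeta> using that False z by auto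
      have "(g has_contour_integral 0) (rectpath a1 a3)"
      proof (rule Cauchy_theorem_convex[OF _ convH, of _ "{}"])
        show "continuous_on ?H g" unfolding g_def using ne by (intro continuous_intros cont) auto
        show "g field_differentiable at x" if "x \<in> interior ?H - {}" for x
          unfolding g_def using that ne interior_subset[of ?H]
          by (intro field_differentiable_divide fd field_differentiable_diff
                    field_differentiable_ident field_differentiable_const) auto
      qed (use im in auto)
      then show ?thesis using False by (simp add: V_def)
    qed
    have cg: "continuous_on (?H - {z}) g"
      unfolding g_def by (intro continuous_intros continuous_on_subset[OF cont]) auto
    have ci: "g contour_integrable_on linepath u v" if "closed_segment u v \<subseteq> ?H - {z}" for u v
      by (rule contour_integrable_continuous_linepath[OF continuous_on_subset[OF cg that]])
    have seg: "closed_segment a1 a2 \<subseteq> ?H - {z}" "closed_segment a2 a3 \<subseteq> ?H - {z}"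
      "closed_segment a3 a4 \<subseteq> ?H - {z}" "closed_segment a4 a1 \<subseteq> ?H - {z}"
      using im unfolding rect by (auto simp: path_image_join)
    have split: "V = contour_integral (linepath a1 a2) g + contour_integral (linepath a2 a3) g
           + contour_integral (linepath a3 a4) g + contour_integral (linepath a4 a1) g"
      using contour_integral_unique[OF hc, symmetric] seg
      unfolding rect by (simp add: ci add.assoc)
    have gb: "cmod (g \<zeta>) \<le> C / (R * (R - cmod z))" if "R \<le> cmod \<zeta>" "0 \<le> Im \<zeta>" for \<zeta>
    proof -
      have "cmod (F \<zeta>) * R \<le> C"
        using decay[OF that(2)] mult_right_mono[OF that(1), of "cmod (F \<zeta>)"]
        by (simp add: norm_mult mult.commute)
      then have 1: "cmod (F \<zeta>) \<le> C / R" using R0 by (simp add: field_simps)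
      have 2: "R - cmod z \<le> cmod (\<zeta> - z)" using that(1) norm_triangle_ineq2[of \<zeta> z] by linarith
      have "cmod (g \<zeta>) = cmod (F \<zeta>) / cmod (\<zeta> - z)" by (simp add: g_def norm_divide)
      also have "\<dots> \<le> (C / R) / (R - cmod z)"
        using R by (intro frac_le 1 2 order_trans[OF norm_ge_zero 1]) auto
      finally show ?thesis by simp
    qed
    have Cn: "0 \<le> C" using decay[of 0] by simp
    have lb: "cmod (contour_integral (linepath u v) g) \<le> C / (R * (R - cmod z)) * cmod (v - u)"
      if "closed_segment u v \<subseteq> ?H - {z}" "\<And>\<zeta>. \<zeta> \<in> closed_segment u v \<Longrightarrow> R \<le> cmod \<zeta>" for u v
      by (rule contour_integral_bound_linepath[OF ci[OF that(1)]])
         (use that Cn R R0 in \<open>auto intro!: gb\<close>)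
    have l1: "cmod (contour_integral (linepath a2 a3) g) \<le> C / (R * (R - cmod z)) * R"
    proof -
      have "R \<le> cmod \<zeta>" if "\<zeta> \<in> closed_segment a2 a3" for \<zeta>
        using that abs_Re_le_cmod[of \<zeta>] R0 by (auto simp: a closed_segment_same_Re)
      moreover have "cmod (a3 - a2) = R" using R0 by (simp add: a cmod_def)
      ultimately show ?thesis using lb[OF seg(2)] by simp
    qed
    have l2: "cmod (contour_integral (linepath a3 a4) g) \<le> C / (R * (R - cmod z)) * (2 * R)"
    proof -
      have "R \<le> cmod \<zeta>" if "\<zeta> \<in> closed_segment a3 a4" for \<zeta>
        using that abs_Im_le_cmod[of \<zeta>] R0 by (auto simp: a closed_segment_same_Im)
      moreover have "cmod (a4 - a3) = 2 * R" using R0 by (simp add: a cmod_def real_sqrt_mult)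
      ultimately show ?thesis using lb[OF seg(3)] by simp
    qed
    have l3: "cmod (contour_integral (linepath a4 a1) g) \<le> C / (R * (R - cmod z)) * R"
    proof -
      have "R \<le> cmod \<zeta>" if "\<zeta> \<in> closed_segment a4 a1" for \<zeta>
        using that abs_Re_le_cmod[of \<zeta>] R0 by (auto simp: a closed_segment_same_Re)
      moreover have "cmod (a1 - a4) = R" using R0 by (simp add: a cmod_def)
      ultimately show ?thesis using lb[OF seg(4)] by simp
    qed
    have bottom: "contour_integral (linepath a1 a2) g = integral {-R..R} (\<lambda>x. g (of_real x))"
      by (subst contour_integral_linepath_Reals_eq) (use R0 in \<open>auto simp: a\<close>)
    have "cmod (integral {-R..R} (\<lambda>x. g (of_real x)) - V)
        = cmod (contour_integral (linepath a2 a3) g + contour_integral (linepath a3 a4) g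
             + contour_integral (linepath a4 a1) g)"
      unfolding split bottom
      by (subst norm_minus_cancel[symmetric]) (simp add: algebra_simps)
    also have "\<dots> \<le> C / (R * (R - cmod z)) * R + C / (R * (R - cmod z)) * (2 * R)
        + C / (R * (R - cmod z)) * R"
      by (intro norm_triangle_mono l1 l2 l3)
    also have "\<dots> = 4 * C / (R - cmod z)" using R0 R by (simp add: divide_simps) 
    finally show ?thesis .
  qed
  have "(\<lambda>n. integral {- real n..real n} (\<lambda>x. g (of_real x)) - V) \<longlonglongrightarrow> 0"
  proof (rule Lim_null_comparison)
    have "\<forall>\<^sub>F n in sequentially. cmod z < real n"
      by (rule filterlim_real_sequentially[THEN filterlim_at_top_dense[THEN iffD1], rule_format])
    then show "\<forall>\<^sub>F n in sequentially. cmod (integral {- real n..real n} (\<lambda>x. g (of_real x)) - V)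
        \<le> 4 * C / (real n - cmod z)"
      by eventually_elim (rule key)
    show "(\<lambda>n. 4 * C / (real n - cmod z)) \<longlonglongrightarrow> 0" by real_asymp
  qed
  then show ?thesis unfolding g_def V_def[symmetric] by (rule LIM_zero_cancel)
qed

text \<open>This is the existence half of the argument: it turns a candidate function into an actual
  measure. Integrability of the boundary density is not assumed; it is extracted from the behaviour
  of \<open>F\<close> along the imaginary axis.\<close>

lemma half_plane_function_is_cauchy_transform:
  fixes F :: "complex \<Rightarrow> complex"
  assumes cont: "continuous_on {z. 0 \<le> Im z} F"
    and hol: "F holomorphic_on {z. 0 < Im z}"
    and decay: "\<And>z. 0 \<le> Im z \<Longrightarrow> cmod (z * F z) \<le> C"
    and neg: "\<And>x. Im (F (complex_of_real x)) \<le> 0"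
    and lim: "((\<lambda>y. \<i> * complex_of_real y * F (\<i> * complex_of_real y)) \<longlongrightarrow> 1) at_top"
  defines "L \<equiv> density lborel (\<lambda>x. ennreal (- Im (F (complex_of_real x)) / pi))"
  shows "real_distribution L" and "\<And>z. 0 < Im z \<Longrightarrow> cauchy_transform L z = F z"
proof -
  define p where "p x = - Im (F (complex_of_real x)) / pi" for x
  have contR: "continuous_on A (\<lambda>x. F (complex_of_real x))" for A
    by (rule continuous_on_compose2[OF cont]) (auto intro!: continuous_intros)
  have contp: "continuous_on A p" for A
    unfolding p_def using contR by (intro continuous_intros) auto
  have [measurable]: "p \<in> borel_measurable borel"
    by (rule borel_measurable_continuous_onI[OF contp])
  have p0: "0 \<le> p x" for x using neg[of x] by (simp add: p_def divide_nonpos_pos)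
  have trunc: "(\<lambda>n. LINT x|lborel. indicator {- real n..real n} x *\<^sub>R (of_real (p x) / (z - of_real x)))
                  \<longlonglongrightarrow> F z"
    and trunc_int: "\<And>n. integrable lborel (\<lambda>x. indicator {- real n..real n} x *\<^sub>R (of_real (p x) / (z - of_real x)))"
    if z: "0 < Im z" for z
  proof -
    let ?J = "\<lambda>n z. integral {- real n..real n} (\<lambda>x. F (of_real x) / (of_real x - z))"
    have ne: "of_real x - z \<noteq> 0" "of_real x - cnj z \<noteq> 0" "z - of_real x \<noteq> 0" for x
      using z by (auto simp: complex_eq_iff)
    have I: "(\<lambda>x. F (of_real x) / (of_real x - w)) integrable_on {- real n..real n}"
      if "w \<in> {z, cnj z}" for n w
      by (rule integrable_continuous_real, intro continuous_intros contR) (use ne that in auto)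
    \<comment> \<open>The pole at \<open>cnj z\<close> lies outside the half-plane, so its integral
      tends to 0. Subtracting its conjugate replaces \<open>F\<close> on the axis by F - conj F = 2
      i Im F, which leaves a Cauchy integral of the real density \<open>p\<close>, so far only as a
      limit of symmetric truncations.\<close>
    have "(\<lambda>n. ?J n z - cnj (?J n (cnj z))) \<longlonglongrightarrow> 2 * pi * \<i> * F z - cnj 0"
      using rectpath_integral_tendsto[OF cont hol decay, of z]
        rectpath_integral_tendsto[OF cont hol decay, of "cnj z"] z
      by (intro tendsto_intros) auto
    moreover have "?J n z - cnj (?J n (cnj z))
       = 2 * pi * \<i> * integral {- real n..real n} (\<lambda>x. of_real (p x) / (z - of_real x))" for n
    proof -
      have "cnj (?J n (cnj z)) = integral {- real n..real n} (\<lambda>x. cnj (F (of_real x) / (of_real x - cnj z)))"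
        by (simp add: integral_cnj)
      moreover have "(\<lambda>x. cnj (F (of_real x) / (of_real x - cnj z))) integrable_on {- real n..real n}"
        by (rule integrable_continuous_real, intro continuous_intros contR) (use ne in auto)
      ultimately have "?J n z - cnj (?J n (cnj z)) = integral {- real n..real n}
          (\<lambda>x. F (of_real x) / (of_real x - z) - cnj (F (of_real x) / (of_real x - cnj z)))"
        using I[of z n] by (simp add: Henstock_Kurzweil_Integration.integral_diff)
      also have "\<dots> = integral {- real n..real n} (\<lambda>x. (2 * pi * \<i>) * (of_real (p x) / (z - of_real x)))"
      proof (rule integral_cong)
        fix x
        have "F (of_real x) / (of_real x - z) - cnj (F (of_real x) / (of_real x - cnj z))
           = (F (of_real x) - cnj (F (of_real x))) / (of_real x - z)"
          by (simp add: diff_divide_distrib)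
        also have "F (of_real x) - cnj (F (of_real x)) = - (2 * pi * \<i>) * of_real (p x)"
          by (simp add: p_def complex_eq_iff)
        also have "- (2 * pi * \<i>) * of_real (p x) / (of_real x - z)
            = (2 * pi * \<i>) * (of_real (p x) / (z - of_real x))"
          using ne[of x] by (simp add: field_simps)
        finally show "F (of_real x) / (of_real x - z) - cnj (F (of_real x) / (of_real x - cnj z))
           = (2 * pi * \<i>) * (of_real (p x) / (z - of_real x))" .
      qed
      also have "\<dots> = (2 * pi * \<i>) * integral {- real n..real n} (\<lambda>x. of_real (p x) / (z - of_real x))"
        by (rule integral_mult_right)
      finally show ?thesis .
    qed
    ultimately have "(\<lambda>n. (2 * pi * \<i>) * integral {- real n..real n} (\<lambda>x. of_real (p x) / (z - of_real x)))
         \<longlonglongrightarrow> 2 * pi * \<i> * F z" by simp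
    then have "(\<lambda>n. integral {- real n..real n} (\<lambda>x. of_real (p x) / (z - of_real x))) \<longlonglongrightarrow> F z"
      by (subst (asm) tendsto_mult_left_iff) auto
    moreover have si: "set_integrable lborel {- real n..real n} (\<lambda>x. of_real (p x) / (z - of_real x))" for n
      using ne by (intro borel_integrable_atLeastAtMost' continuous_intros contp) auto
    ultimately show "(\<lambda>n. LINT x|lborel. indicator {- real n..real n} x *\<^sub>R (of_real (p x) / (z - of_real x)))
                  \<longlonglongrightarrow> F z"
      using set_borel_integral_eq_integral(2)[OF si] by (simp add: set_lebesgue_integral_def)
    show "integrable lborel (\<lambda>x. indicator {- real n..real n} x *\<^sub>R (of_real (p x) / (z - of_real x)))" for n
      using si[of n] by (simp add: set_integrable_def)
  qed
  \<comment> \<open>The imaginary part at z = i y has a nonnegative integrand, so the truncated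
    integrals increase and monotone convergence removes the truncation.\<close>
  have poisson: "has_bochner_integral lborel (\<lambda>x. p x * (y\<^sup>2 / (x\<^sup>2 + y\<^sup>2))) (- y * Im (F (\<i> * of_real y)))"
    if y: "0 < y" for y
  proof (rule has_bochner_integral_monotone_convergence[where
        f = "\<lambda>n x. indicator {- real n..real n} x * (p x * (y\<^sup>2 / (x\<^sup>2 + y\<^sup>2)))"])
    have Imk: "Im (indicator {- real n..real n} x *\<^sub>R (of_real (p x) / (\<i> * of_real y - of_real x)))
       = - (indicator {- real n..real n} x * (p x * (y / (x\<^sup>2 + y\<^sup>2))))" for n x
      by (simp add: Im_divide)
    have eq: "(\<lambda>x. indicator {- real n..real n} x * (p x * (y\<^sup>2 / (x\<^sup>2 + y\<^sup>2))))
       = (\<lambda>x. - y * Im (indicator {- real n..real n} x *\<^sub>R (of_real (p x) / (\<i> * of_real y - of_real x))))" for n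
      unfolding Imk by (simp add: fun_eq_iff power2_eq_square)
    have Iy: "0 < Im (\<i> * complex_of_real y)" using y by simp
    show "integrable lborel (\<lambda>x. indicator {- real n..real n} x * (p x * (y\<^sup>2 / (x\<^sup>2 + y\<^sup>2))))" for n
      unfolding eq by (intro integrable_mult_right integrable_Im trunc_int Iy)
    have "(\<lambda>n. - y * Im (LINT x|lborel. indicator {- real n..real n} x *\<^sub>R (of_real (p x) / (\<i> * of_real y - of_real x))))
        \<longlonglongrightarrow> - y * Im (F (\<i> * of_real y))"
      by (intro tendsto_intros trunc Iy)
    then show "(\<lambda>n. LINT x|lborel. indicator {- real n..real n} x * (p x * (y\<^sup>2 / (x\<^sup>2 + y\<^sup>2))))
        \<longlonglongrightarrow> - y * Im (F (\<i> * of_real y))"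
      unfolding eq by (simp only: integral_mult_right_zero integral_Im[OF trunc_int[OF Iy]])
    show "AE x in lborel. mono (\<lambda>n. indicator {- real n..real n} x * (p x * (y\<^sup>2 / (x\<^sup>2 + y\<^sup>2))))"
      by (intro AE_I2 monoI mult_right_mono) (auto simp: indicator_def p0)
    show "AE x in lborel. (\<lambda>n. indicator {- real n..real n} x * (p x * (y\<^sup>2 / (x\<^sup>2 + y\<^sup>2))))
        \<longlonglongrightarrow> p x * (y\<^sup>2 / (x\<^sup>2 + y\<^sup>2))"
    proof (rule AE_I2, rule tendsto_eventually)
      fix x :: real
      have "\<forall>\<^sub>F n in sequentially. \<bar>x\<bar> \<le> real n"
        by (rule filterlim_real_sequentially[THEN filterlim_at_top[THEN iffD1], rule_format])
      then show "\<forall>\<^sub>F n in sequentially. indicator {- real n..real n} x * (p x * (y\<^sup>2 / (x\<^sup>2 + y\<^sup>2)))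
            = p x * (y\<^sup>2 / (x\<^sup>2 + y\<^sup>2))"
        by eventually_elim (auto simp: indicator_def abs_le_iff)
    qed
  qed auto
  \<comment> \<open>Now y tends to infinity: the factor y^2/(x^2 + y^2) increases to 1 and the
    integrals tend to 1 by \<open>lim\<close>, which gives integrability and total mass at
    once.\<close>
  have "has_bochner_integral lborel p 1"
  proof (rule has_bochner_integral_monotone_convergence[where
        f = "\<lambda>n x. p x * ((real (Suc n))\<^sup>2 / (x\<^sup>2 + (real (Suc n))\<^sup>2))"])
    show "integrable lborel (\<lambda>x. p x * ((real (Suc n))\<^sup>2 / (x\<^sup>2 + (real (Suc n))\<^sup>2)))" for n
      by (rule integrable.intros[OF poisson]) simp
    have "((\<lambda>y. Re (\<i> * complex_of_real y * F (\<i> * complex_of_real y))) \<longlongrightarrow> Re 1) at_top"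
      by (intro tendsto_intros lim)
    then have "((\<lambda>y. - y * Im (F (\<i> * complex_of_real y))) \<longlongrightarrow> 1) at_top"
      by simp
    then have "(\<lambda>n. - real (Suc n) * Im (F (\<i> * complex_of_real (real (Suc n))))) \<longlonglongrightarrow> 1"
      by (rule filterlim_compose) real_asymp
    then show "(\<lambda>n. LINT x|lborel. p x * ((real (Suc n))\<^sup>2 / (x\<^sup>2 + (real (Suc n))\<^sup>2))) \<longlonglongrightarrow> 1"
      by (subst has_bochner_integral_integral_eq[OF poisson]) auto
    show "AE x in lborel. mono (\<lambda>n. p x * ((real (Suc n))\<^sup>2 / (x\<^sup>2 + (real (Suc n))\<^sup>2)))"
    proof (intro AE_I2 monoI mult_left_mono p0)
      fix x :: real and m n :: nat assume "m \<le> n"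
      then have "x\<^sup>2 * (real (Suc m))\<^sup>2 \<le> x\<^sup>2 * (real (Suc n))\<^sup>2"
        by (intro mult_left_mono power_mono) auto
      then have "(real (Suc m))\<^sup>2 * (x\<^sup>2 + (real (Suc n))\<^sup>2) \<le> (real (Suc n))\<^sup>2 * (x\<^sup>2 + (real (Suc m))\<^sup>2)"
        by (simp only: distrib_left mult.commute)
      moreover have "0 < x\<^sup>2 + (real (Suc k))\<^sup>2" for k
        by (intro add_nonneg_pos) auto
      ultimately show "(real (Suc m))\<^sup>2 / (x\<^sup>2 + (real (Suc m))\<^sup>2) \<le> (real (Suc n))\<^sup>2 / (x\<^sup>2 + (real (Suc n))\<^sup>2)"
        by (simp only: le_divide_eq pos_divide_le_eq times_divide_eq_left if_True)
    qed
    show "AE x in lborel. (\<lambda>n. p x * ((real (Suc n))\<^sup>2 / (x\<^sup>2 + (real (Suc n))\<^sup>2))) \<longlonglongrightarrow> p x"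
    proof (rule AE_I2)
      fix x :: real
      have "(\<lambda>n. (real (Suc n))\<^sup>2 / (x\<^sup>2 + (real (Suc n))\<^sup>2)) \<longlonglongrightarrow> 1" by real_asymp
      then have "(\<lambda>n. p x * ((real (Suc n))\<^sup>2 / (x\<^sup>2 + (real (Suc n))\<^sup>2))) \<longlonglongrightarrow> p x * 1"
        by (intro tendsto_intros)
      then show "(\<lambda>n. p x * ((real (Suc n))\<^sup>2 / (x\<^sup>2 + (real (Suc n))\<^sup>2))) \<longlonglongrightarrow> p x" by simp
    qed
  qed auto
  then have pint: "integrable lborel p" and p1: "(LINT x|lborel. p x) = 1"
    by (auto simp: has_bochner_integral_iff)
  have L: "L = density lborel (\<lambda>x. ennreal (p x))" by (simp add: L_def p_def)
  have "prob_space L"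
  proof
    have "emeasure L (space L) = (\<integral>\<^sup>+x. ennreal (p x) \<partial>lborel)"
      unfolding L by (subst emeasure_density) auto
    also have "\<dots> = 1" using nn_integral_eq_integral[OF pint] p0 p1 by simp
    finally show "emeasure L (space L) = 1" .
  qed
  then show "real_distribution L"
    by (simp add: real_distribution_def real_distribution_axioms_def L)
  fix z assume z: "0 < Im z"
  have "(\<lambda>n. LINT x|lborel. indicator {- real n..real n} x *\<^sub>R (of_real (p x) / (z - of_real x)))
          \<longlonglongrightarrow> (LINT x|lborel. of_real (p x) / (z - of_real x))"
  proof (rule integral_dominated_convergence[where w = "\<lambda>x. p x / Im z"])
    show "integrable lborel (\<lambda>x. p x / Im z)" using pint by simp
    show "AE x in lborel. (\<lambda>n. indicator {- real n..real n} x *\<^sub>R (of_real (p x) / (z - of_real x)))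
        \<longlonglongrightarrow> of_real (p x) / (z - of_real x)"
    proof (rule AE_I2, rule tendsto_eventually)
      fix x :: real
      have "\<forall>\<^sub>F n in sequentially. \<bar>x\<bar> \<le> real n"
        by (rule filterlim_real_sequentially[THEN filterlim_at_top[THEN iffD1], rule_format])
      then show "\<forall>\<^sub>F n in sequentially. indicator {- real n..real n} x *\<^sub>R (of_real (p x) / (z - of_real x))
            = of_real (p x) / (z - of_real x)"
        by eventually_elim (auto simp: indicator_def abs_le_iff)
    qed
    show "AE x in lborel. norm (indicator {- real n..real n} x *\<^sub>R (of_real (p x) / (z - of_real x))) \<le> p x / Im z" for n
    proof (rule AE_I2)
      fix x :: real
      have "Im z \<le> cmod (z - of_real x)" using abs_Im_le_cmod[of "z - of_real x"] by simp
      then have "p x / cmod (z - of_real x) \<le> p x / Im z"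
        using z by (intro divide_left_mono p0 mult_pos_pos) linarith+
      then show "norm (indicator {- real n..real n} x *\<^sub>R (of_real (p x) / (z - of_real x))) \<le> p x / Im z"
        using z p0[of x] by (auto simp: indicator_def norm_divide)
    qed
  qed auto
  with trunc[OF z] have "(LINT x|lborel. of_real (p x) / (z - of_real x)) = F z"
    using LIMSEQ_unique by blast
  moreover have "cauchy_transform L z = (LINT x|lborel. p x *\<^sub>R (1 / (z - of_real x)))"
    unfolding cauchy_transform_def L by (rule integral_density) (auto simp: p0)
  ultimately show "cauchy_transform L z = F z" by (simp add: scaleR_conv_of_real)
qed

section \<open>Stieltjes inversion\<close>

context real_distribution
begin

text \<open>For y > 0 this is pi (P - 1/2), where P is the distribution function of \<open>M\<close>
  convolved with the Cauchy law of scale y.\<close>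

definition smoothed_cdf :: "real \<Rightarrow> real \<Rightarrow> real" where
  "smoothed_cdf y b = (LINT s|M. arctan ((b - s) / y))"

lemma arctan_integrable: "integrable M (\<lambda>s. arctan ((b - s) / y))"
proof (rule integrable_const_bound[where B = "pi / 2"])
  have "\<bar>arctan x\<bar> \<le> pi / 2" for x using arctan_bounded[of x] by linarith
  then show "AE s in M. norm (arctan ((b - s) / y)) \<le> pi / 2" by simp
  have "continuous_on UNIV (\<lambda>s. arctan ((b - s) / y))"
    unfolding divide_inverse by (intro continuous_intros)
  then show "(\<lambda>s. arctan ((b - s) / y)) \<in> borel_measurable M"
    by (intro measurable_finite_borel borel_measurable_continuous_onI)
qed

text \<open>Tonelli for the Poisson kernel y/((x - s)^2 + y^2): integration over s gives - Im of the
  Cauchy transform, integration over x gives a difference of arctangents.\<close>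

lemma smoothed_cdf_diff:
  assumes "0 < y" "a \<le> b"
  shows "ennreal (smoothed_cdf y b - smoothed_cdf y a)
     = (\<integral>\<^sup>+x. ennreal (- Im (cauchy_transform M (Complex x y))) * indicator {a..b} x \<partial>lborel)"
proof -
  define k where "k x s = y / ((x - s)\<^sup>2 + y\<^sup>2)" for x s :: real
  have k0: "0 \<le> k x s" for x s using assms by (simp add: k_def)
  have inner: "(\<integral>\<^sup>+s. ennreal (k x s) \<partial>M) = ennreal (- Im (cauchy_transform M (Complex x y)))" for x
  proof -
    have c: "cmod (Complex x y - complex_of_real s) ^ 2 = (x - s)\<^sup>2 + y\<^sup>2" for s by (simp add: cmod_power2)
    have y: "0 < Im (Complex x y)" using assms by simp
    have "integrable M (\<lambda>s. y * (1 / (cmod (Complex x y - complex_of_real s))\<^sup>2))"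
      by (rule integrable_mult_right, rule inv_norm_square_integrable[OF y AE_Im_le_norm_diff])
    moreover have "(\<lambda>s. y * (1 / (cmod (Complex x y - complex_of_real s))\<^sup>2)) = k x"
      unfolding c by (simp add: k_def fun_eq_iff)
    ultimately have "integrable M (k x)"
      and "(LINT s|M. y * (1 / (cmod (Complex x y - complex_of_real s))\<^sup>2)) = (LINT s|M. k x s)"
      by simp_all
    then show ?thesis
      using Im_cauchy_transform[OF y AE_Im_le_norm_diff] k0
      by (subst nn_integral_eq_integral) (auto simp del: times_divide_eq_right simp flip: integral_mult_right_zero)
  qed
  have outer: "(\<integral>\<^sup>+x. ennreal (k x s) * indicator {a..b} x \<partial>lborel)
      = ennreal (arctan ((b - s) / y) - arctan ((a - s) / y))" for s
  proof -
    have d: "DERIV (\<lambda>x. arctan ((x - s) / y)) x :> k x s" for x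
    proof -
      have "1 + ((x - s) / y)\<^sup>2 = ((x - s)\<^sup>2 + y\<^sup>2) / y\<^sup>2"
        using assms by (simp add: field_simps)
      then have "1 / y * inverse (1 + ((x - s) / y)\<^sup>2) = k x s"
        using assms by (simp add: k_def power2_eq_square)
      then show ?thesis
        using assms by (auto intro!: derivative_eq_intros)
    qed
    have "has_bochner_integral lborel (\<lambda>x. k x s * indicator {a..b} x)
        (arctan ((b - s) / y) - arctan ((a - s) / y))"
    proof (rule has_bochner_integral_FTC_Icc_real[OF assms(2) d])
      show "isCont (\<lambda>x. k x s) x" for x
        unfolding k_def using assms by (intro continuous_intros) simp
    qed
    then have I: "integrable lborel (\<lambda>x. k x s * indicator {a..b} x)"
      and V: "(LINT x|lborel. k x s * indicator {a..b} x) = arctan ((b - s) / y) - arctan ((a - s) / y)"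
      unfolding has_bochner_integral_iff by blast+
    have "(\<integral>\<^sup>+x. ennreal (k x s * indicator {a..b} x) \<partial>lborel)
        = ennreal (arctan ((b - s) / y) - arctan ((a - s) / y))"
      using nn_integral_eq_integral[OF I] k0 unfolding V by simp
    moreover have "ennreal (k x s * indicator {a..b} x) = ennreal (k x s) * indicator {a..b} x" for x
      by (auto simp: indicator_def)
    ultimately show ?thesis by simp
  qed
  interpret PS: pair_sigma_finite lborel M
    by (intro pair_sigma_finite.intro lborel.sigma_finite_measure_axioms sigma_finite_measure_axioms)
  let ?f = "\<lambda>x s. ennreal (k x s) * indicator {a..b} x"
  have kM: "(\<lambda>s. ennreal (k x s)) \<in> borel_measurable M" for x
    unfolding k_def by measurable
  have fM: "case_prod ?f \<in> borel_measurable (lborel \<Otimes>\<^sub>M M)"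
  proof -
    have "case_prod ?f \<in> borel_measurable (borel \<Otimes>\<^sub>M borel)" unfolding k_def by measurable
    then show ?thesis
      using measurable_cong_sets[OF sets_pair_measure_cong[of lborel borel M borel] refl] by auto
  qed
  have mono: "arctan ((a - s) / y) \<le> arctan ((b - s) / y)" for s
    using assms by (intro arctan_monotone' divide_right_mono) auto
  have "(\<integral>\<^sup>+x. ennreal (- Im (cauchy_transform M (Complex x y))) * indicator {a..b} x \<partial>lborel)
     = (\<integral>\<^sup>+x. (\<integral>\<^sup>+s. ?f x s \<partial>M) \<partial>lborel)"
    unfolding nn_integral_multc[OF kM] inner ..
  also have "\<dots> = (\<integral>\<^sup>+s. (\<integral>\<^sup>+x. ?f x s \<partial>lborel) \<partial>M)"
    by (rule PS.Fubini'[OF fM, symmetric])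
  also have "\<dots> = (\<integral>\<^sup>+s. ennreal (arctan ((b - s) / y) - arctan ((a - s) / y)) \<partial>M)"
    unfolding outer ..
  also have "\<dots> = ennreal (LINT s|M. arctan ((b - s) / y) - arctan ((a - s) / y))"
  proof (rule nn_integral_eq_integral)
    show "AE s in M. 0 \<le> arctan ((b - s) / y) - arctan ((a - s) / y)"
      using mono by (intro AE_I2) (simp only: diff_ge_0_iff_ge)
  qed (intro Bochner_Integration.integrable_diff arctan_integrable)
  also have "\<dots> = ennreal (smoothed_cdf y b - smoothed_cdf y a)"
    unfolding smoothed_cdf_def Bochner_Integration.integral_diff[OF arctan_integrable arctan_integrable] ..
  finally show ?thesis ..
qed

lemma smoothed_cdf_mono: "0 < y \<Longrightarrow> a \<le> b \<Longrightarrow> smoothed_cdf y a \<le> smoothed_cdf y b"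
  unfolding smoothed_cdf_def
  by (intro integral_mono arctan_integrable) (auto intro!: divide_right_mono arctan_monotone')

lemma smoothed_cdf_tendsto_at_bot:
  assumes "0 < y"
  shows "(\<lambda>n. smoothed_cdf y (- real n)) \<longlonglongrightarrow> - (pi / 2)"
proof -
  have "(\<lambda>n. smoothed_cdf y (- real n)) \<longlonglongrightarrow> (LINT s|M. - (pi / 2))"
    unfolding smoothed_cdf_def
  proof (rule integral_dominated_convergence[where w = "\<lambda>_. pi / 2"])
    have "\<bar>arctan x\<bar> \<le> pi / 2" for x using arctan_bounded[of x] by linarith
    then show "AE s in M. norm (arctan ((- real n - s) / y)) \<le> pi / 2" for n by simp
    have "(\<lambda>n. arctan ((- real n - s) / y)) \<longlonglongrightarrow> - (pi / 2)" for s
    proof (rule filterlim_compose[OF tendsto_arctan_at_bot])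
      show "filterlim (\<lambda>n. (- real n - s) / y) at_bot sequentially"
        using assms by real_asymp
    qed
    then show "AE s in M. (\<lambda>n. arctan ((- real n - s) / y)) \<longlonglongrightarrow> - (pi / 2)" by simp
  qed (simp_all add: borel_measurable_integrable[OF arctan_integrable])
  then show ?thesis using prob_space by simp
qed

text \<open>As the scale shrinks, arctan ((b - s)/y) tends to pi/2, 0 or -pi/2 for s < b, s = b or s
  > b. An atom at b therefore counts half, and the limit sees the mean of the distribution function
  and its left limit.\<close>

lemma smoothed_cdf_tendsto:
  "(\<lambda>n. smoothed_cdf (1 / real (Suc n)) b) \<longlonglongrightarrow> pi / 2 * (cdf M b + measure M {..<b} - 1)"
proof -
  define h where "h s = pi / 2 * (indicator {..b} s + indicator {..<b} s - 1)" for s :: real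
  have "(\<lambda>n. smoothed_cdf (1 / real (Suc n)) b) \<longlonglongrightarrow> (LINT s|M. h s)"
    unfolding smoothed_cdf_def
  proof (rule integral_dominated_convergence[where w = "\<lambda>_. pi / 2"])
    have "\<bar>arctan x\<bar> \<le> pi / 2" for x using arctan_bounded[of x] by linarith
    then show "AE s in M. norm (arctan ((b - s) / (1 / real (Suc n)))) \<le> pi / 2" for n by simp
    have "(\<lambda>n. arctan ((b - s) / (1 / real (Suc n)))) \<longlonglongrightarrow> h s" for s
    proof -
      consider "s = b" | "s < b" | "b < s" by linarith
      then show ?thesis
      proof cases
        case 2
        have "filterlim (\<lambda>n. (b - s) * real (Suc n)) at_top sequentially"
          using 2 by (intro filterlim_tendsto_pos_mult_at_top[OF tendsto_const]
              filterlim_compose[OF filterlim_real_sequentially filterlim_Suc]) auto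
        from filterlim_compose[OF tendsto_arctan_at_top this] show ?thesis using 2 by (simp add: h_def)
      next
        case 3
        have "filterlim (\<lambda>n. (b - s) * real (Suc n)) at_bot sequentially"
          using 3 by (intro filterlim_tendsto_neg_mult_at_bot[OF tendsto_const]
              filterlim_compose[OF filterlim_real_sequentially filterlim_Suc]) auto
        from filterlim_compose[OF tendsto_arctan_at_bot this] show ?thesis using 3 by (simp add: h_def)
      qed (simp add: h_def)
    qed
    then show "AE s in M. (\<lambda>n. arctan ((b - s) / (1 / real (Suc n)))) \<longlonglongrightarrow> h s" by (rule AE_I2)
    show "(\<lambda>s. arctan ((b - s) / (1 / real (Suc n)))) \<in> borel_measurable M" for n
      by (rule borel_measurable_integrable[OF arctan_integrable])
    show "h \<in> borel_measurable M" unfolding h_def by measurable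
    show "integrable M (\<lambda>_. pi / 2)" by (rule integrable_const)
  qed
  also have "(LINT s|M. h s) = pi / 2 * (cdf M b + measure M {..<b} - 1)"
  proof -
    have I: "integrable M (indicator {..b} :: real \<Rightarrow> real)" "integrable M (indicator {..<b} :: real \<Rightarrow> real)"
      by (intro integrable_real_indicator; simp add: emeasure_eq_measure)+
    have "(LINT s|M. indicator {..b} s + indicator {..<b} s - 1 :: real)
       = (LINT s|M. indicator {..b} s + indicator {..<b} s) - (LINT s|M. 1)"
      by (intro Bochner_Integration.integral_diff Bochner_Integration.integrable_add I integrable_const)
    also have "(LINT s|M. indicator {..b} s + indicator {..<b} s :: real)
       = (LINT s|M. indicator {..b} s) + (LINT s|M. indicator {..<b} s)"
      by (intro Bochner_Integration.integral_add I)
    finally have "(LINT s|M. indicator {..b} s + indicator {..<b} s - 1 :: real) = cdf M b + measure M {..<b} - 1"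
      using prob_space by (simp add: cdf_def)
    then show ?thesis unfolding h_def integral_mult_right_zero by (rule arg_cong)
  qed
  finally show ?thesis .
qed

end

theorem cauchy_transform_unique:
  assumes "real_distribution L1" "real_distribution L2"
    and eq: "\<And>z. 0 < Im z \<Longrightarrow> cauchy_transform L1 z = cauchy_transform L2 z"
  shows "L1 = L2"
proof (rule cdf_unique[OF assms(1,2)])
  interpret A: real_distribution L1 by fact
  interpret B: real_distribution L2 by fact
  \<comment> \<open>The Cauchy transform fixes only increments; the common limit -pi/2 at minus
    infinity fixes the constant.\<close>
  have sm: "A.smoothed_cdf y b = B.smoothed_cdf y b" if y: "0 < y" for y b
  proof -
    have d: "A.smoothed_cdf y b - A.smoothed_cdf y a = B.smoothed_cdf y b - B.smoothed_cdf y a"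
      if ab: "a \<le> b" for a
    proof -
      have "cauchy_transform L1 (Complex x y) = cauchy_transform L2 (Complex x y)" for x
        by (rule eq) (simp add: y)
      then have "ennreal (A.smoothed_cdf y b - A.smoothed_cdf y a) = ennreal (B.smoothed_cdf y b - B.smoothed_cdf y a)"
        unfolding A.smoothed_cdf_diff[OF y ab] B.smoothed_cdf_diff[OF y ab] by simp
      then show ?thesis
        by (rule ennreal_inj[THEN iffD1, rotated 2])
           (simp_all only: diff_ge_0_iff_ge A.smoothed_cdf_mono[OF y ab] B.smoothed_cdf_mono[OF y ab])
    qed
    have "(\<lambda>n. A.smoothed_cdf y b - A.smoothed_cdf y (- real n)) \<longlonglongrightarrow> A.smoothed_cdf y b - (- (pi / 2))"
      by (rule tendsto_diff[OF tendsto_const A.smoothed_cdf_tendsto_at_bot[OF y]])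
    moreover have "(\<lambda>n. A.smoothed_cdf y b - A.smoothed_cdf y (- real n)) \<longlonglongrightarrow> B.smoothed_cdf y b - (- (pi / 2))"
    proof (rule Lim_transform_eventually)
      show "(\<lambda>n. B.smoothed_cdf y b - B.smoothed_cdf y (- real n)) \<longlonglongrightarrow> B.smoothed_cdf y b - (- (pi / 2))"
        by (rule tendsto_diff[OF tendsto_const B.smoothed_cdf_tendsto_at_bot[OF y]])
      have "\<forall>\<^sub>F n in sequentially. - b \<le> real n"
        using filterlim_real_sequentially unfolding filterlim_at_top by blast
      then show "\<forall>\<^sub>F n in sequentially. B.smoothed_cdf y b - B.smoothed_cdf y (- real n)
          = A.smoothed_cdf y b - A.smoothed_cdf y (- real n)"
        by eventually_elim (intro d[symmetric], linarith)
    qed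
    ultimately have "A.smoothed_cdf y b - (- (pi / 2)) = B.smoothed_cdf y b - (- (pi / 2))"
      by (rule LIMSEQ_unique)
    then show ?thesis by linarith
  qed
  have half: "cdf L1 b + measure L1 {..<b} = cdf L2 b + measure L2 {..<b}" for b
  proof -
    have "(\<lambda>n. A.smoothed_cdf (1 / real (Suc n)) b) = (\<lambda>n. B.smoothed_cdf (1 / real (Suc n)) b)"
      by (intro ext sm) simp
    from LIMSEQ_unique[OF A.smoothed_cdf_tendsto[of b, unfolded this] B.smoothed_cdf_tendsto[of b]]
    have "pi / 2 * (cdf L1 b + measure L1 {..<b} - 1) = pi / 2 * (cdf L2 b + measure L2 {..<b} - 1)" .
    then show ?thesis by simp
  qed
  \<comment> \<open>The sum of the distribution function P and its left limit determines P: for b <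
    x, 2 P1(b) \<le> P1(x) + P1(x-) = P2(x) + P2(x-) \<le> 2 P2(x), and right continuity lets x
    decrease to b.\<close>
  have le: "cdf N1 b \<le> cdf N2 b"
    if "real_distribution N1" "real_distribution N2"
      and eq12: "\<And>b. cdf N1 b + measure N1 {..<b} = cdf N2 b + measure N2 {..<b}" for N1 N2 b
  proof -
    interpret N1: real_distribution N1 by fact
    interpret N2: real_distribution N2 by fact
    have gt: "cdf N1 b \<le> cdf N2 x" if "b < x" for x
    proof -
      have "2 * cdf N1 b \<le> cdf N1 x + measure N1 {..<x}"
        unfolding cdf_def using that N1.finite_measure_mono[of "{..b}" "{..x}"] N1.finite_measure_mono[of "{..b}" "{..<x}"]
        by (auto simp: subset_iff)
      also have "\<dots> = cdf N2 x + measure N2 {..<x}" by (rule eq12)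
      also have "\<dots> \<le> 2 * cdf N2 x"
        unfolding cdf_def using N2.finite_measure_mono[of "{..<x}" "{..x}"]
        by (simp add: subset_iff)
      finally show ?thesis by linarith
    qed
    have "((\<lambda>x. cdf N2 x) \<longlongrightarrow> cdf N2 b) (at_right b)"
      using N2.cdf_is_right_cont[of b] by (simp add: continuous_within)
    then show ?thesis
    proof (rule tendsto_lowerbound)
      show "\<forall>\<^sub>F x in at_right b. cdf N1 b \<le> cdf N2 x"
        using eventually_at_right_less[of b] by eventually_elim (rule gt)
    qed simp
  qed
  show "cdf L1 = cdf L2"
    by (rule ext, rule antisym, rule le[OF assms(1,2) half], rule le[OF assms(2,1) half[symmetric]])
qed

section \<open>The R-transform\<close>

lemma open_upper_cone: "open (upper_cone \<alpha> \<beta>)"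
proof -
  have "upper_cone \<alpha> \<beta> = {z. inner (Complex 0 1) z > 0} \<inter> {z. inner (Complex 1 (-\<alpha>)) z < 0}
      \<inter> {z. inner (Complex (-1) (-\<alpha>)) z < 0} \<inter> {z. inner (Complex 0 1) z > \<beta>}"
    by (auto simp: upper_cone_def inner_complex_def)
  then show ?thesis by (auto intro!: open_Int open_halfspace_lt open_halfspace_gt)
qed

lemma lower_cone_eq:
  "lower_cone \<gamma> \<delta> = {z. inner (Complex 0 1) z < 0} \<inter> {z. inner (Complex 1 \<gamma>) z < 0}
      \<inter> {z. inner (Complex (-1) \<gamma>) z < 0} \<inter> ball 0 \<delta>"
  by (auto simp: lower_cone_def inner_complex_def)

lemma open_lower_cone: "open (lower_cone \<gamma> \<delta>)"
  unfolding lower_cone_eq by (intro open_Int open_halfspace_lt open_ball)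

lemma convex_lower_cone: "convex (lower_cone \<gamma> \<delta>)"
  unfolding lower_cone_eq by (intro convex_Int convex_halfspace_lt convex_ball)

lemma lower_cone_mono: "\<gamma> \<le> \<gamma>' \<Longrightarrow> \<delta> \<le> \<delta>' \<Longrightarrow> lower_cone \<gamma> \<delta> \<subseteq> lower_cone \<gamma>' \<delta>'"
  unfolding lower_cone_def by (auto intro: less_le_trans mult_right_mono)

lemma lower_cone_Int: "lower_cone \<gamma> \<delta> \<inter> lower_cone \<gamma>' \<delta>' = lower_cone (min \<gamma> \<gamma>') (min \<delta> \<delta>')"
proof
  show "lower_cone \<gamma> \<delta> \<inter> lower_cone \<gamma>' \<delta>' \<subseteq> lower_cone (min \<gamma> \<gamma>') (min \<delta> \<delta>')"
    by (auto simp: lower_cone_def min_def)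
qed (simp add: lower_cone_mono)

lemma imaginary_in_lower_cone:
  "0 < \<gamma> \<Longrightarrow> 0 < s \<Longrightarrow> s < \<delta> \<Longrightarrow> - (\<i> * complex_of_real s) \<in> lower_cone \<gamma> \<delta>"
  by (auto simp: lower_cone_def norm_mult)

context real_distribution
begin

section \<open>Asymptotics of the Cauchy transform in a cone\<close>

lemma norm_le_Im_cone:
  assumes "0 < Im z" "\<bar>Re z\<bar> \<le> \<alpha> * Im z"
  shows "cmod z \<le> (1 + \<alpha>) * Im z"
  using cmod_le[of z] assms by (simp add: algebra_simps)

lemma norm_ratio_le_cone:
  assumes "0 < Im z" "\<bar>Re z\<bar> \<le> \<alpha> * Im z"
  shows "cmod (z / (z - of_real x)) \<le> 1 + \<alpha>"
proof -
  have "Im z \<le> cmod (z - of_real x)" using abs_Im_le_cmod[of "z - of_real x"] by simp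
  moreover have "0 \<le> \<alpha>" using assms abs_ge_zero[of "Re z"]
    by (meson mult_neg_pos not_less order_trans le_less_trans)
  ultimately have "(1 + \<alpha>) * Im z \<le> (1 + \<alpha>) * cmod (z - of_real x)"
    by (intro mult_left_mono) auto
  then have "cmod z \<le> (1 + \<alpha>) * cmod (z - of_real x)" using norm_le_Im_cone[OF assms] by linarith
  moreover have "0 < cmod (z - of_real x)" using assms(1) \<open>Im z \<le> cmod (z - of_real x)\<close> by linarith
  ultimately show ?thesis by (simp add: norm_divide divide_le_eq)
qed

lemma ratio_defect_eq:
  assumes "0 < Im z"
  shows "z / (z - of_real x) - 1 = of_real x / (z - of_real x)"
proof -
  have "z - of_real x \<noteq> 0" using assms by auto
  then show ?thesis by (simp add: field_simps)
qed

lemma norm_defect_le_cone: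
  assumes "0 < Im z" "\<bar>Re z\<bar> \<le> \<alpha> * Im z"
  shows "cmod (of_real x / (z - of_real x)) \<le> min (\<bar>x\<bar> / Im z) (2 + \<alpha>)"
proof -
  have le: "Im z \<le> cmod (z - of_real x)" using abs_Im_le_cmod[of "z - of_real x"] by simp
  have "cmod (of_real x / (z - of_real x)) \<le> \<bar>x\<bar> / Im z"
    using le assms(1) by (simp add: norm_divide frac_le)
  moreover have "cmod (of_real x / (z - of_real x)) \<le> cmod (z / (z - of_real x)) + 1"
    unfolding ratio_defect_eq[OF assms(1), symmetric] using norm_triangle_ineq4[of _ "1::complex"] by simp
  ultimately show ?thesis using norm_ratio_le_cone[OF assms, of x] by simp
qed

text \<open>The measure may have no moments, so |x|/Im z alone cannot serve as a dominating
  function. In a cone the integrand is also bounded by 2 + \<alpha>, and dominated convergence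
  applies to the minimum of the two bounds.\<close>

lemma cone_defect_small:
  assumes "0 < \<epsilon>" "0 < \<alpha>"
  obtains \<beta> where "0 < \<beta>"
    "\<And>z. \<beta> \<le> Im z \<Longrightarrow> \<bar>Re z\<bar> \<le> \<alpha> * Im z \<Longrightarrow> (LINT x|M. cmod (of_real x / (z - of_real x))) \<le> \<epsilon>"
proof -
  have mint: "integrable M (\<lambda>x. min (\<bar>x\<bar> / \<beta>) (2 + \<alpha>))" if "0 < \<beta>" for \<beta>
    using that assms by (intro integrable_const_bound[where B = "2 + \<alpha>"]) (auto simp: min_def)
  have "(\<lambda>n. LINT x|M. min (\<bar>x\<bar> / real (Suc n)) (2 + \<alpha>)) \<longlonglongrightarrow> (LINT x|M. 0)"
  proof (rule integral_dominated_convergence[where w = "\<lambda>_. 2 + \<alpha>"])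
    have "(\<lambda>n. min (\<bar>x\<bar> / real (Suc n)) (2 + \<alpha>)) \<longlonglongrightarrow> min 0 (2 + \<alpha>)" for x
      by (intro tendsto_min tendsto_const LIMSEQ_Suc lim_const_over_n)
    then show "AE x in M. (\<lambda>n. min (\<bar>x\<bar> / real (Suc n)) (2 + \<alpha>)) \<longlonglongrightarrow> 0"
      using assms by simp
    show "AE x in M. norm (min (\<bar>x\<bar> / real (Suc n)) (2 + \<alpha>)) \<le> 2 + \<alpha>" for n
      using assms by (intro AE_I2) (auto simp: min_def)
  qed auto
  then have "\<forall>\<^sub>F n in sequentially. (LINT x|M. min (\<bar>x\<bar> / real (Suc n)) (2 + \<alpha>)) < \<epsilon>"
    using assms(1) by (intro order_tendstoD) auto
  then obtain n where n: "(LINT x|M. min (\<bar>x\<bar> / real (Suc n)) (2 + \<alpha>)) < \<epsilon>"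
    by (auto simp: eventually_sequentially)
  show ?thesis
  proof
    show "0 < real (Suc n)" by simp
    fix z assume z: "real (Suc n) \<le> Im z" "\<bar>Re z\<bar> \<le> \<alpha> * Im z"
    have z0: "0 < Im z" using z(1) by (rule less_le_trans[rotated]) simp
    have "norm (LINT x|M. cmod (of_real x / (z - of_real x))) \<le> (LINT x|M. min (\<bar>x\<bar> / real (Suc n)) (2 + \<alpha>))"
    proof (rule norm_LINT_le[OF mint])
      show "AE x in M. norm (cmod (of_real x / (z - of_real x))) \<le> min (\<bar>x\<bar> / real (Suc n)) (2 + \<alpha>)"
      proof (rule AE_I2)
        fix x
        have "\<bar>x\<bar> / Im z \<le> \<bar>x\<bar> / real (Suc n)" using z(1) by (intro divide_left_mono mult_pos_pos z0) auto
        then show "norm (cmod (of_real x / (z - of_real x))) \<le> min (\<bar>x\<bar> / real (Suc n)) (2 + \<alpha>)"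
          using norm_defect_le_cone[OF z0 z(2), of x] by simp
      qed
    qed auto
    then show "(LINT x|M. cmod (of_real x / (z - of_real x))) \<le> \<epsilon>" using n by simp
  qed
qed

lemma defect_integrable:
  assumes "0 < Im z"
  shows "integrable M (\<lambda>x. of_real x / (z - of_real x))"
proof -
  have "integrable M (\<lambda>x. z * (1 / (z - of_real x)) - 1)"
    by (intro Bochner_Integration.integrable_diff integrable_mult_right integrable_const
        cauchy_kernel_integrable[OF assms AE_Im_le_norm_diff])
  then show ?thesis by (simp add: ratio_defect_eq[OF assms])
qed

lemma norm_cauchy_transform_defect_le:
  assumes "0 < Im z"
  shows "cmod (z * cauchy_transform M z - 1) \<le> (LINT x|M. cmod (of_real x / (z - of_real x)))"
proof -
  have "z * cauchy_transform M z - 1 = (LINT x|M. z * (1 / (z - of_real x))) - (LINT x|M. 1)"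
    unfolding cauchy_transform_def integral_mult_right_zero using prob_space by simp
  also have "\<dots> = (LINT x|M. z * (1 / (z - of_real x)) - 1)"
    by (rule Bochner_Integration.integral_diff[symmetric])
       (intro integrable_mult_right integrable_const cauchy_kernel_integrable[OF assms AE_Im_le_norm_diff])+
  also have "\<dots> = (LINT x|M. of_real x / (z - of_real x))"
    by (simp add: ratio_defect_eq[OF assms])
  finally show ?thesis by (simp add: integral_norm_bound)
qed

lemma norm_cauchy_product_defect_le:
  assumes "0 < Im z" "\<bar>Re z\<bar> \<le> \<alpha> * Im z" "0 < Im w" "\<bar>Re w\<bar> \<le> \<alpha> * Im w"
  shows "cmod (z * w * (LINT x|M. 1 / ((z - complex_of_real x) * (w - complex_of_real x))) - 1)
     \<le> (1 + \<alpha>) * (LINT x|M. cmod (of_real x / (w - of_real x))) + (LINT x|M. cmod (of_real x / (z - of_real x)))"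
proof -
  define d where "d = min (Im z) (Im w)"
  have d: "0 < d" "AE x in M. d \<le> cmod (z - of_real x)" "AE x in M. d \<le> cmod (w - of_real x)"
    using assms AE_Im_le_norm_diff[of z] AE_Im_le_norm_diff[of w] by (auto simp: d_def min_def elim: eventually_mono)
  have "z * w * (LINT x|M. 1 / ((z - complex_of_real x) * (w - complex_of_real x))) - 1
     = (LINT x|M. z * w * (1 / ((z - complex_of_real x) * (w - complex_of_real x)))) - (LINT x|M. 1)"
    unfolding integral_mult_right_zero using prob_space by simp
  also have "\<dots> = (LINT x|M. z * w * (1 / ((z - complex_of_real x) * (w - complex_of_real x))) - 1)"
    by (rule Bochner_Integration.integral_diff[symmetric])
       (intro integrable_mult_right integrable_const cauchy_kernel_prod_integrable[OF d])+
  finally have eq: "z * w * (LINT x|M. 1 / ((z - complex_of_real x) * (w - complex_of_real x))) - 1 = \<dots>" .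
  have "cmod \<dots> \<le> (LINT x|M. (1 + \<alpha>) * cmod (of_real x / (w - of_real x)) + cmod (of_real x / (z - of_real x)))"
  proof (rule norm_LINT_le)
    show "integrable M (\<lambda>x. (1 + \<alpha>) * cmod (of_real x / (w - of_real x)) + cmod (of_real x / (z - of_real x)))"
      by (intro Bochner_Integration.integrable_add integrable_mult_right integrable_norm defect_integrable assms)
    show "AE x in M. cmod (z * w * (1 / ((z - complex_of_real x) * (w - complex_of_real x))) - 1)
        \<le> (1 + \<alpha>) * cmod (of_real x / (w - of_real x)) + cmod (of_real x / (z - of_real x))"
    proof (rule AE_I2)
      fix x
      define a b where "a = z / (z - complex_of_real x)" and "b = w / (w - complex_of_real x)"
      \<comment> \<open>Splitting a b - 1 as a (b - 1) + (a - 1) reduces the defect of the product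
        kernel to the two single defects, since |a| \<le> 1 + \<alpha> in the cone.\<close>
      have "z * w * (1 / ((z - complex_of_real x) * (w - complex_of_real x))) - 1 = a * (b - 1) + (a - 1)"
        by (simp add: a_def b_def algebra_simps)
      also have "cmod \<dots> \<le> cmod a * cmod (b - 1) + cmod (a - 1)"
        by (rule order_trans[OF norm_triangle_ineq]) (simp add: norm_mult)
      also have "\<dots> \<le> (1 + \<alpha>) * cmod (b - 1) + cmod (a - 1)"
        unfolding a_def by (intro add_mono mult_right_mono norm_ratio_le_cone assms) auto
      finally show "cmod (z * w * (1 / ((z - complex_of_real x) * (w - complex_of_real x))) - 1)
        \<le> (1 + \<alpha>) * cmod (of_real x / (w - of_real x)) + cmod (of_real x / (z - of_real x))"
        unfolding a_def b_def ratio_defect_eq[OF assms(1)] ratio_defect_eq[OF assms(3)] .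
    qed
  qed auto
  also have "\<dots> = (1 + \<alpha>) * (LINT x|M. cmod (of_real x / (w - of_real x))) + (LINT x|M. cmod (of_real x / (z - of_real x)))"
    by (subst Bochner_Integration.integral_add)
       (simp_all add: integrable_norm[OF defect_integrable[OF assms(1)]] integrable_norm[OF defect_integrable[OF assms(3)]])
  finally show ?thesis unfolding eq .
qed

lemma cauchy_transform_nonzero: "0 < Im z \<Longrightarrow> cauchy_transform M z \<noteq> 0"
  using Im_cauchy_transform_neg[of z] by auto

text \<open>Near infinity in a cone, \<open>1 / G\<close> differs from the identity by a Lipschitz function with
  constant \<open>1 / 2\<close>; this yields both injectivity and, by Banach's fixed point theorem, the range.\<close>

lemma inverse_cauchy_transform_near_identity:
  assumes "0 < \<alpha>"
  obtains \<beta> where "0 < \<beta>"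
    "\<And>z. z \<in> upper_cone \<alpha> \<beta> \<Longrightarrow> cmod (1 / cauchy_transform M z - z) \<le> cmod z / 9"
    "\<And>z w. z \<in> upper_cone \<alpha> \<beta> \<Longrightarrow> w \<in> upper_cone \<alpha> \<beta> \<Longrightarrow>
       cmod ((1 / cauchy_transform M z - z) - (1 / cauchy_transform M w - w)) \<le> cmod (z - w) / 2"
proof -
  \<comment> \<open>With this \<epsilon> the quantities \<open>A\<close>, \<open>B1\<close>,
    \<open>B2\<close> below all lie within 1/10 of 1. Then (1/10)/(9/10) = 1/9 is the first bound,
    and A/(B1 B2) differs from 1 by at most 0.31/0.81 < 1/2.\<close>
  define \<epsilon> where "\<epsilon> = 1 / (10 * (2 + \<alpha>))"
  have \<epsilon>: "0 < \<epsilon>" "(1 + \<alpha>) * \<epsilon> + \<epsilon> = 1 / 10" "\<epsilon> \<le> 1 / 10"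
    using assms by (auto simp: \<epsilon>_def field_simps)
  obtain \<beta> where \<beta>: "0 < \<beta>"
    "\<And>z. \<beta> \<le> Im z \<Longrightarrow> \<bar>Re z\<bar> \<le> \<alpha> * Im z \<Longrightarrow> (LINT x|M. cmod (of_real x / (z - of_real x))) \<le> \<epsilon>"
    using cone_defect_small[OF \<epsilon>(1) assms] by blast
  have cone: "0 < Im z" "\<beta> \<le> Im z" "\<bar>Re z\<bar> \<le> \<alpha> * Im z" "z \<noteq> 0" if "z \<in> upper_cone \<alpha> \<beta>" for z
    using that by (auto simp: upper_cone_def)
  have B: "cmod (z * cauchy_transform M z - 1) \<le> 1 / 10" if "z \<in> upper_cone \<alpha> \<beta>" for z
    using norm_cauchy_transform_defect_le[OF cone(1)[OF that]] \<beta>(2)[OF cone(2,3)[OF that]] \<epsilon>(3) by linarith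
  have Bn: "9 / 10 \<le> cmod (z * cauchy_transform M z)" if "z \<in> upper_cone \<alpha> \<beta>" for z
    using B[OF that] norm_triangle_ineq2[of 1 "1 - z * cauchy_transform M z"]
    by (simp add: norm_minus_commute)
  show ?thesis
  proof (rule that[OF \<beta>(1)])
    fix z assume z: "z \<in> upper_cone \<alpha> \<beta>"
    let ?B = "z * cauchy_transform M z"
    have nz: "cauchy_transform M z \<noteq> 0" by (rule cauchy_transform_nonzero[OF cone(1)[OF z]])
    have "1 / cauchy_transform M z - z = - z * ((?B - 1) / ?B)"
      using nz cone(4)[OF z] by (simp add: field_simps)
    also have "cmod \<dots> = cmod z * (cmod (?B - 1) / cmod ?B)" by (simp only: norm_mult norm_minus_cancel norm_divide)
    also have "\<dots> \<le> cmod z * ((1 / 10) / (9 / 10))"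
      by (intro mult_left_mono frac_le B Bn z) auto
    finally show "cmod (1 / cauchy_transform M z - z) \<le> cmod z / 9" by simp
  next
    fix z w assume z: "z \<in> upper_cone \<alpha> \<beta>" and w: "w \<in> upper_cone \<alpha> \<beta>"
    define K where "K = (LINT x|M. 1 / ((z - complex_of_real x) * (w - complex_of_real x)))"
    define A B1 B2 where "A = z * w * K" and "B1 = z * cauchy_transform M z" and "B2 = w * cauchy_transform M w"
    have nz: "cauchy_transform M z \<noteq> 0" "cauchy_transform M w \<noteq> 0" "z \<noteq> 0" "w \<noteq> 0"
      using cauchy_transform_nonzero cone z w by blast+
    have b1: "cmod (B1 - 1) \<le> 1 / 10" "9 / 10 \<le> cmod B1" unfolding B1_def by (rule B Bn; fact)+
    have b2: "cmod (B2 - 1) \<le> 1 / 10" "9 / 10 \<le> cmod B2" unfolding B2_def by (rule B Bn; fact)+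
    have a: "cmod (A - 1) \<le> 1 / 10"
    proof -
      have "cmod (A - 1) \<le> (1 + \<alpha>) * (LINT x|M. cmod (of_real x / (w - of_real x))) + (LINT x|M. cmod (of_real x / (z - of_real x)))"
        unfolding A_def K_def by (rule norm_cauchy_product_defect_le) (use cone z w in auto)
      also have "\<dots> \<le> (1 + \<alpha>) * \<epsilon> + \<epsilon>"
        using assms by (intro add_mono mult_left_mono \<beta>(2) cone z w) auto
      finally show ?thesis using \<epsilon>(2) by simp
    qed
    have G: "cauchy_transform M z - cauchy_transform M w = (w - z) * K"
      unfolding K_def
      by (rule cauchy_transform_diff[of "min (Im z) (Im w)"])
         (use cone[OF z] cone[OF w] AE_Im_le_norm_diff[of z] AE_Im_le_norm_diff[of w] in
           \<open>auto simp: min_def elim: eventually_mono\<close>)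
    have "1 / cauchy_transform M z - 1 / cauchy_transform M w
        = - (cauchy_transform M z - cauchy_transform M w) / (cauchy_transform M z * cauchy_transform M w)"
      using nz by (simp add: field_simps)
    also have "\<dots> = (z - w) * (A / (B1 * B2))"
      unfolding G A_def B1_def B2_def using nz by (simp add: field_simps)
    finally have eq: "(1 / cauchy_transform M z - z) - (1 / cauchy_transform M w - w)
        = (z - w) * (A / (B1 * B2) - 1)" by (simp add: algebra_simps)
    have nB: "B1 \<noteq> 0" "B2 \<noteq> 0" using b1 b2 by auto
    have "A / (B1 * B2) - 1 = ((A - 1) - (B1 - 1) * (B2 - 1) - (B1 - 1) - (B2 - 1)) / (B1 * B2)"
      using nB by (simp add: field_simps)
    also have "cmod \<dots> \<le> (1/10 + 1/10 * (1/10) + 1/10 + 1/10) / (9/10 * (9/10))"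
      unfolding norm_divide norm_mult[of B1]
    proof (rule frac_le)
      show "cmod ((A - 1) - (B1 - 1) * (B2 - 1) - (B1 - 1) - (B2 - 1)) \<le> 1/10 + 1/10 * (1/10) + 1/10 + 1/10"
      proof -
        have "cmod ((B1 - 1) * (B2 - 1)) \<le> 1/10 * (1/10)"
          unfolding norm_mult by (intro mult_mono b1 b2) auto
        then show ?thesis
          using a b1(1) b2(1) norm_triangle_ineq4[of "A - 1" "(B1 - 1) * (B2 - 1)"]
            norm_triangle_ineq4[of "(A - 1) - (B1 - 1) * (B2 - 1)" "B1 - 1"]
            norm_triangle_ineq4[of "(A - 1) - (B1 - 1) * (B2 - 1) - (B1 - 1)" "B2 - 1"]
          by linarith
      qed
      show "9/10 * (9/10) \<le> cmod B1 * cmod B2" by (intro mult_mono b1 b2) auto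
    qed auto
    also have "\<dots> \<le> (1::real) / 2" by (simp add: field_simps)
    finally have "cmod (z - w) * cmod (A / (B1 * B2) - 1) \<le> cmod (z - w) * (1 / 2)"
      by (intro mult_left_mono) auto
    then show "cmod ((1 / cauchy_transform M z - z) - (1 / cauchy_transform M w - w)) \<le> cmod (z - w) / 2"
      unfolding eq norm_mult by simp
  qed
qed

section \<open>Existence of the inverse on a lower cone\<close>

lemma inj_on_if_inverse_near_identity:
  fixes f :: "complex \<Rightarrow> complex"
  assumes "\<And>z w. z \<in> S \<Longrightarrow> w \<in> S \<Longrightarrow> cmod ((1 / f z - z) - (1 / f w - w)) \<le> cmod (z - w) / 2"
  shows "inj_on f S"
proof (rule inj_onI)
  fix z w assume "z \<in> S" "w \<in> S" "f z = f w"
  then have "cmod (z - w) \<le> cmod (z - w) / 2"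
    using assms[of z w] by (simp add: norm_minus_commute)
  then show "z = w" by simp
qed

lemma cauchy_transform_inj_on_cone:
  assumes "0 < \<alpha>"
  obtains \<beta> where "0 < \<beta>" "inj_on (cauchy_transform M) (upper_cone \<alpha> \<beta>)"
proof -
  obtain \<beta> where "0 < \<beta>" and lip: "\<And>z w. z \<in> upper_cone \<alpha> \<beta> \<Longrightarrow> w \<in> upper_cone \<alpha> \<beta> \<Longrightarrow>
       cmod ((1 / cauchy_transform M z - z) - (1 / cauchy_transform M w - w)) \<le> cmod (z - w) / 2"
    using inverse_cauchy_transform_near_identity[OF assms] by metis
  moreover have "inj_on (cauchy_transform M) (upper_cone \<alpha> \<beta>)"
    by (rule inj_on_if_inverse_near_identity[OF lip])
  ultimately show ?thesis using that by blast
qed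

lemma ex_cauchy_invertible:
  obtains \<alpha> \<beta> \<delta> where "cauchy_invertible M 1 \<alpha> \<beta> \<delta>"
proof -
  obtain \<beta> where \<beta>: "0 < \<beta>"
    and near: "\<And>z. z \<in> upper_cone 3 \<beta> \<Longrightarrow> cmod (1 / cauchy_transform M z - z) \<le> cmod z / 9"
    and lip: "\<And>z w. z \<in> upper_cone 3 \<beta> \<Longrightarrow> w \<in> upper_cone 3 \<beta> \<Longrightarrow>
       cmod ((1 / cauchy_transform M z - z) - (1 / cauchy_transform M w - w)) \<le> cmod (z - w) / 2"
    using inverse_cauchy_transform_near_identity[of 3] by (metis zero_less_numeral)
  have inj: "inj_on (cauchy_transform M) (upper_cone 3 \<beta>)"
    by (rule inj_on_if_inverse_near_identity[OF lip])
  have "lower_cone 1 (1 / (3 * \<beta>)) \<subseteq> cauchy_transform M ` upper_cone 3 \<beta>"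
  proof
    fix v assume v: "v \<in> lower_cone 1 (1 / (3 * \<beta>))"
    then have v0: "v \<noteq> 0" and Imv: "Im v < 0" and Rev: "\<bar>Re v\<bar> < \<bar>Im v\<bar>" and nv: "cmod v < 1 / (3 * \<beta>)"
      by (auto simp: lower_cone_def)
    define \<zeta> where "\<zeta> = 1 / v"
    have n2: "0 < (cmod v)\<^sup>2" using v0 by simp
    have Im\<zeta>: "Im \<zeta> = - Im v / (cmod v)\<^sup>2" and Re\<zeta>: "Re \<zeta> = Re v / (cmod v)\<^sup>2"
      by (simp_all add: \<zeta>_def Re_divide Im_divide cmod_power2)
    have \<zeta>0: "0 < Im \<zeta>" using Imv n2 unfolding Im\<zeta> by (simp add: divide_neg_pos)
    have \<zeta>1: "\<bar>Re \<zeta>\<bar> < Im \<zeta>"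
      using divide_strict_right_mono[OF Rev n2] Imv unfolding Im\<zeta> Re\<zeta> by (simp add: abs_divide)
    have "3 * \<beta> < cmod \<zeta>"
    proof -
      have "cmod v * (3 * \<beta>) < 1" using nv \<beta> by (simp add: field_simps)
      then show ?thesis using v0 by (simp add: \<zeta>_def norm_divide field_simps)
    qed
    have "(cmod \<zeta>)\<^sup>2 \<le> (3 / 2 * Im \<zeta>)\<^sup>2"
    proof -
      have "\<bar>Re \<zeta>\<bar>\<^sup>2 \<le> (Im \<zeta>)\<^sup>2" using \<zeta>1 by (intro power_mono) auto
      moreover have "0 \<le> (Im \<zeta>)\<^sup>2" "(3 / 2 * Im \<zeta>)\<^sup>2 = 9 / 4 * (Im \<zeta>)\<^sup>2"
        by (simp_all add: power_mult_distrib power_divide)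
      ultimately show ?thesis unfolding cmod_power2 power2_abs by linarith
    qed
    then have \<zeta>2: "cmod \<zeta> \<le> 3 / 2 * Im \<zeta>" by (rule power2_le_imp_le) (use \<zeta>0 in simp)
    \<comment> \<open>Since |\<zeta>| \<le> (3/2) Im \<zeta>, a point z of the ball has Im z \<ge>
      (5/8) Im \<zeta> and |Re z| < (11/8) Im \<zeta>, hence |Re z| < 3 Im z; this explains the
      aperture 3. Also Im z \<ge> (5/12) |\<zeta>| > \<beta>.\<close>
    have ball: "z \<in> upper_cone 3 \<beta>" and ballnorm: "cmod z \<le> 5 / 4 * cmod \<zeta>"
      if "z \<in> cball \<zeta> (cmod \<zeta> / 4)" for z
    proof -
      have d: "cmod (\<zeta> - z) \<le> cmod \<zeta> / 4" using that by (simp add: dist_norm)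
      have "\<bar>Im \<zeta> - Im z\<bar> \<le> cmod \<zeta> / 4" "\<bar>Re \<zeta> - Re z\<bar> \<le> cmod \<zeta> / 4"
        using abs_Im_le_cmod[of "\<zeta> - z"] abs_Re_le_cmod[of "\<zeta> - z"] d by auto
      then have "\<beta> < Im z" "\<bar>Re z\<bar> < 3 * Im z"
        using \<zeta>2 \<zeta>1 \<zeta>0 \<open>3 * \<beta> < cmod \<zeta>\<close> by (auto simp: abs_if split: if_splits)
      then show "z \<in> upper_cone 3 \<beta>" using \<beta> by (auto simp: upper_cone_def)
      show "cmod z \<le> 5 / 4 * cmod \<zeta>" using norm_triangle_ineq2[of z \<zeta>] d by (simp add: norm_minus_commute)
    qed
    \<comment> \<open>A fixed point of \<open>?T\<close> solves 1/G(z) = \<zeta> = 1/v. The ball is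
      mapped into itself because (1/9)(5/4) < 1/4.\<close>
    let ?T = "\<lambda>z. \<zeta> - (1 / cauchy_transform M z - z)"
    have "\<exists>!z. z \<in> cball \<zeta> (cmod \<zeta> / 4) \<and> ?T z = z"
    proof (rule Banach_fix[where c = "1 / 2"])
      show "Topological_Spaces.complete (cball \<zeta> (cmod \<zeta> / 4))" by (simp add: compact_imp_complete)
      show "cball \<zeta> (cmod \<zeta> / 4) \<noteq> {}" by simp
      show "?T ` cball \<zeta> (cmod \<zeta> / 4) \<subseteq> cball \<zeta> (cmod \<zeta> / 4)"
      proof (rule image_subsetI)
        fix z assume z: "z \<in> cball \<zeta> (cmod \<zeta> / 4)"
        have "cmod (1 / cauchy_transform M z - z) \<le> cmod \<zeta> / 4"
          using near[OF ball[OF z]] ballnorm[OF z] norm_ge_zero[of \<zeta>] by linarith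
        then show "?T z \<in> cball \<zeta> (cmod \<zeta> / 4)" by (simp add: dist_norm)
      qed
      show "dist (?T z) (?T w) \<le> 1 / 2 * dist z w"
        if "z \<in> cball \<zeta> (cmod \<zeta> / 4)" "w \<in> cball \<zeta> (cmod \<zeta> / 4)" for z w
        using lip[OF ball ball, of z w] that
        by (simp add: dist_norm norm_minus_commute algebra_simps)
    qed auto
    then obtain z where z: "z \<in> cball \<zeta> (cmod \<zeta> / 4)" "?T z = z" by blast
    then have "1 / cauchy_transform M z = 1 / v" by (simp add: \<zeta>_def)
    then have "v = cauchy_transform M z" using v0
      by (metis div_by_0 divide_eq_0_iff nonzero_eq_divide_eq divide_divide_eq_right mult_1 one_neq_zero)
    then show "v \<in> cauchy_transform M ` upper_cone 3 \<beta>" using ball[OF z(1)] by blast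
  qed
  then have "cauchy_invertible M 1 3 \<beta> (1 / (3 * \<beta>))"
    using \<beta> inj by (simp add: cauchy_invertible_def)
  then show ?thesis by (rule that)
qed

text \<open>On the negative imaginary axis near 0 both inverses behave like 1/w, so their values
  enter a cone where the transform is injective and they agree there. That segment has a limit
  point, and the identity theorem extends the equality over the connected cone. Arbitrary right
  inverses are allowed because one of the form k(w) - t w is compared later.\<close>

lemma right_inverse_unique:
  assumes "0 < \<gamma>" "0 < \<delta>"
    and hol: "k1 holomorphic_on lower_cone \<gamma> \<delta>" "k2 holomorphic_on lower_cone \<gamma> \<delta>"
    and up: "\<And>w. w \<in> lower_cone \<gamma> \<delta> \<Longrightarrow> cauchy_transform M (k1 w) = w"
      "\<And>w. w \<in> lower_cone \<gamma> \<delta> \<Longrightarrow> cauchy_transform M (k2 w) = w"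
    and lim: "((\<lambda>s. - (\<i> * of_real s) * k1 (- (\<i> * of_real s))) \<longlongrightarrow> 1) (at_right 0)"
      "((\<lambda>s. - (\<i> * of_real s) * k2 (- (\<i> * of_real s))) \<longlongrightarrow> 1) (at_right 0)"
    and w: "w \<in> lower_cone \<gamma> \<delta>"
  shows "k1 w = k2 w"
proof -
  obtain \<beta> where \<beta>: "0 < \<beta>" and inj: "inj_on (cauchy_transform M) (upper_cone 1 \<beta>)"
    using cauchy_transform_inj_on_cone[of 1] by auto
  have small: "\<forall>\<^sub>F s in at_right 0. k (- (\<i> * of_real s)) \<in> upper_cone 1 \<beta>"
    if k: "((\<lambda>s. - (\<i> * of_real s) * k (- (\<i> * of_real s))) \<longlongrightarrow> 1) (at_right 0)" for k
  proof -
    have "\<forall>\<^sub>F s in at_right 0. dist (- (\<i> * of_real s) * k (- (\<i> * of_real s))) 1 < 1 / 2"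
      by (rule tendstoD[OF k]) simp
    moreover have "\<forall>\<^sub>F s in at_right (0::real). 0 < s \<and> s < 1 / (2 * \<beta>)"
      using eventually_at_right_real[of 0 "1 / (2 * \<beta>)"] \<beta> by simp
    ultimately show ?thesis
    proof eventually_elim
      case (elim s)
      define q where "q = - (\<i> * of_real s) * k (- (\<i> * of_real s))"
      have "\<bar>Re q - 1\<bar> < 1 / 2" "\<bar>Im q\<bar> < 1 / 2"
        using elim(1) abs_Re_le_cmod[of "q - 1"] abs_Im_le_cmod[of "q - 1"]
        unfolding q_def[symmetric] dist_norm by auto
      then have q: "1 / 2 < Re q" "\<bar>Im q\<bar> < Re q" by linarith+
      have "Re q = s * Im (k (- (\<i> * of_real s)))" "Im q = - s * Re (k (- (\<i> * of_real s)))"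
        by (simp_all add: q_def)
      then have k: "Im (k (- (\<i> * of_real s))) = Re q / s" "Re (k (- (\<i> * of_real s))) = - Im q / s"
        using elim(2) by auto
      have "1 / 2 / s < Re q / s" using q(1) elim(2) by (intro divide_strict_right_mono) auto
      moreover have "\<beta> < 1 / 2 / s" using elim(2) \<beta> by (simp add: field_simps)
      moreover have "\<bar>- Im q / s\<bar> < Re q / s" using divide_strict_right_mono[OF q(2), of s] elim(2) by simp
      ultimately show ?case unfolding upper_cone_def mem_Collect_eq k using \<beta> by simp
    qed
  qed
  have "\<forall>\<^sub>F s in at_right (0::real). 0 < s \<and> s < \<delta>"
    using eventually_at_right_real[of 0 \<delta>] assms(2) by simp
  with small[OF lim(1)] small[OF lim(2)]
  have "\<forall>\<^sub>F s in at_right 0. k1 (- (\<i> * of_real s)) = k2 (- (\<i> * of_real s))"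
  proof eventually_elim
    case (elim s)
    have "- (\<i> * of_real s) \<in> lower_cone \<gamma> \<delta>"
      using elim(3) assms(1) by (intro imaginary_in_lower_cone) auto
    then show ?case using inj_onD[OF inj _ elim(1,2)] up by simp
  qed
  then obtain b where b: "0 < b" "\<And>s. 0 < s \<Longrightarrow> s < b \<Longrightarrow> k1 (- (\<i> * of_real s)) = k2 (- (\<i> * of_real s))"
    unfolding eventually_at_right_field by auto
  define s0 where "s0 = min b \<delta>"
  have s0: "0 < s0" using b assms by (simp add: s0_def)
  let ?p = "\<lambda>s. - (\<i> * complex_of_real s)"
  let ?U = "?p ` {0<..<s0}"
  have "k1 w - k2 w = 0"
  proof (rule analytic_continuation[where f = "\<lambda>w. k1 w - k2 w" and U = ?U and \<xi> = "?p (s0 / 2)"])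
    show "(\<lambda>w. k1 w - k2 w) holomorphic_on lower_cone \<gamma> \<delta>" by (intro holomorphic_intros hol)
    show U: "?U \<subseteq> lower_cone \<gamma> \<delta>"
      using assms by (auto simp: s0_def intro!: imaginary_in_lower_cone)
    show "?p (s0 / 2) \<in> lower_cone \<gamma> \<delta>" by (rule subsetD[OF U], rule imageI) (use s0 in simp)
    show "?p (s0 / 2) islimpt ?U"
    proof (rule connected_imp_perfect)
      show "connected ?U" by (intro connected_continuous_image continuous_intros) simp
      show "?p (s0 / 2) \<in> ?U" by (rule imageI) (use s0 in simp)
      show "?U \<noteq> {x}" for x
      proof
        assume "?U = {x}"
        moreover have "?p (s0 / 2) \<in> ?U" "?p (s0 / 3) \<in> ?U" by (rule imageI, use s0 in simp)+
        ultimately have "?p (s0 / 2) = ?p (s0 / 3)" by (metis singletonD)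
        then show False using s0 by (simp add: complex_eq_iff)
      qed
    qed
    show "k1 z - k2 z = 0" if "z \<in> ?U" for z
      using that b(2) by (auto simp: s0_def)
  qed (simp_all add: open_lower_cone convex_connected[OF convex_lower_cone] w)
  then show ?thesis by simp
qed

lemma cauchy_inverse_props:
  assumes "cauchy_invertible M \<gamma> \<alpha> \<beta> \<delta>"
  defines "K \<equiv> inv_into (upper_cone \<alpha> \<beta>) (cauchy_transform M)"
  shows "w \<in> lower_cone \<gamma> \<delta> \<Longrightarrow> K w \<in> upper_cone \<alpha> \<beta>"
    and "w \<in> lower_cone \<gamma> \<delta> \<Longrightarrow> cauchy_transform M (K w) = w"
    and "K holomorphic_on lower_cone \<gamma> \<delta>"
    and "((\<lambda>s. - (\<i> * of_real s) * K (- (\<i> * of_real s))) \<longlongrightarrow> 1) (at_right 0)"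
proof -
  let ?G = "cauchy_transform M"
  have pos: "0 < \<gamma>" "0 < \<alpha>" "0 < \<beta>" "0 < \<delta>" and inj: "inj_on ?G (upper_cone \<alpha> \<beta>)"
    and sub: "lower_cone \<gamma> \<delta> \<subseteq> ?G ` upper_cone \<alpha> \<beta>"
    using assms(1) by (auto simp: cauchy_invertible_def)
  show K1: "K w \<in> upper_cone \<alpha> \<beta>" if "w \<in> lower_cone \<gamma> \<delta>" for w
    unfolding K_def using that sub by (intro inv_into_into) auto
  show K2: "?G (K w) = w" if "w \<in> lower_cone \<gamma> \<delta>" for w
    unfolding K_def using that sub by (intro f_inv_into_f) auto
  have "?G holomorphic_on upper_cone \<alpha> \<beta>"
    by (rule holomorphic_on_subset[OF cauchy_transform_holomorphic]) (auto simp: upper_cone_def)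
  from holomorphic_has_inverse[OF this open_upper_cone inj]
  obtain g where g: "g holomorphic_on ?G ` upper_cone \<alpha> \<beta>" "\<And>z. z \<in> upper_cone \<alpha> \<beta> \<Longrightarrow> g (?G z) = z"
    by metis
  have "K w = g w" if "w \<in> lower_cone \<gamma> \<delta>" for w
    using g(2)[OF K1[OF that]] K2[OF that] by simp
  then show "K holomorphic_on lower_cone \<gamma> \<delta>"
    using holomorphic_on_subset[OF g(1) sub] holomorphic_cong by metis
  show "((\<lambda>s. - (\<i> * of_real s) * K (- (\<i> * of_real s))) \<longlongrightarrow> 1) (at_right 0)"
  proof (rule tendstoI)
    fix \<epsilon> :: real assume "0 < \<epsilon>"
    obtain \<beta>' where \<beta>': "0 < \<beta>'"
      "\<And>z. \<beta>' \<le> Im z \<Longrightarrow> \<bar>Re z\<bar> \<le> \<alpha> * Im z \<Longrightarrow> (LINT x|M. cmod (of_real x / (z - of_real x))) \<le> \<epsilon> / 2"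
      using cone_defect_small[of "\<epsilon> / 2" \<alpha>] \<open>0 < \<epsilon>\<close> pos by auto
    \<comment> \<open>As w tends to 0, \<open>K w\<close> has to leave every bounded height.
      \<open>C\<close> is the compact part of the cone up to height \<open>\<beta>'\<close>; the
      transform has no zero there, so its modulus is at least some m > 0, and |w| < m forces
      \<open>K w\<close> above \<open>\<beta>'\<close>, where the defect is small.\<close>
    define C where "C = {z. \<bar>Re z\<bar> \<le> \<alpha> * Im z \<and> \<beta> \<le> Im z \<and> Im z \<le> \<beta>'}"
    have "closed C" unfolding C_def
      by (intro closed_Collect_conj closed_Collect_le continuous_intros)
    moreover have "bounded C"
    proof (rule boundedI)
      fix z assume "z \<in> C"
      then have "cmod z \<le> (1 + \<alpha>) * Im z" "Im z \<le> \<beta>'"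
        using pos by (auto simp: C_def intro!: norm_le_Im_cone)
      moreover have "(1 + \<alpha>) * Im z \<le> (1 + \<alpha>) * \<beta>'"
        using calculation pos by (intro mult_left_mono) auto
      ultimately show "cmod z \<le> (1 + \<alpha>) * \<beta>'" by linarith
    qed
    ultimately have comp: "compact C" by (simp add: compact_eq_bounded_closed)
    have Cup: "C \<subseteq> {z. 0 < Im z}" using pos by (auto simp: C_def)
    obtain m where m: "0 < m" "\<And>z. z \<in> C \<Longrightarrow> m \<le> cmod (?G z)"
    proof (cases "C = {}")
      case False
      have "continuous_on C (\<lambda>z. cmod (?G z))"
        by (intro continuous_on_norm holomorphic_on_imp_continuous_on
            holomorphic_on_subset[OF cauchy_transform_holomorphic Cup])
      from continuous_attains_inf[OF comp False this]
      obtain z0 where "z0 \<in> C" "\<forall>z\<in>C. cmod (?G z0) \<le> cmod (?G z)" by blast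
      moreover have "?G z0 \<noteq> 0" using \<open>z0 \<in> C\<close> Cup by (intro cauchy_transform_nonzero) auto
      ultimately show ?thesis by (intro that[of "cmod (?G z0)"]) auto
    qed (use that[of 1] in auto)
    have "\<forall>\<^sub>F s in at_right (0::real). 0 < s \<and> s < min m \<delta>"
      using eventually_at_right_real[of 0 "min m \<delta>"] m pos by simp
    then show "\<forall>\<^sub>F s in at_right 0. dist (- (\<i> * of_real s) * K (- (\<i> * of_real s))) 1 < \<epsilon>"
    proof eventually_elim
      case (elim s)
      let ?w = "- (\<i> * complex_of_real s)"
      have w: "?w \<in> lower_cone \<gamma> \<delta>" using elim pos by (intro imaginary_in_lower_cone) auto
      have up: "\<beta> < Im (K ?w)" "\<bar>Re (K ?w)\<bar> \<le> \<alpha> * Im (K ?w)" "0 < Im (K ?w)"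
        using K1[OF w] by (auto simp: upper_cone_def)
      have "K ?w \<notin> C"
      proof
        assume "K ?w \<in> C"
        then have "m \<le> cmod (?G (K ?w))" by (rule m)
        then show False using K2[OF w] elim by (simp add: norm_mult)
      qed
      then have "\<beta>' \<le> Im (K ?w)" using up by (auto simp: C_def)
      then have "cmod (K ?w * ?G (K ?w) - 1) \<le> \<epsilon> / 2"
        using norm_cauchy_transform_defect_le[OF up(3)] \<beta>'(2)[of "K ?w"] up(2) by linarith
      then show ?case using K2[OF w] \<open>0 < \<epsilon>\<close> by (simp add: dist_norm mult.commute)
    qed
  qed
qed

lemma R_transform_eqI:
  assumes "0 < \<gamma>" "0 < \<delta>"
    and "k holomorphic_on lower_cone \<gamma> \<delta>"
    and "\<And>w. w \<in> lower_cone \<gamma> \<delta> \<Longrightarrow> cauchy_transform M (k w) = w"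
    and "((\<lambda>s. - (\<i> * of_real s) * k (- (\<i> * of_real s))) \<longlongrightarrow> 1) (at_right 0)"
    and w: "w \<in> lower_cone \<gamma> \<delta>" "w \<in> R_domain M"
  shows "R_transform M w = k w - 1 / w"
proof -
  have *: "inv_into (upper_cone \<alpha> \<beta>) (cauchy_transform M) w = k w"
    if inv: "cauchy_invertible M \<gamma>' \<alpha> \<beta> \<delta>'" and w': "w \<in> lower_cone \<gamma>' \<delta>'" for \<gamma>' \<alpha> \<beta> \<delta>'
  proof -
    note K = cauchy_inverse_props[OF inv]
    have sub: "lower_cone (min \<gamma> \<gamma>') (min \<delta> \<delta>') \<subseteq> lower_cone \<gamma> \<delta>"
      "lower_cone (min \<gamma> \<gamma>') (min \<delta> \<delta>') \<subseteq> lower_cone \<gamma>' \<delta>'"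
      by (auto simp flip: lower_cone_Int)
    show ?thesis
  proof (rule right_inverse_unique[of "min \<gamma> \<gamma>'" "min \<delta> \<delta>'"
        "inv_into (upper_cone \<alpha> \<beta>) (cauchy_transform M)" k w])
    show "0 < min \<gamma> \<gamma>'" "0 < min \<delta> \<delta>'" using assms(1,2) inv by (auto simp: cauchy_invertible_def)
    show "inv_into (upper_cone \<alpha> \<beta>) (cauchy_transform M) holomorphic_on lower_cone (min \<gamma> \<gamma>') (min \<delta> \<delta>')"
      by (rule holomorphic_on_subset[OF K(3) sub(2)])
    show "k holomorphic_on lower_cone (min \<gamma> \<gamma>') (min \<delta> \<delta>')"
      by (rule holomorphic_on_subset[OF assms(3) sub(1)])
    show "w \<in> lower_cone (min \<gamma> \<gamma>') (min \<delta> \<delta>')" using w w' by (simp flip: lower_cone_Int)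
  qed (use K(2,4) sub assms(4,5) in auto)
  qed
  obtain \<gamma>' \<alpha> \<beta> \<delta>' where "cauchy_invertible M \<gamma>' \<alpha> \<beta> \<delta>'" "w \<in> lower_cone \<gamma>' \<delta>'"
    using w(2) by (auto simp: R_domain_def)
  then show ?thesis
    unfolding R_transform_def
  proof (intro the_equality)
    show "\<exists>\<gamma> \<alpha> \<beta> \<delta>. cauchy_invertible M \<gamma> \<alpha> \<beta> \<delta> \<and> w \<in> lower_cone \<gamma> \<delta> \<and>
        k w - 1 / w = inv_into (upper_cone \<alpha> \<beta>) (cauchy_transform M) w - 1 / w"
      using \<open>cauchy_invertible M \<gamma>' \<alpha> \<beta> \<delta>'\<close> \<open>w \<in> lower_cone \<gamma>' \<delta>'\<close> * by metis
  qed (elim exE conjE, simp add: *)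
qed

section \<open>The R-transform determines the measure\<close>

lemma lower_cone_subset_R_domain:
  obtains \<delta> where "0 < \<delta>" "lower_cone 1 \<delta> \<subseteq> R_domain M"
proof -
  obtain \<alpha> \<beta> \<delta> where "cauchy_invertible M 1 \<alpha> \<beta> \<delta>" by (rule ex_cauchy_invertible)
  moreover from this have "0 < \<delta>" by (simp add: cauchy_invertible_def)
  ultimately show ?thesis by (intro that[of \<delta>]) (auto simp: R_domain_def)
qed

end

text \<open>Equal R-transforms make the two inverses equal on a small cone. The image of that cone
  is a nonempty open subset of the upper half-plane on which both Cauchy transforms are the inverse
  of the same map, and analytic continuation does the rest.\<close>

lemma R_transform_determines_distribution:
  assumes "real_distribution L1" "real_distribution L2" "0 < \<delta>"
    and eq: "\<And>w. w \<in> lower_cone 1 \<delta> \<Longrightarrow> w \<in> R_domain L1 \<Longrightarrow> w \<in> R_domain L2 \<Longrightarrow>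
        R_transform L1 w = R_transform L2 w"
  shows "L1 = L2"
proof (rule cauchy_transform_unique[OF assms(1,2)])
  interpret A: real_distribution L1 by fact
  interpret B: real_distribution L2 by fact
  obtain \<alpha>1 \<beta>1 \<delta>1 where inv1: "cauchy_invertible L1 1 \<alpha>1 \<beta>1 \<delta>1" by (rule A.ex_cauchy_invertible)
  obtain \<alpha>2 \<beta>2 \<delta>2 where inv2: "cauchy_invertible L2 1 \<alpha>2 \<beta>2 \<delta>2" by (rule B.ex_cauchy_invertible)
  note K1 = A.cauchy_inverse_props[OF inv1] and K2 = B.cauchy_inverse_props[OF inv2]
  let ?K1 = "inv_into (upper_cone \<alpha>1 \<beta>1) (cauchy_transform L1)"
  let ?K2 = "inv_into (upper_cone \<alpha>2 \<beta>2) (cauchy_transform L2)"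
  have pos: "0 < \<delta>1" "0 < \<delta>2" using inv1 inv2 by (auto simp: cauchy_invertible_def)
  define d where "d = min \<delta> (min \<delta>1 \<delta>2)"
  have d: "0 < d" "lower_cone 1 d \<subseteq> lower_cone 1 \<delta>" "lower_cone 1 d \<subseteq> lower_cone 1 \<delta>1"
    "lower_cone 1 d \<subseteq> lower_cone 1 \<delta>2"
    using pos assms(3) by (simp_all add: d_def lower_cone_mono)
  have KK: "?K1 w = ?K2 w" if w: "w \<in> lower_cone 1 d" for w
  proof -
    have dom: "w \<in> R_domain L1" "w \<in> R_domain L2"
      unfolding R_domain_def using w d inv1 inv2 by blast+
    have "R_transform L1 w = ?K1 w - 1 / w"
      by (rule A.R_transform_eqI[OF _ pos(1) K1(3,2,4)]) (use w d dom in auto)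
    moreover have "R_transform L2 w = ?K2 w - 1 / w"
      by (rule B.R_transform_eqI[OF _ pos(2) K2(3,2,4)]) (use w d dom in auto)
    ultimately show ?thesis using eq[of w] dom w d by auto
  qed
  let ?Z = "?K1 ` lower_cone 1 d"
  have openZ: "open ?Z"
  proof (rule open_mapping_thm3[OF _ open_lower_cone])
    show "?K1 holomorphic_on lower_cone 1 d" by (rule holomorphic_on_subset[OF K1(3) d(3)])
    show "inj_on ?K1 (lower_cone 1 d)" by (rule inj_on_inverseI[of _ "cauchy_transform L1"]) (use K1(2) d in auto)
  qed
  have Zup: "?Z \<subseteq> {z. 0 < Im z}" using K1(1) d by (auto simp: upper_cone_def)
  have Zne: "?Z \<noteq> {}" using imaginary_in_lower_cone[of 1 "d/2" d] d(1) by auto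
  have Zeq: "cauchy_transform L1 z = cauchy_transform L2 z" if "z \<in> ?Z" for z
    using that K1(2) K2(2) KK d by fastforce
  fix z :: complex assume z: "0 < Im z"
  show "cauchy_transform L1 z = cauchy_transform L2 z"
  proof (rule analytic_continuation_open[OF openZ open_halfspace_Im_gt Zne _ Zup
        A.cauchy_transform_holomorphic B.cauchy_transform_holomorphic Zeq])
    show "connected {z. 0 < Im z}" by (intro convex_connected convex_halfspace_Im_gt)
  qed (use z in auto)
qed

text \<open>The defining identity holds only on the intersection of three domains, one of which
  depends on the candidate. Since the domains of \<open>M\<close> and \<open>N\<close> share a cone
  of aperture 1, two candidates can still be compared on a common cone.\<close>

lemma free_convolution_eqI:
  assumes "real_distribution M" "real_distribution N" "real_distribution L"
    and R: "\<And>w. w \<in> R_domain M \<Longrightarrow> w \<in> R_domain N \<Longrightarrow> w \<in> R_domain L \<Longrightarrow>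
      R_transform L w = R_transform M w + R_transform N w"
  shows "M \<boxplus> N = L"
  unfolding free_convolution_def
proof (rule the_equality)
  fix L' assume L': "real_distribution L' \<and>
    (\<forall>w\<in>R_domain M \<inter> R_domain N \<inter> R_domain L'. R_transform L' w = R_transform M w + R_transform N w)"
  obtain \<delta>1 where \<delta>1: "0 < \<delta>1" "lower_cone 1 \<delta>1 \<subseteq> R_domain M"
    by (rule real_distribution.lower_cone_subset_R_domain[OF assms(1)])
  obtain \<delta>2 where \<delta>2: "0 < \<delta>2" "lower_cone 1 \<delta>2 \<subseteq> R_domain N"
    by (rule real_distribution.lower_cone_subset_R_domain[OF assms(2)])
  show "L' = L"
  proof (rule R_transform_determines_distribution[of _ _ "min \<delta>1 \<delta>2"])
    fix w assume w: "w \<in> lower_cone 1 (min \<delta>1 \<delta>2)" "w \<in> R_domain L'" "w \<in> R_domain L"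
    have "lower_cone 1 (min \<delta>1 \<delta>2) \<subseteq> R_domain M \<inter> R_domain N"
      using \<delta>1 \<delta>2 lower_cone_mono[of 1 1 "min \<delta>1 \<delta>2" \<delta>1] lower_cone_mono[of 1 1 "min \<delta>1 \<delta>2" \<delta>2] by auto
    then have dom: "w \<in> R_domain M" "w \<in> R_domain N" using w(1) by auto
    have "R_transform L' w = R_transform M w + R_transform N w" using L' dom w(2) by blast
    then show "R_transform L' w = R_transform L w" using R[OF dom w(3)] by simp
  qed (use L' assms \<delta>1 \<delta>2 in auto)
qed (use assms in auto)

section \<open>The semicircle distribution\<close>

text \<open>With \<open>q\<^sub>1, q\<^sub>2\<close> the square roots of \<open>z \<mp> 2 sqrt t\<close> in the closed first quadrant,
  \<open>(z - sqrt (z\<^sup>2 - 4 t)) / (2 t) = 4 / (q\<^sub>1 + q\<^sub>2)\<^sup>2\<close>; the right hand side is continuous up to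
  the real axis and visibly of order \<open>1 / z\<close>.\<close>

definition semicircle_cauchy :: "real \<Rightarrow> complex \<Rightarrow> complex" where
  "semicircle_cauchy t z = 4 / (csqrt (z - of_real (2 * sqrt t)) + csqrt (z + of_real (2 * sqrt t)))\<^sup>2"

lemma csqrt_upper:
  "0 \<le> Im z \<Longrightarrow> csqrt z = Complex (sqrt ((cmod z + Re z) / 2)) (sqrt ((cmod z - Re z) / 2))"
  by (simp add: complex_eq_iff sgn_if)

lemma csqrt_first_quadrant:
  assumes "0 \<le> Im z" shows "0 \<le> Re (csqrt z)" "0 \<le> Im (csqrt z)"
proof -
  have "Re z \<le> cmod z" "- Re z \<le> cmod z" using abs_Re_le_cmod[of z] by auto
  then show "0 \<le> Re (csqrt z)" "0 \<le> Im (csqrt z)" using assms by (simp_all add: csqrt_upper del: csqrt.sel)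
qed

text \<open>The principal root jumps across the negative axis, but its value on that axis is the
  limit from above, so it is continuous on the closed upper half-plane.\<close>

lemma continuous_on_csqrt_upper: "continuous_on {z. 0 \<le> Im z} csqrt"
proof -
  have "continuous_on {z. 0 \<le> Im z} (\<lambda>z. Complex (sqrt ((cmod z + Re z) / 2)) (sqrt ((cmod z - Re z) / 2)))"
    by (intro continuous_intros) auto
  then show ?thesis by (rule continuous_on_eq) (simp add: csqrt_upper)
qed

text \<open>|a + b|^2 = |a|^2 + |b|^2 + 2 Re (a conj b), and the last term is nonnegative in the
  first quadrant. This keeps the denominator of \<open>semicircle_cauchy\<close> away from 0 and
  yields its decay.\<close>

lemma norm_square_sum_first_quadrant:
  assumes "0 \<le> Re a" "0 \<le> Im a" "0 \<le> Re b" "0 \<le> Im b"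
  shows "cmod (a\<^sup>2) + cmod (b\<^sup>2) \<le> cmod ((a + b)\<^sup>2)"
proof -
  have "0 \<le> Re a * Re b + Im a * Im b" using assms by simp
  then show ?thesis unfolding norm_power cmod_power2 by (simp add: power2_eq_square algebra_simps)
qed

context
  fixes t :: real
  assumes t: "0 < t"
begin

lemma semicircle_cauchy_denominator:
  assumes "0 \<le> Im z"
  shows "2 * cmod z \<le> cmod ((csqrt (z - of_real (2 * sqrt t)) + csqrt (z + of_real (2 * sqrt t)))\<^sup>2)"
    and "4 * sqrt t \<le> cmod ((csqrt (z - of_real (2 * sqrt t)) + csqrt (z + of_real (2 * sqrt t)))\<^sup>2)"
proof -
  let ?a = "z - of_real (2 * sqrt t)" and ?b = "z + of_real (2 * sqrt t)"
  have "cmod ?a + cmod ?b \<le> cmod ((csqrt ?a + csqrt ?b)\<^sup>2)"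
    using norm_square_sum_first_quadrant[of "csqrt ?a" "csqrt ?b"]
      csqrt_first_quadrant[of ?a] csqrt_first_quadrant[of ?b] assms by (simp del: csqrt.sel)
  moreover have "2 * cmod z \<le> cmod ?a + cmod ?b"
  proof -
    have "cmod (2 * z) = cmod (?a + ?b)" by simp
    then show ?thesis using norm_triangle_ineq[of ?a ?b] by (simp only: norm_mult norm_numeral)
  qed
  moreover have "4 * sqrt t \<le> cmod ?a + cmod ?b"
  proof -
    have "cmod (?b - ?a) = cmod (complex_of_real (4 * sqrt t))" by simp
    also have "\<dots> = 4 * sqrt t" using t by (simp only: norm_of_real) simp
    finally show ?thesis using norm_triangle_ineq4[of ?b ?a] by simp
  qed
  ultimately show "2 * cmod z \<le> cmod ((csqrt ?a + csqrt ?b)\<^sup>2)" "4 * sqrt t \<le> cmod ((csqrt ?a + csqrt ?b)\<^sup>2)"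
    by linarith+
qed

lemma semicircle_cauchy_denominator_nonzero:
  "0 \<le> Im z \<Longrightarrow> csqrt (z - of_real (2 * sqrt t)) + csqrt (z + of_real (2 * sqrt t)) \<noteq> 0"
  using semicircle_cauchy_denominator(2)[of z] t by auto

text \<open>With a^2 and b^2 equal to z minus and plus 2 sqrt t, (b - a)(b + a) = 4 sqrt t turns 4
  t/(a + b)^2 into (b - a)^2/4; added to (a + b)^2/4 this gives (a^2 + b^2)/2 = z. Read backwards,
  the equation says that the inverse is t w + 1/w.\<close>

lemma semicircle_cauchy_equation:
  assumes "0 \<le> Im z"
  shows "z = t * semicircle_cauchy t z + 1 / semicircle_cauchy t z"
proof -
  define a b where "a = csqrt (z - of_real (2 * sqrt t))" and "b = csqrt (z + of_real (2 * sqrt t))"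
  have a: "a\<^sup>2 = z - of_real (2 * sqrt t)" and b: "b\<^sup>2 = z + of_real (2 * sqrt t)" by (simp_all add: a_def b_def)
  have nz: "a + b \<noteq> 0" using semicircle_cauchy_denominator_nonzero[OF assms] by (simp add: a_def b_def)
  have "(b - a) * (a + b) = of_real (4 * sqrt t)"
    using a b by (simp add: power2_eq_square algebra_simps)
  then have "((b - a) * (a + b))\<^sup>2 = of_real ((4 * sqrt t)\<^sup>2)" by simp
  also have "(4 * sqrt t)\<^sup>2 = 16 * t" using t by (simp add: power_mult_distrib)
  finally have "(b - a)\<^sup>2 * (a + b)\<^sup>2 = 16 * of_real t" by (simp add: power_mult_distrib)
  then have 1: "4 * of_real t / (a + b)\<^sup>2 = (b - a)\<^sup>2 / 4" using nz by (simp add: field_simps)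
  have "t * semicircle_cauchy t z + 1 / semicircle_cauchy t z = 4 * of_real t / (a + b)\<^sup>2 + (a + b)\<^sup>2 / 4"
    by (simp add: semicircle_cauchy_def a_def b_def)
  also have "\<dots> = (b - a)\<^sup>2 / 4 + (a + b)\<^sup>2 / 4" unfolding 1 ..
  also have "\<dots> = (a\<^sup>2 + b\<^sup>2) / 2" by (simp add: power2_eq_square field_simps)
  also have "\<dots> = z" by (simp add: a b)
  finally show ?thesis ..
qed

text \<open>Outside the support the two roots are both real or both imaginary, so the square of
  their sum is real. Inside, the sum is v + i u with u^2 + v^2 = 4 sqrt t independent of x, and only
  the cross term 2 u v = 2 sqrt (4 t - x^2) reaches the imaginary part.\<close>

lemma semicircle_cauchy_real:
  "- Im (semicircle_cauchy t (of_real x)) / pi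
     = indicator {-2 * sqrt t..2 * sqrt t} x * (1 / (2 * pi * t) * sqrt (4 * t - x\<^sup>2))"
proof -
  let ?a = "complex_of_real x - of_real (2 * sqrt t)" and ?b = "complex_of_real x + of_real (2 * sqrt t)"
  have ab: "?a = of_real (x - 2 * sqrt t)" "?b = of_real (x + 2 * sqrt t)" by simp_all
  have pos: "0 < sqrt t" using t by simp
  consider "2 * sqrt t < x" | "x < - 2 * sqrt t" | "- 2 * sqrt t \<le> x" "x \<le> 2 * sqrt t" by linarith
  then show ?thesis
  proof cases
    case 1
    then have "0 \<le> x - 2 * sqrt t" "0 \<le> x + 2 * sqrt t" using pos by linarith+
    then have "csqrt ?a = of_real (sqrt (x - 2 * sqrt t))" "csqrt ?b = of_real (sqrt (x + 2 * sqrt t))"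
      unfolding ab by (simp_all only: of_real_sqrt)
    then have "semicircle_cauchy t (of_real x) = of_real (4 / (sqrt (x - 2 * sqrt t) + sqrt (x + 2 * sqrt t))\<^sup>2)"
      by (simp add: semicircle_cauchy_def)
    then have "Im (semicircle_cauchy t (of_real x)) = 0" by (simp only: Im_complex_of_real)
    then show ?thesis using 1 by simp
  next
    case 2
    then have "x - 2 * sqrt t \<le> 0" "x + 2 * sqrt t \<le> 0" using pos by linarith+
    then have "csqrt ?a = \<i> * of_real (sqrt (- (x - 2 * sqrt t)))" "csqrt ?b = \<i> * of_real (sqrt (- (x + 2 * sqrt t)))"
      unfolding ab by (subst csqrt_of_real_nonpos; simp)+
    then have "csqrt ?a + csqrt ?b = \<i> * of_real (sqrt (- (x - 2 * sqrt t)) + sqrt (- (x + 2 * sqrt t)))"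
      by (simp add: distrib_left)
    then have "semicircle_cauchy t (of_real x)
        = of_real (- 4 / (sqrt (- (x - 2 * sqrt t)) + sqrt (- (x + 2 * sqrt t)))\<^sup>2)"
      unfolding semicircle_cauchy_def by (simp only: power_mult_distrib i_squared) simp
    then have "Im (semicircle_cauchy t (of_real x)) = 0" by (simp only: Im_complex_of_real)
    then show ?thesis using 2 by simp
  next
    case 3
    define u v where "u = sqrt (2 * sqrt t - x)" and "v = sqrt (2 * sqrt t + x)"
    have u: "u\<^sup>2 = 2 * sqrt t - x" and v: "v\<^sup>2 = 2 * sqrt t + x" using 3 by (simp_all add: u_def v_def)
    have "csqrt ?a = \<i> * of_real u"
      unfolding ab using 3 by (subst csqrt_of_real_nonpos) (auto simp: u_def)
    moreover have "csqrt ?b = of_real v"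
      unfolding ab using 3 by (subst csqrt_of_real_nonneg) (auto simp: v_def add.commute)
    ultimately have "semicircle_cauchy t (of_real x) = 4 / (Complex v u)\<^sup>2"
      by (simp add: semicircle_cauchy_def Complex_eq add.commute)
    also have "\<dots> = 4 * (Complex v (-u))\<^sup>2 / of_real (16 * t)"
    proof -
      have "Complex v u * Complex v (-u) = of_real (u\<^sup>2 + v\<^sup>2)"
        by (simp add: complex_eq_iff power2_eq_square)
      then have "(Complex v u)\<^sup>2 * (Complex v (-u))\<^sup>2 = (of_real (u\<^sup>2 + v\<^sup>2))\<^sup>2"
        by (simp only: power_mult_distrib[symmetric])
      also have "u\<^sup>2 + v\<^sup>2 = 4 * sqrt t" by (simp add: u v)
      also have "(complex_of_real (4 * sqrt t))\<^sup>2 = of_real (16 * t)"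
        using t by (simp add: power_mult_distrib flip: of_real_power)
      finally have eq: "(Complex v u)\<^sup>2 * (Complex v (-u))\<^sup>2 = of_real (16 * t)" .
      have "complex_of_real (16 * t) \<noteq> 0" using t by simp
      then have "(Complex v u)\<^sup>2 \<noteq> 0" "(Complex v (-u))\<^sup>2 \<noteq> 0" using eq by auto
      moreover have "4 / a = 4 * b / (a * b)" if "a \<noteq> 0" "b \<noteq> 0" for a b :: complex
        using that by simp
      ultimately show ?thesis unfolding eq[symmetric] by blast
    qed
    finally have "Im (semicircle_cauchy t (of_real x)) = 4 * (- 2 * (u * v)) / (16 * t)"
      by (simp add: Im_divide_of_real Im_power2 del: of_real_mult)
    also have "u * v = sqrt (4 * t - x\<^sup>2)"
      using t unfolding u_def v_def by (simp add: power2_eq_square algebra_simps flip: real_sqrt_mult)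
    finally show ?thesis using 3 t by (simp add: field_simps)
  qed
qed

lemma semicircle_cauchy_continuous: "continuous_on {z. 0 \<le> Im z} (semicircle_cauchy t)"
proof -
  have "continuous_on {z. 0 \<le> Im z} (\<lambda>z. csqrt (z - of_real (2 * sqrt t)))"
       "continuous_on {z. 0 \<le> Im z} (\<lambda>z. csqrt (z + of_real (2 * sqrt t)))"
    by (rule continuous_on_compose2[OF continuous_on_csqrt_upper]; force intro!: continuous_intros)+
  then show ?thesis unfolding semicircle_cauchy_def
    by (intro continuous_intros) (use semicircle_cauchy_denominator_nonzero in auto)
qed

lemma semicircle_cauchy_holomorphic: "semicircle_cauchy t holomorphic_on {z. 0 < Im z}"
  unfolding semicircle_cauchy_def
  by (intro holomorphic_intros holomorphic_on_compose_gen[unfolded o_def, OF _ holomorphic_on_csqrt])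
     (use semicircle_cauchy_denominator_nonzero in \<open>auto simp: complex_nonpos_Reals_iff\<close>)

lemma semicircle_cauchy_decay:
  assumes "0 \<le> Im z"
  shows "cmod (z * semicircle_cauchy t z) \<le> 2"
proof -
  let ?q = "(csqrt (z - of_real (2 * sqrt t)) + csqrt (z + of_real (2 * sqrt t)))\<^sup>2"
  have q: "cmod (semicircle_cauchy t z) = 4 / cmod ?q" by (simp add: semicircle_cauchy_def norm_divide)
  have pos: "0 < cmod ?q" using semicircle_cauchy_denominator_nonzero[OF assms] by simp
  show "cmod (z * semicircle_cauchy t z) \<le> 2"
    unfolding norm_mult q using semicircle_cauchy_denominator(1)[OF assms] pos by (simp add: field_simps)
qed

lemma semicircle_cauchy_asymp:
  "((\<lambda>y. \<i> * complex_of_real y * semicircle_cauchy t (\<i> * complex_of_real y)) \<longlongrightarrow> 1) at_top"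
proof -
  have "((\<lambda>y. \<i> * complex_of_real y * semicircle_cauchy t (\<i> * complex_of_real y) - 1) \<longlongrightarrow> 0) at_top"
  proof (rule Lim_null_comparison[where g = "\<lambda>y. t * (2 / y)\<^sup>2"])
    show "\<forall>\<^sub>F y in at_top. cmod (\<i> * complex_of_real y * semicircle_cauchy t (\<i> * complex_of_real y) - 1)
        \<le> t * (2 / y)\<^sup>2"
      using eventually_gt_at_top[of 0]
    proof eventually_elim
      case (elim y)
      let ?z = "\<i> * complex_of_real y" and ?g = "semicircle_cauchy t (\<i> * complex_of_real y)"
      have Im: "0 \<le> Im ?z" using elim by simp
      have "?g \<noteq> 0" using semicircle_cauchy_denominator_nonzero[OF Im] by (simp add: semicircle_cauchy_def)
      then have "?z * ?g - 1 = t * ?g\<^sup>2"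
        using semicircle_cauchy_equation[OF Im] by (simp add: field_simps power2_eq_square)
      moreover have "cmod ?g \<le> 2 / y"
        using semicircle_cauchy_decay[OF Im] elim by (simp add: norm_mult field_simps)
      ultimately show ?case
        using t by (simp add: norm_mult norm_power power_mono)
    qed
    show "((\<lambda>y. t * (2 / y)\<^sup>2) \<longlongrightarrow> 0) at_top" by real_asymp
  qed
  then show ?thesis by (rule LIM_zero_cancel)
qed

lemma semicircle_density:
  "semicircle t = density lborel (\<lambda>x. ennreal (- Im (semicircle_cauchy t (complex_of_real x)) / pi))"
  unfolding semicircle_def semicircle_cauchy_real ..

lemma Im_semicircle_cauchy_real: "Im (semicircle_cauchy t (of_real x)) \<le> 0"
proof -
  have "0 \<le> - Im (semicircle_cauchy t (of_real x)) / pi"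
    unfolding semicircle_cauchy_real
  proof (cases "x \<in> {-2 * sqrt t..2 * sqrt t}")
    case True
    then have "\<bar>x\<bar>\<^sup>2 \<le> (2 * sqrt t)\<^sup>2" by (intro power_mono) auto
    then have "x\<^sup>2 \<le> 4 * t" using t by (simp add: power_mult_distrib)
    then show "0 \<le> indicator {-2 * sqrt t..2 * sqrt t} x * (1 / (2 * pi * t) * sqrt (4 * t - x\<^sup>2))"
      using t by simp
  qed simp
  then show ?thesis using pi_gt_zero by (auto simp: divide_le_0_iff)
qed

lemma real_distribution_semicircle: "real_distribution (semicircle t)"
  and cauchy_transform_semicircle:
    "0 < Im z \<Longrightarrow> cauchy_transform (semicircle t) z = semicircle_cauchy t z"
  unfolding semicircle_density
  by (rule half_plane_function_is_cauchy_transform[OF semicircle_cauchy_continuous semicircle_cauchy_holomorphic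
        semicircle_cauchy_decay Im_semicircle_cauchy_real semicircle_cauchy_asymp]; assumption)+

lemma R_transform_semicircle:
  assumes "w \<in> R_domain (semicircle t)"
  shows "R_transform (semicircle t) w = of_real t * w"
proof -
  interpret real_distribution "semicircle t" by (rule real_distribution_semicircle)
  obtain \<gamma> \<alpha> \<beta> \<delta> where inv: "cauchy_invertible (semicircle t) \<gamma> \<alpha> \<beta> \<delta>" and w: "w \<in> lower_cone \<gamma> \<delta>"
    using assms by (auto simp: R_domain_def)
  note K = cauchy_inverse_props[OF inv]
  let ?K = "inv_into (upper_cone \<alpha> \<beta>) (cauchy_transform (semicircle t))"
  have "R_transform (semicircle t) w = ?K w - 1 / w"
    by (rule R_transform_eqI[OF _ _ K(3,2,4) w assms]) (use inv in \<open>auto simp: cauchy_invertible_def\<close>)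
  moreover have "?K w = of_real t * w + 1 / w"
  proof -
    have Im: "0 < Im (?K w)" using K(1)[OF w] by (simp add: upper_cone_def)
    then have "semicircle_cauchy t (?K w) = w" using K(2)[OF w] cauchy_transform_semicircle by simp
    then show ?thesis using semicircle_cauchy_equation[of "?K w"] Im by simp
  qed
  ultimately show ?thesis by simp
qed

end

section \<open>Densities with a dip\<close>

lemma AE_lborel_interval_witness:
  fixes a b :: real
  assumes "AE x in lborel. P x" "a < b"
  obtains x where "a < x" "x < b" "P x"
proof (rule ccontr)
  assume "\<not> thesis"
  then have "AE x in lborel. x \<notin> {a<..<b}"
    using assms(1) that by (auto elim: eventually_mono)
  then have "{a<..<b} \<in> null_sets lborel" by (subst AE_iff_null_sets) auto
  then have "emeasure lborel {a<..<b} = 0" by auto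
  then show False using assms(2) by simp
qed

text \<open>The monotone \<open>f\<close> matches \<open>p\<close> only almost everywhere, so the
  dip has to be seen on open intervals: continuity spreads a level m between the three values over
  neighbourhoods, and points where f = p are picked in each of them.\<close>

lemma not_unimodal_density:
  fixes p :: "real \<Rightarrow> real"
  assumes cont: "continuous_on UNIV p" and nn: "\<And>x. 0 \<le> p x"
    and x: "x1 < x2" "x2 < x3" and p: "p x2 < p x1" "p x2 < p x3"
  shows "\<not> unimodal (density lborel (\<lambda>x. ennreal (p x)))"
proof
  let ?L = "density lborel (\<lambda>x. ennreal (p x))"
  assume "unimodal ?L"
  then obtain a f where f: "\<And>x. 0 \<le> f x" "mono_on {..<a} f" "antimono_on {a<..} f"
    and L: "\<And>A. A \<in> sets borel \<Longrightarrow> emeasure ?L A = emeasure ?L {a} * emeasure (return borel a) A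
        + emeasure (density lborel (\<lambda>x. ennreal (f x))) A"
    unfolding unimodal_def by blast
  have [measurable]: "p \<in> borel_measurable borel" by (rule borel_measurable_continuous_onI[OF cont])
  \<comment> \<open>Unimodality gives monotonicity on either side of \<open>a\<close> and nothing at
    \<open>a\<close> itself, so measurability, needed for uniqueness of densities, is pieced
    together from three parts.\<close>
  have fm[measurable]: "f \<in> borel_measurable borel"
  proof (rule measurable_piecewise_restrict[of "{{..<a}, {a}, {a<..}}"])
    show "f \<in> borel_measurable (restrict_space borel \<Omega>)" if "\<Omega> \<in> {{..<a}, {a}, {a<..}}" for \<Omega>
    proof -
      have "monotone_on {a<..} (\<le>) (\<le>) (\<lambda>x. - f x)"
        using f(3) by (auto simp: monotone_on_def)
      then have "(\<lambda>x. - f x) \<in> borel_measurable (restrict_space borel {a<..})"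
        by (intro borel_measurable_mono_on_fnc)
      then have "(\<lambda>x. - (- f x)) \<in> borel_measurable (restrict_space borel {a<..})"
        by (rule borel_measurable_uminus)
      moreover have "f \<in> borel_measurable (restrict_space borel {..<a})"
        by (rule borel_measurable_mono_on_fnc[OF f(2)])
      moreover have "f \<in> borel_measurable (restrict_space borel {a})"
        by (rule borel_measurable_mono_on_fnc) (auto simp: monotone_on_def)
      ultimately show ?thesis using that by auto
    qed
  qed auto
  have null: "{a} \<in> null_sets ?L"
  proof -
    have "{a} \<in> null_sets lborel" by (rule null_setsI) simp_all
    moreover have "absolutely_continuous lborel ?L" by (rule absolutely_continuousI_density) simp
    ultimately show ?thesis by (auto simp: absolutely_continuous_def)
  qed
  then have "?L = density lborel (\<lambda>x. ennreal (f x))"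
  proof (intro measure_eqI)
    fix A assume "A \<in> sets ?L"
    then have "A \<in> sets borel" by simp
    from L[OF this] null_setsD1[OF null] show "emeasure ?L A = emeasure (density lborel (\<lambda>x. ennreal (f x))) A"
      by simp
  qed simp
  then have "AE x in lborel. ennreal (p x) = ennreal (f x)"
    by (subst (asm) sigma_finite_measure.density_unique_iff[OF lborel.sigma_finite_measure_axioms]) auto
  moreover have "AE x in lborel. x \<noteq> a" by (rule AE_lborel_singleton)
  ultimately have ae: "AE x in lborel. p x = f x \<and> x \<noteq> a"
    by eventually_elim (use nn f(1) in \<open>auto\<close>)
  obtain m where m: "p x2 < m" "m < p x1" "m < p x3"
    using dense[of "p x2" "min (p x1) (p x3)"] p by auto
  have nbhd: "\<exists>e>0. \<forall>y. dist y x < e \<longrightarrow> Q (p y)" if "Q (p x)" "open {y. Q y}" for Q x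
  proof -
    have "open (p -` {y. Q y})" using cont that(2) by (rule continuous_on_open_vimage[THEN iffD1, rule_format, OF open_UNIV, simplified])
    then show ?thesis using that(1) unfolding open_dist by auto
  qed
  obtain e1 where e1: "e1 > 0" "\<And>y. dist y x1 < e1 \<Longrightarrow> m < p y"
    using nbhd[of "\<lambda>y. m < y" x1] m(2) open_greaterThan[of m] by (auto simp: greaterThan_def)
  obtain e2 where e2: "e2 > 0" "\<And>y. dist y x2 < e2 \<Longrightarrow> p y < m"
    using nbhd[of "\<lambda>y. y < m" x2] m(1) open_lessThan[of m] by (auto simp: lessThan_def)
  obtain e3 where e3: "e3 > 0" "\<And>y. dist y x3 < e3 \<Longrightarrow> m < p y"
    using nbhd[of "\<lambda>y. m < y" x3] m(3) open_greaterThan[of m] by (auto simp: greaterThan_def)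
  \<comment> \<open>The interval is cut to lie within (x1, x3), which orders y1 < y2 < y3. Avoiding
    \<open>a\<close> matters because \<open>f a\<close> is arbitrary.\<close>
  obtain y2 where y2: "max x1 (x2 - e2) < y2" "y2 < min x3 (x2 + e2)" "p y2 = f y2 \<and> y2 \<noteq> a"
    by (rule AE_lborel_interval_witness[OF ae, of "max x1 (x2 - e2)" "min x3 (x2 + e2)"]) (use x e2 in auto)
  obtain y1 where y1: "x1 - e1 < y1" "y1 < x1" "p y1 = f y1 \<and> y1 \<noteq> a"
    by (rule AE_lborel_interval_witness[OF ae, of "x1 - e1" x1]) (use e1 in auto)
  obtain y3 where y3: "x3 < y3" "y3 < x3 + e3" "p y3 = f y3 \<and> y3 \<noteq> a"
    by (rule AE_lborel_interval_witness[OF ae, of x3 "x3 + e3"]) (use e3 in auto)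
  have f1: "m < f y1" using e1(2)[of y1] y1 by (auto simp: dist_real_def)
  have f2: "f y2 < m" using e2(2)[of y2] y2 by (auto simp: dist_real_def)
  have f3: "m < f y3" using e3(2)[of y3] y3 by (auto simp: dist_real_def)
  show False
  proof (cases "y2 < a")
    case True
    then have "f y1 \<le> f y2" using f(2) y1 y2 by (auto simp: monotone_on_def)
    then show False using f1 f2 by simp
  next
    case False
    then have "f y3 \<le> f y2" using f(3) y2 y3 by (auto simp: monotone_on_def)
    then show False using f3 f2 by simp
  qed
qed

section \<open>Free convolution with the semicircle distribution\<close>

text \<open>\<open>gap\<close> keeps the region of small energy at distance \<open>d\<close> from
  [0, l], so the Cauchy transform of \<open>N\<close> is bounded and continuous up to its boundary.
  \<open>not_dirac\<close> supplies the strict inequality behind injectivity of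
  \<open>H\<close>.\<close>

locale semicircle_convolution = real_distribution N for N :: "real measure" +
  fixes t l d :: real
  assumes t: "0 < t" and l: "0 < l" and d: "0 < d"
    and support: "AE x in N. x \<in> {0..l}"
    and gap: "\<And>w x. 0 < Im w \<Longrightarrow> (LINT x|N. 1 / (cmod (w - complex_of_real x))\<^sup>2) \<le> 1 / t \<Longrightarrow>
        x \<in> {0..l} \<Longrightarrow> d \<le> cmod (w - complex_of_real x)"
    and not_dirac: "\<And>x0. \<not> (AE x in N. x = x0)"
begin

text \<open>For Im w > 0, (Im w/pi) times the energy is the density at Re w of \<open>N\<close>
  convolved with the Cauchy law of scale Im w.\<close>

definition energy :: "complex \<Rightarrow> real" where
  "energy w = (LINT x|N. 1 / (cmod (w - complex_of_real x))\<^sup>2)"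

text \<open>\<open>H\<close> is the left inverse of Biane's subordination function of the free convolution
  with the semicircle distribution of variance \<open>t\<close>; it maps \<open>Dom\<close> homeomorphically onto the
  closed upper half-plane.\<close>

definition H :: "complex \<Rightarrow> complex" where "H w = w + of_real t * cauchy_transform N w"

text \<open>The distance is taken to every point of [0, l], which makes this set visibly closed; it
  contains the distant real points, where the limit measure has density 0.\<close>

definition far :: "complex set" where
  "far = {w. 0 \<le> Im w} \<inter> (\<Inter>x\<in>{0..l}. {w. d \<le> cmod (w - complex_of_real x)})"

definition Dom :: "complex set" where "Dom = {w \<in> far. energy w \<le> 1 / t}"

lemma AE_far: "w \<in> far \<Longrightarrow> AE x in N. d \<le> cmod (w - of_real x)"
  using support by (auto simp: far_def elim: eventually_mono)

lemma domI: "0 < Im w \<Longrightarrow> energy w \<le> 1 / t \<Longrightarrow> w \<in> Dom"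
  using gap by (auto simp: Dom_def far_def energy_def)

lemma dom_far: "w \<in> Dom \<Longrightarrow> w \<in> far" by (simp add: Dom_def)

lemma Im_dom: "w \<in> Dom \<Longrightarrow> 0 \<le> Im w" by (simp add: Dom_def far_def)

lemma closed_far: "closed far"
  unfolding far_def by (intro closed_Int closed_INT closed_halfspace_Im_ge ballI closed_Collect_le continuous_intros)

lemma continuous_on_energy: "continuous_on far energy"
  unfolding continuous_on_sequentially
proof (intro allI ballI impI)
  fix s w assume w: "w \<in> far" and s: "(\<forall>n. s n \<in> far) \<and> s \<longlonglongrightarrow> w"
  have "(\<lambda>n. energy (s n)) \<longlonglongrightarrow> energy w"
    unfolding energy_def
  proof (rule integral_dominated_convergence[where w = "\<lambda>_. 1 / d\<^sup>2"])
    show "AE x in N. norm (1 / (cmod (s n - complex_of_real x))\<^sup>2) \<le> 1 / d\<^sup>2" for n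
      using AE_far[of "s n"] s d by (auto elim!: eventually_mono intro!: frac_le power_mono)
    show "AE x in N. (\<lambda>n. 1 / (cmod (s n - complex_of_real x))\<^sup>2) \<longlonglongrightarrow> 1 / (cmod (w - complex_of_real x))\<^sup>2"
      using AE_far[OF w]
    proof eventually_elim
      case (elim x)
      then have "(cmod (w - complex_of_real x))\<^sup>2 \<noteq> 0" using d by auto
      then show ?case using s by (intro tendsto_intros) auto
    qed
  qed auto
  then show "(energy \<circ> s) \<longlonglongrightarrow> energy w" by (simp add: o_def)
qed

lemma closed_dom: "closed Dom"
  unfolding Dom_def using continuous_on_energy closed_far
  by (rule continuous_on_closed_Collect_le[OF _ continuous_on_const])

lemma continuous_on_H: "continuous_on far H"
proof -
  have "continuous_on far (cauchy_transform N)"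
    by (intro continuous_at_imp_continuous_on ballI field_differentiable_imp_continuous_at
        cauchy_transform_field_differentiable[OF d AE_far])
  then show ?thesis unfolding H_def by (intro continuous_intros)
qed

text \<open>This makes \<open>H\<close> proper on \<open>Dom\<close>: preimages of bounded sets are
  bounded.\<close>

lemma H_near_identity: "w \<in> far \<Longrightarrow> cmod (H w - w) \<le> t / d"
  using norm_cauchy_transform_le[OF d AE_far, of w] t
  by (simp add: H_def norm_mult divide_inverse mult_left_mono)

lemma Im_H_far: "w \<in> far \<Longrightarrow> Im (H w) = Im w * (1 - t * energy w)"
  using Im_cauchy_transform[OF d AE_far, of w] by (simp add: H_def energy_def algebra_simps)

lemma Im_H: "0 < Im w \<Longrightarrow> Im (H w) = Im w * (1 - t * energy w)"
  using Im_cauchy_transform[OF _ AE_Im_le_norm_diff, of w] by (simp add: H_def energy_def algebra_simps)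

lemma Im_H_dom: "w \<in> Dom \<Longrightarrow> 0 \<le> Im (H w)"
proof -
  assume w: "w \<in> Dom"
  then have "0 \<le> 1 - t * energy w" using t by (simp add: Dom_def field_simps)
  then show ?thesis using Im_H_far[OF dom_far[OF w]] Im_dom[OF w] by simp
qed

text \<open>Since Im (H w) = Im w (1 - t energy w), positivity of Im (H w) above the axis already
  implies the energy bound. The right-hand side exhibits the set as open, so the open mapping
  theorem becomes available.\<close>

lemma dom_upper: "{w \<in> Dom. 0 < Im (H w)} = {w. 0 < Im w} \<inter> H -` {z. 0 < Im z}"
proof (intro equalityI subsetI)
  fix w assume "w \<in> {w \<in> Dom. 0 < Im (H w)}"
  then have w: "w \<in> Dom" "0 < Im (H w)" by auto
  then have "Im w \<noteq> 0" using Im_H_far[OF dom_far] by auto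
  then show "w \<in> {w. 0 < Im w} \<inter> H -` {z. 0 < Im z}" using w Im_dom[OF w(1)] by auto
next
  fix w assume "w \<in> {w. 0 < Im w} \<inter> H -` {z. 0 < Im z}"
  then have w: "0 < Im w" "0 < Im (H w)" by auto
  then have "0 < 1 - t * energy w" by (simp add: Im_H zero_less_mult_iff)
  then have "energy w \<le> 1 / t" using t by (simp add: field_simps)
  then show "w \<in> {w \<in> Dom. 0 < Im (H w)}" using w domI by auto
qed

text \<open>Strictness in the arithmetic-geometric mean inequality: \<open>|w - x| = |w' - x|\<close> for at most
  one real \<open>x\<close> when \<open>w \<noteq> w'\<close> lie in the closed upper half-plane.\<close>

lemma H_diff:
  assumes w: "w \<in> Dom" "w' \<in> Dom" "w \<noteq> w'"
  obtains K where "H w - H w' = (w - w') * (1 - K)" "cmod K < 1"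
proof -
  define A B where "A x = cmod (w - complex_of_real x)" and "B x = cmod (w' - complex_of_real x)" for x
  define k where "k = (LINT x|N. 1 / ((w - complex_of_real x) * (w' - complex_of_real x)))"
  note far = AE_far[OF dom_far[OF w(1)]] AE_far[OF dom_far[OF w(2)]]
  have iA: "integrable N (\<lambda>x. 1 / (A x)\<^sup>2)" and iB: "integrable N (\<lambda>x. 1 / (B x)\<^sup>2)"
    unfolding A_def B_def by (rule inv_norm_square_integrable[OF d]; fact far)+
  have iAB: "integrable N (\<lambda>x. 1 / (A x * B x))"
    using integrable_norm[OF cauchy_kernel_prod_integrable[OF d far]]
    by (simp add: A_def B_def norm_divide norm_mult)
  have h: "(1 / A x - 1 / B x)\<^sup>2 = 1 / (A x)\<^sup>2 + 1 / (B x)\<^sup>2 - 2 * (1 / (A x * B x))" for x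
    by (simp add: power2_diff power_divide)
  have ih: "integrable N (\<lambda>x. (1 / A x - 1 / B x)\<^sup>2)"
    unfolding h by (intro Bochner_Integration.integrable_diff Bochner_Integration.integrable_add
        integrable_mult_right iA iB iAB)
  have "(LINT x|N. (1 / A x - 1 / B x)\<^sup>2) = (LINT x|N. 1 / (A x)\<^sup>2 + 1 / (B x)\<^sup>2) - (LINT x|N. 2 * (1 / (A x * B x)))"
    unfolding h by (intro Bochner_Integration.integral_diff Bochner_Integration.integrable_add
        integrable_mult_right iA iB iAB)
  also have "(LINT x|N. 1 / (A x)\<^sup>2 + 1 / (B x)\<^sup>2) = energy w + energy w'"
    unfolding energy_def A_def[symmetric] B_def[symmetric] by (intro Bochner_Integration.integral_add iA iB)
  finally have val: "(LINT x|N. (1 / A x - 1 / B x)\<^sup>2) = energy w + energy w' - 2 * (LINT x|N. 1 / (A x * B x))"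
    by (simp only: integral_mult_right_zero)
  have "(LINT x|N. (1 / A x - 1 / B x)\<^sup>2) \<noteq> 0"
  proof
    assume "(LINT x|N. (1 / A x - 1 / B x)\<^sup>2) = 0"
    then have "AE x in N. (1 / A x - 1 / B x)\<^sup>2 = 0"
      using integral_nonneg_eq_0_iff_AE[OF ih] by auto
    then have "AE x in N. x = ((cmod w)\<^sup>2 - (cmod w')\<^sup>2) / (2 * (Re w - Re w'))"
      using far
    proof eventually_elim
      case (elim x)
      then have "A x = B x" by (auto simp: A_def B_def)
      then have "(A x)\<^sup>2 = (B x)\<^sup>2" by simp
      then have eq: "2 * x * (Re w - Re w') = (cmod w)\<^sup>2 - (cmod w')\<^sup>2"
        unfolding A_def B_def cmod_power2 by (simp add: power2_eq_square algebra_simps)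
      have "Re w \<noteq> Re w'"
      proof
        assume "Re w = Re w'"
        then have "(Im w)\<^sup>2 = (Im w')\<^sup>2" using eq unfolding cmod_power2 by simp
        then have "Im w = Im w'" by (rule power2_eq_imp_eq) (use Im_dom w in auto)
        then show False using w(3) \<open>Re w = Re w'\<close> by (simp add: complex_eq_iff)
      qed
      then show ?case using eq by (simp add: field_simps)
    qed
    then show False using not_dirac by blast
  qed
  moreover have "0 \<le> (LINT x|N. (1 / A x - 1 / B x)\<^sup>2)" by simp
  ultimately have "2 * (LINT x|N. 1 / (A x * B x)) < energy w + energy w'" unfolding val by linarith
  also have "\<dots> \<le> 2 * (1 / t)" using w by (simp add: Dom_def)
  finally have "(LINT x|N. 1 / (A x * B x)) < 1 / t" by simp
  moreover have "cmod k \<le> (LINT x|N. 1 / (A x * B x))"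
    unfolding k_def by (rule norm_LINT_le[OF iAB]) (auto simp: A_def B_def norm_divide norm_mult)
  ultimately have "cmod k < 1 / t" by linarith
  then have "cmod (of_real t * k) < 1" using t by (simp add: norm_mult field_simps)
  moreover have "H w - H w' = (w - w') * (1 - of_real t * k)"
  proof -
    have G: "cauchy_transform N w - cauchy_transform N w' = (w' - w) * k"
      unfolding k_def by (rule cauchy_transform_diff[OF d far])
    have "H w - H w' = (w - w') + of_real t * (cauchy_transform N w - cauchy_transform N w')"
      by (simp add: H_def algebra_simps)
    then show ?thesis unfolding G by (simp add: algebra_simps)
  qed
  ultimately show ?thesis using that by blast
qed

lemma inj_on_H: "inj_on H Dom"
proof (rule inj_onI, rule ccontr)
  fix w w' assume w: "w \<in> Dom" "w' \<in> Dom" "H w = H w'" "w \<noteq> w'"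
  obtain K where "H w - H w' = (w - w') * (1 - K)" "cmod K < 1" by (rule H_diff[OF w(1,2,4)])
  then show False using w(3,4) by auto
qed

text \<open>Let r = H w' - H w, which is real. Multiplying r = (w' - w)(1 - K) by conj (1 - K) and
  taking real parts gives r (1 - Re K) = Re (w' - w) |1 - K|^2, where |K| < 1 makes both factors in
  K positive.\<close>

lemma H_strict_mono:
  assumes w: "w \<in> Dom" "w' \<in> Dom" and real: "Im (H w) = 0" "Im (H w') = 0" and less: "Re w < Re w'"
  shows "Re (H w) < Re (H w')"
proof -
  have "w' \<noteq> w" using less by auto
  then obtain K where K: "H w' - H w = (w' - w) * (1 - K)" "cmod K < 1"
    by (rule H_diff[OF w(2,1)])
  define r where "r = Re (H w') - Re (H w)"
  have r: "H w' - H w = of_real r" using real by (simp add: r_def complex_eq_iff)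
  have "Re K < 1" using K(2) complex_Re_le_cmod[of K] by linarith
  have "of_real r * cnj (1 - K) = (w' - w) * ((1 - K) * cnj (1 - K))"
    unfolding r[symmetric] K(1) by (rule mult.assoc)
  moreover have "r * (1 - Re K) = Re (of_real r * cnj (1 - K))" by simp
  ultimately have "r * (1 - Re K) = Re ((w' - w) * ((1 - K) * cnj (1 - K)))" by (simp only:)
  also have "\<dots> = Re (w' - w) * (cmod (1 - K))\<^sup>2" 
    unfolding complex_norm_square[symmetric] by simp
  finally have "r * (1 - Re K) = Re (w' - w) * (cmod (1 - K))\<^sup>2" .
  moreover have "0 < Re (w' - w) * (cmod (1 - K))\<^sup>2"
    using less K(2) by (intro mult_pos_pos) auto
  ultimately have "0 < r * (1 - Re K)" by simp
  then show ?thesis using \<open>Re K < 1\<close> by (simp add: r_def zero_less_mult_iff)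
qed

lemma H_preimage_bounded:
  assumes "w \<in> Dom" "cmod (H w) \<le> R" shows "w \<in> Dom \<inter> cball 0 (R + t / d)"
proof -
  have "cmod w \<le> cmod (H w) + cmod (H w - w)"
    using norm_triangle_ineq4[of "H w" "H w - w"] by simp
  then show ?thesis using assms H_near_identity[OF dom_far[OF assms(1)]] by auto
qed

lemma compact_dom_piece: "compact (Dom \<inter> cball 0 R)"
  by (rule closed_Int_compact[OF closed_dom compact_cball])

lemma compact_H_piece: "compact (H ` (Dom \<inter> cball 0 R))"
proof (rule compact_continuous_image[OF _ compact_dom_piece])
  show "continuous_on (Dom \<inter> cball 0 R) H"
    by (rule continuous_on_subset[OF continuous_on_H]) (use dom_far in blast)
qed

lemma closed_H_dom: "closed (H ` Dom)"
  unfolding closed_sequential_limits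
proof (intro allI impI)
  fix s z assume s: "(\<forall>n. s n \<in> H ` Dom) \<and> s \<longlonglongrightarrow> z"
  then have lim: "s \<longlonglongrightarrow> z" by (rule conjunct2)
  obtain R where R: "\<And>n. cmod (s n) \<le> R"
    using convergent_imp_bounded[OF lim] unfolding bounded_iff by blast
  have mem: "s n \<in> H ` (Dom \<inter> cball 0 (R + t / d))" for n
  proof -
    obtain w where w: "w \<in> Dom" "s n = H w" using s by blast
    then have "w \<in> Dom \<inter> cball 0 (R + t / d)" using R[of n] by (intro H_preimage_bounded) auto
    then show ?thesis using w(2) by blast
  qed
  have "z \<in> H ` (Dom \<inter> cball 0 (R + t / d))"
    by (rule closed_sequentially[OF compact_imp_closed[OF compact_H_piece] mem lim])
  then show "z \<in> H ` Dom" by blast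
qed

lemma H_holomorphic: "H holomorphic_on {w. 0 < Im w}"
  unfolding H_def by (intro holomorphic_intros cauchy_transform_holomorphic)

lemma open_dom_upper: "open {w \<in> Dom. 0 < Im (H w)}"
  unfolding dom_upper
  by (intro continuous_open_preimage holomorphic_on_imp_continuous_on H_holomorphic open_halfspace_Im_gt)

text \<open>The image is open because \<open>H\<close> is holomorphic and injective, relatively
  closed because \<open>H\<close> is proper, and nonempty; the upper half-plane is
  connected.\<close>

lemma H_image_upper: "H ` {w \<in> Dom. 0 < Im (H w)} = {z. 0 < Im z}"
proof -
  let ?\<Omega> = "{w \<in> Dom. 0 < Im (H w)}" and ?U = "{z. 0 < Im z}"
  have eq: "H ` ?\<Omega> = ?U \<inter> H ` Dom" by auto
  have "open (H ` ?\<Omega>)"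
  proof (rule open_mapping_thm3[OF _ open_dom_upper])
    show "H holomorphic_on ?\<Omega>" by (rule holomorphic_on_subset[OF H_holomorphic]) (auto simp: dom_upper)
    show "inj_on H ?\<Omega>" by (rule inj_on_subset[OF inj_on_H]) auto
  qed
  then have "openin (top_of_set ?U) (H ` ?\<Omega>)" by (subst openin_open_eq) (auto simp: open_halfspace_Im_gt)
  moreover have "closedin (top_of_set ?U) (H ` ?\<Omega>)"
    unfolding eq using closed_H_dom by (simp add: closedin_closed_Int)
  moreover have "connected ?U" by (intro convex_connected convex_halfspace_Im_gt)
  moreover have "H ` ?\<Omega> \<noteq> {}"
  proof -
    \<comment> \<open>Any height with t < y^2 works: t |G(i y)| \<le> t/y < y keeps H(i y) above the
      axis.\<close>
    define y where "y = sqrt t + 1"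
    have y: "0 < y" "t < y\<^sup>2" using t by (auto simp: y_def power2_eq_square algebra_simps add_pos_nonneg)
    let ?w = "\<i> * complex_of_real y"
    have "\<bar>Im (cauchy_transform N ?w)\<bar> \<le> 1 / y"
      using norm_cauchy_transform_le[OF _ AE_Im_le_norm_diff, of ?w] y(1)
        abs_Im_le_cmod[of "cauchy_transform N ?w"] by simp
    then have "t * \<bar>Im (cauchy_transform N ?w)\<bar> \<le> t * (1 / y)" using t by (intro mult_left_mono) auto
    also have "t * (1 / y) < y" using y by (simp add: field_simps power2_eq_square)
    finally have "\<bar>t * Im (cauchy_transform N ?w)\<bar> < y" using t by (simp add: abs_mult)
    then have "0 < Im (H ?w)" by (simp add: H_def)
    then have "?w \<in> ?\<Omega>" unfolding dom_upper using y by simp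
    then show ?thesis by blast
  qed
  ultimately show ?thesis unfolding connected_clopen by blast
qed

lemma H_image: "H ` Dom = {z. 0 \<le> Im z}"
proof
  show "H ` Dom \<subseteq> {z. 0 \<le> Im z}" using Im_H_dom by auto
  have "{z. 0 < Im z} \<subseteq> H ` Dom" using H_image_upper by blast
  then have "closure {z. 0 < Im z} \<subseteq> H ` Dom" by (rule closure_minimal[OF _ closed_H_dom])
  moreover have "closure {z. 0 < Im z} = {z. 0 \<le> Im z}"
    using closure_halfspace_gt[of \<i> "0::real"] by (simp add: inner_complex_def)
  ultimately show "{z. 0 \<le> Im z} \<subseteq> H ` Dom" by simp
qed

section \<open>The subordination function and the measure it produces\<close>

definition \<omega> :: "complex \<Rightarrow> complex" where "\<omega> = inv_into Dom H"

lemma \<omega>_dom: "0 \<le> Im z \<Longrightarrow> \<omega> z \<in> Dom"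
  unfolding \<omega>_def using H_image by (intro inv_into_into) auto

lemma H_\<omega>: "0 \<le> Im z \<Longrightarrow> H (\<omega> z) = z"
  unfolding \<omega>_def using H_image by (intro f_inv_into_f) auto

lemma \<omega>_H: "w \<in> Dom \<Longrightarrow> \<omega> (H w) = w"
  unfolding \<omega>_def by (rule inv_into_f_f[OF inj_on_H])

text \<open>A continuous injection on a compact set has a continuous inverse; by properness a
  convergent sequence together with its limit has all its preimages in one compact piece of
  \<open>Dom\<close>.\<close>

lemma continuous_on_\<omega>: "continuous_on {z. 0 \<le> Im z} \<omega>"
  unfolding continuous_on_sequentially
proof (intro allI ballI impI)
  fix s z assume z: "z \<in> {z. 0 \<le> Im z}" and s: "(\<forall>n. s n \<in> {z. 0 \<le> Im z}) \<and> s \<longlonglongrightarrow> z"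
  then have "bounded (range s)" using convergent_imp_bounded by blast
  then have "bounded (insert z (range s))" by simp
  then obtain R where R: "\<And>v. v \<in> insert z (range s) \<Longrightarrow> cmod v \<le> R" unfolding bounded_iff by blast
  let ?T = "H ` (Dom \<inter> cball 0 (R + t / d))"
  have mem: "v \<in> ?T" if "v \<in> insert z (range s)" for v
  proof -
    have "0 \<le> Im v" using that z s by auto
    then have "v = H (\<omega> v)" "\<omega> v \<in> Dom" using H_\<omega> \<omega>_dom by auto
    moreover have "\<omega> v \<in> Dom \<inter> cball 0 (R + t / d)"
      by (rule H_preimage_bounded) (use calculation R[OF that] in auto)
    ultimately show ?thesis by blast
  qed
  have "continuous_on ?T \<omega>"
    by (rule continuous_on_inv[OF _ compact_dom_piece])
       (auto intro: continuous_on_subset[OF continuous_on_H] simp: dom_far \<omega>_H)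
  then have "\<forall>x. \<forall>a\<in>?T. (\<forall>n. x n \<in> ?T) \<and> x \<longlonglongrightarrow> a \<longrightarrow> (\<omega> \<circ> x) \<longlonglongrightarrow> \<omega> a"
    unfolding continuous_on_sequentially .
  moreover have "z \<in> ?T" "\<And>n. s n \<in> ?T" by (rule mem, simp)+
  ultimately show "(\<omega> \<circ> s) \<longlonglongrightarrow> \<omega> z" using s by blast
qed

lemma \<omega>_holomorphic: "\<omega> holomorphic_on {z. 0 < Im z}"
proof -
  let ?\<Omega> = "{w \<in> Dom. 0 < Im (H w)}"
  have "H holomorphic_on ?\<Omega>" by (rule holomorphic_on_subset[OF H_holomorphic]) (auto simp: dom_upper)
  moreover have "inj_on H ?\<Omega>" by (rule inj_on_subset[OF inj_on_H]) auto
  ultimately obtain g where g: "g holomorphic_on H ` ?\<Omega>" "\<And>w. w \<in> ?\<Omega> \<Longrightarrow> g (H w) = w"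
    by (rule holomorphic_has_inverse[OF _ open_dom_upper]) blast
  have "g z = \<omega> z" if "z \<in> {z. 0 < Im z}" for z
    using that g(2)[of "\<omega> z"] \<omega>_dom[of z] H_\<omega>[of z] by auto
  then show ?thesis by (rule holomorphic_transform[OF g(1)[unfolded H_image_upper]])
qed

text \<open>As z = H(\<open>\<omega>\<close> z), this is the Cauchy transform of \<open>N\<close> at
  \<open>\<omega>\<close> z. In the present form regularity is inherited from
  \<open>\<omega>\<close>, and on the real axis Im F = - Im \<open>\<omega>\<close>/t.\<close>

definition F :: "complex \<Rightarrow> complex" where "F z = (z - \<omega> z) / of_real t"

lemma F_eq: "0 \<le> Im z \<Longrightarrow> F z = cauchy_transform N (\<omega> z)"
proof -
  assume "0 \<le> Im z"
  then have "F z = (H (\<omega> z) - \<omega> z) / of_real t" unfolding F_def by (simp only: H_\<omega>)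
  also have "\<dots> = cauchy_transform N (\<omega> z)" using t unfolding H_def by simp
  finally show ?thesis .
qed

lemma norm_defect_le_support:
  assumes "0 < e" "AE x in N. e \<le> cmod (w - of_real x)"
  shows "cmod (w * cauchy_transform N w - 1) \<le> l / e"
proof -
  have i: "integrable N (\<lambda>x. w * (1 / (w - complex_of_real x)))"
    by (intro integrable_mult_right cauchy_kernel_integrable[OF assms])
  have "w * cauchy_transform N w - 1 = (LINT x|N. w * (1 / (w - complex_of_real x))) - (LINT x|N. 1)"
    unfolding cauchy_transform_def integral_mult_right_zero using prob_space by simp
  also have "\<dots> = (LINT x|N. w * (1 / (w - of_real x)) - 1)"
    by (rule Bochner_Integration.integral_diff[symmetric, OF i integrable_const])
  also have "cmod \<dots> \<le> (LINT x|N. l / e)"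
  proof (rule norm_LINT_le[OF integrable_const])
    show "AE x in N. cmod (w * (1 / (w - complex_of_real x)) - 1) \<le> l / e"
      using assms(2) support
    proof eventually_elim
      case (elim x)
      then have "w - complex_of_real x \<noteq> 0" using assms(1) by auto
      then have "w * (1 / (w - complex_of_real x)) - 1 = of_real x / (w - of_real x)" by (simp add: field_simps)
      then show ?case using elim assms(1) by (auto simp: norm_divide intro!: frac_le)
    qed
  qed auto
  finally show ?thesis using prob_space by simp
qed

text \<open>Substituting z = \<open>\<omega>\<close> z + t F z splits the defect into that of
  \<open>N\<close> at \<open>\<omega>\<close> z and t F^2. The distance \<open>e\<close> is left
  free: e = d gives the uniform decay, and e = y gives the limit along the imaginary axis.\<close>

lemma F_defect:
  assumes "0 \<le> Im z" "0 < e" "AE x in N. e \<le> cmod (\<omega> z - of_real x)"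
  shows "cmod (z * F z - 1) \<le> l / e + t / e\<^sup>2"
proof -
  have "z * F z - 1 = (\<omega> z * cauchy_transform N (\<omega> z) - 1) + of_real t * (F z)\<^sup>2"
  proof -
    have "z = \<omega> z + of_real t * F z" using t by (simp add: F_def)
    then have "z * F z = (\<omega> z + of_real t * F z) * F z" by (rule arg_cong)
    also have "\<dots> = \<omega> z * F z + of_real t * (F z)\<^sup>2"
      by (simp only: distrib_right mult.assoc power2_eq_square)
    finally have "z * F z = \<omega> z * F z + of_real t * (F z)\<^sup>2" .
    then show ?thesis using F_eq[OF assms(1)] by simp
  qed
  also have "cmod \<dots> \<le> l / e + t * (cmod (F z))\<^sup>2"
    using norm_defect_le_support[OF assms(2,3)] t
    by (intro order_trans[OF norm_triangle_ineq] add_mono) (auto simp: norm_mult norm_power)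
  also have "\<dots> \<le> l / e + t * (1 / e)\<^sup>2"
    using norm_cauchy_transform_le[OF assms(2,3)] t F_eq[OF assms(1)]
    by (intro add_mono mult_left_mono power_mono) auto
  finally show ?thesis by (simp add: power_divide)
qed

lemma F_decay: "0 \<le> Im z \<Longrightarrow> cmod (z * F z) \<le> 1 + l / d + t / d\<^sup>2"
  using F_defect[OF _ d AE_far[OF dom_far[OF \<omega>_dom]], of z]
    norm_triangle_ineq2[of "z * F z" 1] unfolding norm_one by linarith

lemma Im_F_nonpos: "Im z = 0 \<Longrightarrow> Im (F z) \<le> 0"
  using Im_dom[OF \<omega>_dom, of z] t by (simp add: F_def Im_divide_of_real divide_nonpos_pos)

lemma Im_\<omega>_ge:
  assumes "0 < Im z" shows "Im z \<le> Im (\<omega> z)"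
proof -
  have z: "0 \<le> Im z" using assms by simp
  have "\<omega> z \<in> {w \<in> Dom. 0 < Im (H w)}" using \<omega>_dom[OF z] H_\<omega>[OF z] assms by simp
  then have up: "0 < Im (\<omega> z)" unfolding dom_upper by blast
  have "Im z = Im (\<omega> z) * (1 - t * energy (\<omega> z))" using Im_H[OF up] unfolding H_\<omega>[OF z] .
  also have "\<dots> \<le> Im (\<omega> z) * 1"
  proof (rule mult_left_mono)
    have "0 \<le> energy (\<omega> z)" by (simp add: energy_def)
    then show "1 - t * energy (\<omega> z) \<le> 1" using t by simp
  qed (use up in simp)
  finally show ?thesis by simp
qed

lemma F_asymp: "((\<lambda>y. \<i> * complex_of_real y * F (\<i> * complex_of_real y)) \<longlongrightarrow> 1) at_top"
proof -
  have "((\<lambda>y. \<i> * complex_of_real y * F (\<i> * complex_of_real y) - 1) \<longlongrightarrow> 0) at_top"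
  proof (rule Lim_null_comparison[where g = "\<lambda>y. l / y + t / y\<^sup>2"])
    show "\<forall>\<^sub>F y in at_top. cmod (\<i> * complex_of_real y * F (\<i> * complex_of_real y) - 1) \<le> l / y + t / y\<^sup>2"
      using eventually_gt_at_top[of 0]
    proof eventually_elim
      case (elim y)
      have "y \<le> Im (\<omega> (\<i> * of_real y))" using Im_\<omega>_ge[of "\<i> * of_real y"] elim by simp
      then have "AE x in N. y \<le> cmod (\<omega> (\<i> * of_real y) - of_real x)"
        by (intro eventually_mono[OF AE_Im_le_norm_diff]) (rule order_trans)
      from F_defect[OF _ elim this] show ?case using elim by simp
    qed
    show "((\<lambda>y. l / y + t / y\<^sup>2) \<longlongrightarrow> 0) at_top" by real_asymp
  qed
  then show ?thesis by (rule LIM_zero_cancel)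
qed

definition L :: "real measure" where
  "L = density lborel (\<lambda>x. ennreal (- Im (F (complex_of_real x)) / pi))"

lemma continuous_on_F: "continuous_on {z. 0 \<le> Im z} F"
  unfolding F_def using t by (intro continuous_intros continuous_on_\<omega>) auto

lemma F_holomorphic: "F holomorphic_on {z. 0 < Im z}"
  unfolding F_def using t by (intro holomorphic_intros \<omega>_holomorphic) auto

lemma Im_F_real: "Im (F (complex_of_real x)) \<le> 0"
  by (rule Im_F_nonpos) simp

lemma real_distribution_L: "real_distribution L"
  unfolding L_def
  by (rule half_plane_function_is_cauchy_transform(1)[OF continuous_on_F F_holomorphic F_decay Im_F_real F_asymp])

lemma cauchy_transform_L: "0 < Im z \<Longrightarrow> cauchy_transform L z = F z"
  unfolding L_def
  by (rule half_plane_function_is_cauchy_transform(2)[OF continuous_on_F F_holomorphic F_decay Im_F_real F_asymp])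

text \<open>If k inverts the Cauchy transform of \<open>L\<close>, then F(k v) = v means
  \<open>\<omega>\<close> (k v) = k v - t v, and the Cauchy transform of \<open>N\<close> takes the
  value v there. So k v - t v is the inverse belonging to \<open>N\<close>.\<close>

lemma R_transform_L:
  assumes "w \<in> R_domain N" "w \<in> R_domain L"
  shows "R_transform L w = of_real t * w + R_transform N w"
proof -
  interpret L: real_distribution L by (rule real_distribution_L)
  obtain \<gamma> \<alpha> \<beta> \<delta> where inv: "cauchy_invertible L \<gamma> \<alpha> \<beta> \<delta>" and w: "w \<in> lower_cone \<gamma> \<delta>"
    using assms(2) by (auto simp: R_domain_def)
  have pos: "0 < \<gamma>" "0 < \<delta>" using inv by (auto simp: cauchy_invertible_def)
  note K = L.cauchy_inverse_props[OF inv]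
  define k where "k = inv_into (upper_cone \<alpha> \<beta>) (cauchy_transform L)"
  note K = K[folded k_def]
  have "R_transform L w = k w - 1 / w"
    by (rule L.R_transform_eqI[OF pos K(3,2,4) w assms(2)])
  moreover have "R_transform N w = (k w - of_real t * w) - 1 / w"
  proof (rule R_transform_eqI[OF pos _ _ _ w assms(1)])
    show "(\<lambda>w. k w - of_real t * w) holomorphic_on lower_cone \<gamma> \<delta>"
      by (intro holomorphic_intros K(3))
    show "cauchy_transform N (k v - of_real t * v) = v" if v: "v \<in> lower_cone \<gamma> \<delta>" for v
    proof -
      have Im: "0 < Im (k v)" using K(1)[OF v] by (simp add: upper_cone_def)
      have F: "F (k v) = v" using K(2)[OF v] cauchy_transform_L[OF Im] by simp
      then have "\<omega> (k v) = k v - of_real t * v" using t by (simp add: F_def field_simps)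
      then show ?thesis using F_eq[of "k v"] Im F by simp
    qed
    have "((\<lambda>s. - (\<i> * of_real s) * k (- (\<i> * of_real s)) - of_real t * (- (\<i> * of_real s))\<^sup>2)
        \<longlongrightarrow> 1 - of_real t * (- (\<i> * of_real 0))\<^sup>2) (at_right 0)"
      by (intro tendsto_intros K(4))
    then show "((\<lambda>s. - (\<i> * of_real s) * (k (- (\<i> * of_real s)) - of_real t * - (\<i> * of_real s))) \<longlongrightarrow> 1) (at_right 0)"
      by (simp add: algebra_simps power2_eq_square)
  qed
  ultimately show ?thesis by simp
qed

lemma free_convolution_semicircle: "semicircle t \<boxplus> N = L"
proof (rule free_convolution_eqI)
  show "real_distribution N" by (rule real_distribution_axioms)
  fix w assume "w \<in> R_domain (semicircle t)" "w \<in> R_domain N" "w \<in> R_domain L"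
  then show "R_transform L w = R_transform (semicircle t) w + R_transform N w"
    using R_transform_L R_transform_semicircle[OF t] by simp
qed (use real_distribution_semicircle[OF t] real_distribution_L in auto)

lemma not_unimodal_L:
  assumes w: "w1 \<in> Dom" "w2 \<in> Dom" "w3 \<in> Dom"
    and real: "Im (H w1) = 0" "Im (H w2) = 0" "Im (H w3) = 0"
    and "Re w1 < Re w2" "Re w2 < Re w3" "Im w2 < Im w1" "Im w2 < Im w3"
  shows "\<not> unimodal L"
proof -
  have val: "- Im (F (of_real (Re (H w)))) / pi = Im w / (pi * t)" if "w \<in> Dom" "Im (H w) = 0" for w
  proof -
    have "of_real (Re (H w)) = H w" using that(2) by (simp add: complex_eq_iff)
    then have "F (of_real (Re (H w))) = (H w - w) / of_real t" using \<omega>_H[OF that(1)] by (simp add: F_def)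
    then show ?thesis using that(2) by (simp add: Im_divide_of_real)
  qed
  have pt: "0 < pi * t" using t by simp
  show ?thesis unfolding L_def
  proof (rule not_unimodal_density[of _ "Re (H w1)" "Re (H w2)" "Re (H w3)"])
    show "continuous_on UNIV (\<lambda>x. - Im (F (complex_of_real x)) / pi)"
      by (intro continuous_intros continuous_on_compose2[OF continuous_on_F]) auto
    show "0 \<le> - Im (F (complex_of_real x)) / pi" for x
      using Im_F_nonpos[of "of_real x"] by (simp add: divide_nonpos_pos)
    show "Re (H w1) < Re (H w2)" "Re (H w2) < Re (H w3)"
      by (intro H_strict_mono; fact)+
    show "- Im (F (of_real (Re (H w2)))) / pi < - Im (F (of_real (Re (H w1)))) / pi"
      "- Im (F (of_real (Re (H w2)))) / pi < - Im (F (of_real (Re (H w3)))) / pi"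
      unfolding val[OF w(1) real(1)] val[OF w(2) real(2)] val[OF w(3) real(3)]
      by (intro divide_strict_right_mono pt; fact)+
  qed
qed

section \<open>Locating boundary points on vertical lines\<close>

lemma continuous_on_energy_vertical: "0 < a \<Longrightarrow> continuous_on {a..b} (\<lambda>v. energy (Complex u v))"
proof -
  assume a: "0 < a"
  have "continuous_on {a..b} (\<lambda>v. - Im (cauchy_transform N (Complex u v)) / v)"
    using a by (intro continuous_intros continuous_on_compose2[OF
          holomorphic_on_imp_continuous_on[OF cauchy_transform_holomorphic]]) auto
  then show ?thesis
  proof (rule continuous_on_eq)
    fix v assume "v \<in> {a..b}"
    then have "0 < v" using a by auto
    then show "- Im (cauchy_transform N (Complex u v)) / v = energy (Complex u v)"
      using Im_cauchy_transform[OF _ AE_Im_le_norm_diff, of "Complex u v"] by (simp add: energy_def)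
  qed
qed

lemma boundary_point:
  assumes "0 < v" "energy (Complex u v) = 1 / t"
  shows "Complex u v \<in> Dom" "Im (H (Complex u v)) = 0"
  using assms domI[of "Complex u v"] Im_H[of "Complex u v"] t by auto

lemma boundary_point_above:
  assumes "0 < c" "1 / t < energy (Complex u c)"
  obtains v where "c < v" "Complex u v \<in> Dom" "Im (H (Complex u v)) = 0"
proof -
  \<comment> \<open>At height at least sqrt t the kernel is at most 1/t, so the energy crosses the
    level 1/t between c and b.\<close>
  define b where "b = sqrt t + c"
  have b: "c \<le> b" "0 < b" "sqrt t \<le> b" using assms t by (auto simp: b_def add_pos_pos)
  have "energy (Complex u b) \<le> 1 / t"
  proof -
    have "norm (energy (Complex u b)) \<le> (LINT x|N. 1 / t)"
      unfolding energy_def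
    proof (rule norm_LINT_le[OF integrable_const])
      show "AE x in N. norm (1 / (cmod (Complex u b - complex_of_real x))\<^sup>2) \<le> 1 / t"
        using AE_Im_le_norm_diff[of "Complex u b"]
      proof eventually_elim
        case (elim x)
        then have "(sqrt t)\<^sup>2 \<le> (cmod (Complex u b - complex_of_real x))\<^sup>2"
          using b t by (intro power_mono) auto
        then show ?case using t by (auto intro!: frac_le)
      qed
    qed auto
    then show ?thesis using prob_space by simp
  qed
  then obtain v where v: "c \<le> v" "v \<le> b" "energy (Complex u v) = 1 / t"
    using IVT2'[of "\<lambda>v. energy (Complex u v)" b "1 / t" c] b assms continuous_on_energy_vertical[OF assms(1)] by auto
  moreover have "c \<noteq> v" using v assms by auto
  ultimately show ?thesis using that[of v] boundary_point[of v u] assms by auto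
qed

lemma boundary_point_below:
  assumes "0 < c" "energy (Complex u c) < 1 / t" "u \<in> {0..l}"
  obtains v where "v < c" "Complex u v \<in> Dom" "Im (H (Complex u v)) = 0"
proof -
  \<comment> \<open>The point u + i a is closer than \<open>d\<close> to u in [0, l], so by
    \<open>gap\<close> its energy exceeds 1/t.\<close>
  define a where "a = min c (d / 2)"
  have a: "0 < a" "a \<le> c" "a < d" using assms d by (auto simp: a_def)
  have "1 / t \<le> energy (Complex u a)"
  proof (rule ccontr)
    assume "\<not> ?thesis"
    then have "d \<le> cmod (Complex u a - complex_of_real u)"
      using gap[of "Complex u a" u] a assms by (auto simp: energy_def)
    then show False using a by (simp add: cmod_def)
  qed
  then obtain v where v: "a \<le> v" "v \<le> c" "energy (Complex u v) = 1 / t"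
    using IVT2'[of "\<lambda>v. energy (Complex u v)" c "1 / t" a] a assms continuous_on_energy_vertical[OF a(1)] by auto
  moreover have "c \<noteq> v" using v assms by auto
  ultimately show ?thesis using that[of v] boundary_point[of v u] a by auto
qed

end

section \<open>An atom at the end of a uniform distribution\<close>

text \<open>Collapsing [-q, 0] to the point 0 turns part of a uniform law on [-q, l] into an atom of
  weight q/(q + l), so integrals and null sets reduce to Lebesgue measure.\<close>

definition atom_uniform :: "real \<Rightarrow> real \<Rightarrow> real measure" where
  "atom_uniform q l =
     distr (density lborel (\<lambda>x. ennreal (indicator {-q..l} x / (q + l)))) borel (max 0)"

context
  fixes q l :: real
  assumes q: "0 < q" and l: "0 < l"
begin

definition uniform_base :: "real measure" where
  "uniform_base = density lborel (\<lambda>x. ennreal (indicator {-q..l} x / (q + l)))"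

lemma sets_uniform_base [simp, measurable_cong]: "sets uniform_base = sets borel"
  by (simp add: uniform_base_def)

lemma emeasure_uniform_base:
  assumes "A \<in> sets borel"
  shows "emeasure uniform_base A = ennreal (1 / (q + l)) * emeasure lborel ({-q..l} \<inter> A)"
proof -
  have "emeasure uniform_base A = (\<integral>\<^sup>+x. ennreal (indicator {-q..l} x / (q + l)) * indicator A x \<partial>lborel)"
    unfolding uniform_base_def using assms by (intro emeasure_density) auto
  also have "\<dots> = (\<integral>\<^sup>+x. ennreal (1 / (q + l)) * indicator ({-q..l} \<inter> A) x \<partial>lborel)"
    by (intro nn_integral_cong) (auto simp: indicator_def)
  also have "\<dots> = ennreal (1 / (q + l)) * emeasure lborel ({-q..l} \<inter> A)"
    using assms by (intro nn_integral_cmult_indicator) auto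
  finally show ?thesis .
qed

lemma prob_space_uniform_base: "prob_space uniform_base"
proof
  have "emeasure uniform_base UNIV = ennreal (1 / (q + l)) * ennreal (q + l)"
    using q l by (subst emeasure_uniform_base) (auto simp: add.commute)
  also have "\<dots> = ennreal (1 / (q + l) * (q + l))"
    using q l by (intro ennreal_mult[symmetric]) auto
  also have "\<dots> = 1" using q l by simp
  finally show "emeasure uniform_base (space uniform_base) = 1" by (simp add: uniform_base_def)
qed

lemma atom_uniform_eq: "atom_uniform q l = distr uniform_base borel (max 0)"
  by (simp add: atom_uniform_def uniform_base_def)

lemma max_zero_measurable: "(max 0 :: real \<Rightarrow> real) \<in> borel_measurable uniform_base"
proof -
  have "(\<lambda>x::real. max 0 x) \<in> borel_measurable uniform_base" by measurable
  then show ?thesis by simp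
qed

lemma real_distribution_atom_uniform: "real_distribution (atom_uniform q l)"
  unfolding atom_uniform_eq
  by (rule prob_space.real_distribution_distr[OF prob_space_uniform_base max_zero_measurable])

lemma emeasure_atom_uniform:
  assumes "A \<in> sets borel"
  shows "emeasure (atom_uniform q l) A = ennreal (1 / (q + l)) * emeasure lborel ({-q..l} \<inter> max 0 -` A)"
proof -
  have vm: "max 0 -` A \<in> sets borel"
    using measurable_sets[OF max_zero_measurable assms] by (simp add: uniform_base_def)
  have "emeasure (atom_uniform q l) A = emeasure uniform_base (max 0 -` A)"
    unfolding atom_uniform_eq using emeasure_distr[OF max_zero_measurable assms] by (simp add: uniform_base_def)
  then show ?thesis using emeasure_uniform_base[OF vm] by simp
qed

lemma unimodal_atom_uniform: "unimodal (atom_uniform q l)"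
  unfolding unimodal_def
proof (intro conjI exI ballI allI)
  let ?f = "\<lambda>x. indicator {0<..l} x / (q + l) :: real"
  show "sets (atom_uniform q l) = sets borel" by (simp add: atom_uniform_def)
  show "0 \<le> ?f x" for x using q l by simp
  show "mono_on {..<0} ?f" by (rule mono_onI) simp
  show "antimono_on {0<..} ?f"
    using q l by (auto simp: monotone_on_def indicator_def divide_right_mono)
  fix A :: "real set" assume A: "A \<in> sets borel"
  have f: "emeasure (density lborel (\<lambda>x. ennreal (?f x))) A = ennreal (1 / (q + l)) * emeasure lborel ({0<..l} \<inter> A)"
  proof -
    have "emeasure (density lborel (\<lambda>x. ennreal (?f x))) A = (\<integral>\<^sup>+x. ennreal (?f x) * indicator A x \<partial>lborel)"
      using A by (intro emeasure_density) auto
    also have "\<dots> = (\<integral>\<^sup>+x. ennreal (1 / (q + l)) * indicator ({0<..l} \<inter> A) x \<partial>lborel)"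
      by (intro nn_integral_cong) (auto simp: indicator_def)
    also have "\<dots> = ennreal (1 / (q + l)) * emeasure lborel ({0<..l} \<inter> A)"
      using A by (intro nn_integral_cmult_indicator) auto
    finally show ?thesis .
  qed
  have "{-q..l} \<inter> max 0 -` {0} = {-q..0}" using q l by auto
  then have zero: "emeasure (atom_uniform q l) {0} = ennreal (1 / (q + l)) * emeasure lborel {-q..0}"
    by (subst emeasure_atom_uniform) auto
  show "emeasure (atom_uniform q l) A = emeasure (atom_uniform q l) {0} * emeasure (return borel 0) A
      + emeasure (density lborel (\<lambda>x. ennreal (?f x))) A"
  proof (cases "0 \<in> A")
    case True
    have "{-q..l} \<inter> max 0 -` A = {-q..0} \<union> ({0<..l} \<inter> A)"
      using True q l by (auto simp: max_def split: if_splits)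
    moreover have "emeasure lborel ({-q..0} \<union> ({0<..l} \<inter> A)) = emeasure lborel {-q..0} + emeasure lborel ({0<..l} \<inter> A)"
      using A by (intro plus_emeasure[symmetric]) auto
    ultimately show ?thesis
      unfolding f zero emeasure_atom_uniform[OF A] using True A by (simp add: distrib_left)
  next
    case False
    have "x \<in> {-q..l} \<inter> max 0 -` A \<longleftrightarrow> x \<in> {0<..l} \<inter> A" for x
      using False q by (cases "0 < x") (auto simp: max_def)
    then have "{-q..l} \<inter> max 0 -` A = {0<..l} \<inter> A" by blast
    then show ?thesis unfolding f emeasure_atom_uniform[OF A] using False A by simp
  qed
qed

lemma AE_atom_uniform:
  assumes "{x. P x} \<in> sets borel"
  shows "(AE x in atom_uniform q l. P x) \<longleftrightarrow> (AE x in lborel. x \<in> {-q..l} \<longrightarrow> P (max 0 x))"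
proof -
  have "(AE x in atom_uniform q l. P x) \<longleftrightarrow> (AE x in uniform_base. P (max 0 x))"
    unfolding atom_uniform_eq using assms by (intro AE_distr_iff max_zero_measurable) auto
  also have "\<dots> \<longleftrightarrow> (AE x in lborel. 0 < ennreal (indicator {-q..l} x / (q + l)) \<longrightarrow> P (max 0 x))"
    unfolding uniform_base_def by (intro AE_density) auto
  also have "\<dots> \<longleftrightarrow> (AE x in lborel. x \<in> {-q..l} \<longrightarrow> P (max 0 x))"
    using q l by (intro AE_cong) (auto simp: indicator_def)
  finally show ?thesis .
qed

lemma atom_uniform_support: "AE x in atom_uniform q l. x \<in> {0..l}"
  using l by (subst AE_atom_uniform) auto

lemma atom_uniform_not_dirac: "\<not> (AE x in atom_uniform q l. x = x0)"
proof
  assume "AE x in atom_uniform q l. x = x0"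
  then have ae: "AE x in lborel. x \<in> {-q..l} \<longrightarrow> max 0 x = x0"
    by (subst (asm) AE_atom_uniform) auto
  obtain x where "0 < x" "x < l / 2" "x \<in> {-q..l} \<longrightarrow> max 0 x = x0"
    by (rule AE_lborel_interval_witness[OF ae, of 0 "l / 2"]) (use l in auto)
  moreover obtain y where "l / 2 < y" "y < l" "y \<in> {-q..l} \<longrightarrow> max 0 y = x0"
    by (rule AE_lborel_interval_witness[OF ae, of "l / 2" l]) (use l in auto)
  ultimately show False using q l by auto
qed

lemma measure_atom_uniform_interval:
  assumes "0 \<le> a" "a \<le> b" "b \<le> l"
  shows "(b - a) / (q + l) \<le> measure (atom_uniform q l) {a..b}"
proof -
  interpret real_distribution "atom_uniform q l" by (rule real_distribution_atom_uniform)
  have "ennreal ((b - a) / (q + l)) = ennreal (1 / (q + l)) * emeasure lborel {a..b}"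
    using assms q l by (simp flip: ennreal_mult')
  also have "\<dots> \<le> emeasure (atom_uniform q l) {a..b}"
  proof -
    have "max 0 -` {a..b} \<in> sets borel"
      using measurable_sets[OF max_zero_measurable, of "{a..b}"] by (simp add: uniform_base_def)
    then have "emeasure lborel {a..b} \<le> emeasure lborel ({-q..l} \<inter> max 0 -` {a..b})"
      using assms q by (intro emeasure_mono) auto
    then show ?thesis by (subst emeasure_atom_uniform) (auto intro: mult_left_mono)
  qed
  also have "\<dots> = ennreal (measure (atom_uniform q l) {a..b})" by (rule emeasure_eq_measure)
  finally show ?thesis by (simp add: ennreal_le_iff)
qed

text \<open>If w were within d of x0, an interval of length d around or beside x0 would lie within 2
  d of w and carry mass at least d/(q + l). Its energy alone would be at least 1/(4 d (q + l)) \<ge>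
  2/t.\<close>

lemma atom_uniform_gap:
  assumes t: "0 < t" and w: "0 < Im w" and x0: "x0 \<in> {0..l}"
    and le: "(LINT x|atom_uniform q l. 1 / (cmod (w - complex_of_real x))\<^sup>2) \<le> 1 / t"
  shows "min (l / 2) (t / (8 * (q + l))) \<le> cmod (w - complex_of_real x0)"
proof (rule ccontr)
  interpret real_distribution "atom_uniform q l" by (rule real_distribution_atom_uniform)
  define d where "d = min (l / 2) (t / (8 * (q + l)))"
  assume "\<not> ?thesis"
  then have near: "cmod (w - complex_of_real x0) < d"
    unfolding d_def by (rule not_le_imp_less)
  have "d \<le> t / (8 * (q + l))" by (simp add: d_def)
  then have "d * (8 * (q + l)) \<le> t" using q l pos_le_divide_eq[of "8 * (q + l)" d t] by simp
  moreover have "0 < d" using t q l by (simp add: d_def)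
  moreover have "d \<le> l / 2" unfolding d_def by (rule min.cobounded1)
  ultimately have d: "0 < d" "d \<le> l / 2" "d * (8 * (q + l)) \<le> t" by blast+
  \<comment> \<open>The interval extends from x0 towards the farther end of [0, l]; d \<le> l/2
    keeps it inside.\<close>
  define a where "a = (if x0 \<le> l / 2 then x0 else x0 - d)"
  have a: "0 \<le> a" "a + d \<le> l" "x0 \<in> {a..a + d}" using d x0 by (auto simp: a_def)
  have "d / (q + l) / (4 * d\<^sup>2) \<le> measure (atom_uniform q l) {a..a + d} / (4 * d\<^sup>2)"
    using measure_atom_uniform_interval[of a "a + d"] a d by (intro divide_right_mono) auto
  also have "\<dots> = (LINT x|atom_uniform q l. indicator {a..a + d} x / (4 * d\<^sup>2))" by simp
  also have "\<dots> \<le> (LINT x|atom_uniform q l. 1 / (cmod (w - complex_of_real x))\<^sup>2)"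
  proof (rule integral_mono)
    show "integrable (atom_uniform q l) (\<lambda>x. indicator {a..a + d} x / (4 * d\<^sup>2) :: real)"
      by (intro integrable_divide integrable_real_indicator) (auto simp: emeasure_eq_measure)
    show "integrable (atom_uniform q l) (\<lambda>x. 1 / (cmod (w - complex_of_real x))\<^sup>2)"
      by (rule inv_norm_square_integrable[OF w AE_Im_le_norm_diff])
    fix x
    show "indicator {a..a + d} x / (4 * d\<^sup>2) \<le> 1 / (cmod (w - complex_of_real x))\<^sup>2"
    proof (cases "x \<in> {a..a + d}")
      case True
      have "Im w \<le> cmod (w - of_real x)" using abs_Im_le_cmod[of "w - of_real x"] by simp
      then have "0 < cmod (w - of_real x)" using w by linarith
      then have pos: "0 < (cmod (w - of_real x))\<^sup>2" by (rule zero_less_power)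
      have "cmod (w - of_real x) \<le> cmod (w - of_real x0) + cmod (complex_of_real (x0 - x))"
        using norm_triangle_ineq[of "w - of_real x0" "complex_of_real (x0 - x)"] by simp
      also have "\<dots> \<le> d + d" using near True a(3) unfolding norm_of_real by auto
      finally have "(cmod (w - of_real x))\<^sup>2 \<le> (2 * d)\<^sup>2" by (intro power_mono) auto
      then have "1 / (4 * d\<^sup>2) \<le> 1 / (cmod (w - of_real x))\<^sup>2"
        using pos d by (intro divide_left_mono mult_pos_pos) (auto simp: power_mult_distrib)
      then show ?thesis using True by simp
    qed simp
  qed
  also have "\<dots> \<le> 1 / t" by (rule le)
  also have "d / (q + l) / (4 * d\<^sup>2) = 1 / (4 * d * (q + l))" using d by (simp add: power2_eq_square)
  finally have "inverse (4 * d * (q + l)) \<le> inverse t" by (simp add: inverse_eq_divide)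
  then have "t \<le> 4 * d * (q + l)" by (rule inverse_le_imp_le) (use d q l in simp)
  moreover have "0 < d * (q + l)" using d q l by simp
  ultimately show False using d(3) by (simp add: algebra_simps)
qed

lemma atom_uniform_energy:
  assumes v: "0 < v"
  shows "(LINT x|atom_uniform q l. 1 / (cmod (Complex u v - complex_of_real x))\<^sup>2)
     = (q / (u\<^sup>2 + v\<^sup>2) + (arctan ((l - u) / v) + arctan (u / v)) / v) / (q + l)"
proof -
  define k where "k x = 1 / ((x - u)\<^sup>2 + v\<^sup>2)" for x
  have k: "1 / (cmod (Complex u v - complex_of_real x))\<^sup>2 = k x" for x
    by (simp add: k_def cmod_power2 power2_commute)
  have [measurable]: "k \<in> borel_measurable borel" unfolding k_def by measurable
  have "(LINT x|atom_uniform q l. k x) = (LINT x|uniform_base. k (max 0 x))"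
    unfolding atom_uniform_eq by (intro integral_distr max_zero_measurable) simp
  also have "\<dots> = (LINT x|lborel. (indicator {-q..l} x / (q + l)) *\<^sub>R k (max 0 x))"
    unfolding uniform_base_def using q l by (intro integral_density) auto
  also have "\<dots> = (LINT x|lborel. (1 / (q + l)) * (indicator {-q..<0} x * k 0 + k x * indicator {0..l} x))"
    using q l by (intro Bochner_Integration.integral_cong) (auto simp: indicator_def max_def)
  also have "\<dots> = (1 / (q + l)) * (LINT x|lborel. indicator {-q..<0} x * k 0 + k x * indicator {0..l} x)"
    by (rule integral_mult_right_zero)
  also have "(LINT x|lborel. indicator {-q..<0} x * k 0 + k x * indicator {0..l} x)
      = q * k 0 + (arctan ((l - u) / v) / v - arctan ((0 - u) / v) / v)"
  proof (rule has_bochner_integral_integral_eq, rule has_bochner_integral_add)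
    have "has_bochner_integral lborel (indicator {-q..<0} :: real \<Rightarrow> real) (measure lborel {-q..<0})"
      using q by (intro has_bochner_integral_real_indicator) auto
    then have "has_bochner_integral lborel (indicator {-q..<0} :: real \<Rightarrow> real) q" using q by simp
    then show "has_bochner_integral lborel (\<lambda>x. indicator {-q..<0} x * k 0) (q * k 0)"
      by (rule has_bochner_integral_mult_left)
    show "has_bochner_integral lborel (\<lambda>x. k x * indicator {0..l} x) (arctan ((l - u) / v) / v - arctan ((0 - u) / v) / v)"
    proof (rule has_bochner_integral_FTC_Icc_real)
      show "DERIV (\<lambda>x. arctan ((x - u) / v) / v) x :> k x" for x
      proof -
        have "1 + ((x - u) / v)\<^sup>2 = ((x - u)\<^sup>2 + v\<^sup>2) / v\<^sup>2" using v by (simp add: field_simps)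
        then have "1 / v * inverse (1 + ((x - u) / v)\<^sup>2) / v = k x"
          using v by (simp add: k_def power2_eq_square)
        then show ?thesis using v by (auto intro!: derivative_eq_intros)
      qed
      show "isCont k x" for x
        unfolding k_def using v by (intro continuous_intros) simp
    qed (use l in auto)
  qed
  also have "k 0 = 1 / (u\<^sup>2 + v\<^sup>2)" by (simp add: k_def)
  also have "arctan ((0 - u) / v) = - arctan (u / v)" by (simp add: arctan_minus)
  finally show ?thesis unfolding k by (simp add: add_divide_distrib)
qed

end

text \<open>By the mean value theorem arctan x = x/(1 + z^2) for some 0 < z < x.\<close>

lemma arctan_between:
  assumes "0 < x"
  shows "x / (1 + x\<^sup>2) \<le> arctan x" "arctan x \<le> x"
proof -
  have "\<exists>z. 0 < z \<and> z < x \<and> arctan x - arctan 0 = (x - 0) * inverse (1 + z\<^sup>2)"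
    by (rule MVT2[OF assms]) (auto intro: DERIV_arctan)
  then obtain z where z: "0 < z" "z < x" "arctan x = x / (1 + z\<^sup>2)" by (auto simp: divide_inverse)
  have sq: "z\<^sup>2 \<le> x\<^sup>2" using z by (intro power_mono) auto
  show "x / (1 + x\<^sup>2) \<le> arctan x"
    unfolding z(3) using sq assms by (intro divide_left_mono mult_pos_pos) (auto simp: add_pos_nonneg)
  have "x / (1 + z\<^sup>2) \<le> x / 1" using assms by (intro divide_left_mono) (auto simp: add_pos_nonneg)
  then show "arctan x \<le> x" unfolding z(3) by simp
qed

theorem lemma3p9:
  fixes t :: real
  assumes "t > 0"
  shows "\<not> freely_strongly_unimodal (semicircle t)"
proof
  assume fsu: "freely_strongly_unimodal (semicircle t)"
  \<comment> \<open>Chosen so that 103 c^2/t = pi - 1/20; with abscissae in units of c, the level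
    1/t then becomes pi - 1/20 and t drops out.\<close>
  define c where "c = sqrt (t * (pi - 1 / 20) / 103)"
  have pi: "3 < pi" "pi < 4" using pi_gt3 pi_less_4 by auto
  have c: "0 < c" using assms pi by (simp add: c_def)
  have c2: "c\<^sup>2 = t * (pi - 1 / 20) / 103" using assms pi by (simp add: c_def)
  define N where "N = atom_uniform (3 * c) (100 * c)"
  define d where "d = min (100 * c / 2) (t / (8 * (3 * c + 100 * c)))"
  have pos: "0 < 3 * c" "0 < 100 * c" using c by auto
  interpret N: real_distribution N unfolding N_def by (rule real_distribution_atom_uniform[OF pos])
  interpret semicircle_convolution N t "100 * c" d
  proof
    show "0 < d" using assms c by (auto simp: d_def)
    show "AE x in N. x \<in> {0..100 * c}" unfolding N_def by (rule atom_uniform_support[OF pos])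
    show "\<not> (AE x in N. x = x0)" for x0 unfolding N_def by (rule atom_uniform_not_dirac[OF pos])
    show "d \<le> cmod (w - complex_of_real x)"
      if "0 < Im w" "(LINT x|N. 1 / (cmod (w - complex_of_real x))\<^sup>2) \<le> 1 / t" "x \<in> {0..100 * c}" for w x
      unfolding d_def by (rule atom_uniform_gap[OF pos assms that(1,3) that(2)[unfolded N_def]])
  qed (use assms c in auto)
  have energy: "energy (Complex (c * s) c) = (3 / (s\<^sup>2 + 1) + arctan (100 - s) + arctan s) / (103 * c\<^sup>2)" for s
  proof -
    have a: "(100 * c - c * s) / c = 100 - s" "c * s / c = s" using c by (simp_all add: field_simps)
    have b: "(c * s)\<^sup>2 + c\<^sup>2 = c\<^sup>2 * (s\<^sup>2 + 1)" by (simp add: power_mult_distrib algebra_simps)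
    have e: "3 * c / (c\<^sup>2 * (s\<^sup>2 + 1)) = 3 / (s\<^sup>2 + 1) / c" using c by (simp add: power2_eq_square)
    have f: "(x / c + y / c) / (3 * c + 100 * c) = (x + y) / (103 * c\<^sup>2)" for x y
      using c by (simp add: power2_eq_square add_divide_distrib)
    show ?thesis
      unfolding energy_def unfolding N_def atom_uniform_energy[OF pos c] a b e f
      by (simp add: add.assoc)
  qed
  have level: "1 / t = (pi - 1 / 20) / (103 * c\<^sup>2)" unfolding c2 using assms pi by simp
  have pos2: "0 < 103 * c\<^sup>2" using c by simp
  have inv: "arctan (1 / x) = pi / 2 - arctan x" if "0 < x" for x using arctan_inverse[of x] that by (simp add: inverse_eq_divide)
  have "1 / t < energy (Complex (c * 0) c)"
  proof -
    \<comment> \<open>At the atom the crude value 3 + pi/4 already exceeds pi, because pi <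
      4.\<close>
    have "arctan 1 \<le> arctan 100" by (rule arctan_monotone') simp
    then have "pi - 1 / 20 < 3 + arctan 100" using pi arctan_one by linarith
    then show ?thesis unfolding energy level using pos2 by (intro divide_strict_right_mono) auto
  qed
  then obtain v1 where v1: "c < v1" "Complex (c * 0) v1 \<in> Dom" "Im (H (Complex (c * 0) v1)) = 0"
    by (rule boundary_point_above[OF c])
  have "1 / t < energy (Complex (c * 50) c)"
  proof -
    \<comment> \<open>At the midpoint both arctangents equal arctan 50 \<ge> pi/2 - 1/50, so the sum
      exceeds pi - 1/25.\<close>
    have "arctan (1 / 50) \<le> 1 / 50" by (rule arctan_between) simp
    then have "pi - 1 / 20 < 3 / (50\<^sup>2 + 1) + arctan (100 - 50) + arctan 50"
      using inv[of 50] by simp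
    then show ?thesis unfolding energy level using pos2 by (intro divide_strict_right_mono) auto
  qed
  then obtain v3 where v3: "c < v3" "Complex (c * 50) v3 \<in> Dom" "Im (H (Complex (c * 50) v3)) = 0"
    by (rule boundary_point_above[OF c])
  have "energy (Complex (c * 4) c) < 1 / t"
  proof -
    \<comment> \<open>Here the deficit pi/2 - arctan 4 \<ge> 4/17 outweighs the contribution 3/17 of
      the atom, which leaves less than pi - 1/17 < pi - 1/20.\<close>
    have "(1 / 4) / (1 + (1 / 4)\<^sup>2) \<le> arctan (1 / 4 :: real)" by (rule arctan_between) simp
    then have "4 / 17 \<le> pi / 2 - arctan 4" using inv[of 4] by (simp add: power2_eq_square)
    moreover have "arctan 96 < pi / 2" by (rule arctan_ubound)
    ultimately have "3 / (4\<^sup>2 + 1) + arctan (100 - 4) + arctan 4 < pi - 1 / 20" by simp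
    then show ?thesis unfolding energy level using pos2 by (intro divide_strict_right_mono) auto
  qed
  moreover have "c * 4 \<in> {0..100 * c}" using c by simp
  ultimately obtain v2 where v2: "v2 < c" "Complex (c * 4) v2 \<in> Dom" "Im (H (Complex (c * 4) v2)) = 0"
    by (rule boundary_point_below[OF c])
  have "\<not> unimodal L"
    by (rule not_unimodal_L[OF v1(2) v2(2) v3(2) v1(3) v2(3) v3(3)]) (use c v1 v2 v3 in auto)
  moreover have "unimodal (semicircle t \<boxplus> N)"
    using fsu N.real_distribution_axioms unimodal_atom_uniform[OF pos]
    unfolding freely_strongly_unimodal_def N_def by blast
  ultimately show False unfolding free_convolution_semicircle by blast
qed

end
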